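(* Let $(x_j,r_j)_{j\in I}$ be a particle configuration with $\mu_0:=\sup_{j\in I}r_jd_j^{-3}<\infty$ and $d_j/2>\kappa r_j$ for all $j\in I$, for some constant $\kappa>1$. There exists $\gamma_0>0$ depending only on $\mu_0$ and $\kappa$ such that for every $f\in\dot H^{-1}(\mathbb{R}^3)$ and every $0<\gamma<\gamma_0$ the sequence $$\Big(1-\gamma\sum_{j\in I}e^{-|x_j|}Q_j\Big)^N(-\Delta)^{-1}f,\qquad N\in\mathbb{N},$$ converges in $\dot H^1(\mathbb{R}^3)$ as $N\to\infty$ to the solution of $$-\Delta u=f\ \text{ in }\mathbb{R}^3\setminus K,\qquad u=0\ \text{ in }K.$$
   Context: Particle configuration: $I$ is a finite or countable index set; $x_j\in\mathbb{R}^3$ are centers, $r_j>0$ radii, $B_j:=B_{r_j}(x_j)$, $K:=\bigcup_{j\in I}\overline{B_j}$, and $d_j:=\inf_{k\ne j}|x_j-x_k|$. $\dot H^1(\mathbb{R}^3)=\{v\in L^6(\mathbb{R}^3):\nabla v\in L^2(\mathbb{R}^3)\}$ with inner product $(u,v)=\int\nabla u\cdot\nabla v$; $\dot H^{-1}(\mathbb{R}^3)$ is its dual, and $(-\Delta)^{-1}:\dot H^{-1}(\mathbb{R}^3)\to\dot H^1(\mathbb{R}^3)$ is the (isometric) inverse of $-\Delta$. $Q_j$ is the orthogonal projection in $\dot H^1(\mathbb{R}^3)$ onto the orthogonal complement of $\{v\in\dot H^1(\mathbb{R}^3):v=0\text{ in }\overline{B_j}\}$; equivalently, $Q_jw=w$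 in $\overline{B_j}$ and $-\Delta Q_jw=0$ in $\mathbb{R}^3\setminus\overline{B_j}$. Solution: $u\in\dot H^1(\mathbb{R}^3)$ with $u=0$ in $K$ and $\int\nabla u\cdot\nabla v=\langle f,v\rangle$ for all $v\in\dot H^1(\mathbb{R}^3)$ with $v=0$ in $K$ (it exists and is unique). *)

theory Defs
  imports "HOL-Analysis.Analysis"
begin

section \<open>Weak gradients\<close>

text \<open>A function is smooth if it is differentiable and all its partial derivatives (the components
  of its gradient \<^term>\<open>G\<close>) are again smooth, coinductively.\<close>

coinductive smooth :: "(real^3 \<Rightarrow> real) \<Rightarrow> bool" where
  smoothI: "\<lbrakk>\<And>x. (\<phi> has_derivative (\<lambda>h. G x \<bullet> h)) (at x); \<And>i. smooth (\<lambda>x. G x $ i)\<rbrakk> \<Longrightarrow> smooth \<phi>"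

definition test_function :: "(real^3 \<Rightarrow> real) \<Rightarrow> bool" where
  "test_function \<phi> \<longleftrightarrow> smooth \<phi> \<and> compact (closure {x. \<phi> x \<noteq> 0})"

definition partial_deriv :: "3 \<Rightarrow> (real^3 \<Rightarrow> real) \<Rightarrow> real^3 \<Rightarrow> real" where
  "partial_deriv i \<phi> x = frechet_derivative \<phi> (at x) (axis i 1)"

definition weak_gradient :: "(real^3 \<Rightarrow> real) \<Rightarrow> (real^3 \<Rightarrow> real^3) \<Rightarrow> bool" where
  "weak_gradient v g \<longleftrightarrow>
     (\<forall>\<phi> i. test_function \<phi> \<longrightarrow>
        (LINT x|lborel. v x * partial_deriv i \<phi> x) = - (LINT x|lborel. g x $ i * \<phi> x))"

text \<open>Uniqueness of weak gradients (du Bois-Reymond), via tensor products of one-dimensional bump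
  functions converging to indicators of boxes; a function in $L^6$ with vanishing weak gradient is
  zero, since its integrals against a test function and against its translates agree. These make
  the inner product below well defined and definite.\<close>

primrec diffable_upto :: "nat \<Rightarrow> (real \<Rightarrow> real) \<Rightarrow> bool" where
  "diffable_upto 0 f \<longleftrightarrow> True"
| "diffable_upto (Suc n) f \<longleftrightarrow> (\<exists>f'. (\<forall>x. (f has_real_derivative f' x) (at x)) \<and> diffable_upto n f')"

lemma diffable_upto_SucD: "diffable_upto (Suc n) f \<Longrightarrow> diffable_upto n f"
proof (induction n arbitrary: f)
  case (Suc n)
  then obtain f' where "\<forall>x. (f has_real_derivative f' x) (at x)" "diffable_upto (Suc n) f'"
    by (metis diffable_upto.simps(2))
  with Suc.IH show ?case by (metis diffable_upto.simps(2))
qed simp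

lemma diffable_upto_const: "diffable_upto n (\<lambda>x. c)"
proof (induction n arbitrary: c)
  case (Suc n)
  show ?case by (auto intro!: exI[of _ "\<lambda>x. 0"] Suc)
qed simp

lemma diffable_upto_add:
  "diffable_upto n f \<Longrightarrow> diffable_upto n g \<Longrightarrow> diffable_upto n (\<lambda>x. f x + g x)"
proof (induction n arbitrary: f g)
  case (Suc n)
  then obtain f' g' where f': "\<forall>x. (f has_real_derivative f' x) (at x)" "diffable_upto n f'"
    and g': "\<forall>x. (g has_real_derivative g' x) (at x)" "diffable_upto n g'"
    by auto
  show ?case using f' g' Suc.IH
    by (auto intro!: exI[of _ "\<lambda>x. f' x + g' x"] derivative_eq_intros)
qed simp

lemma diffable_upto_mult:
  "diffable_upto n f \<Longrightarrow> diffable_upto n g \<Longrightarrow> diffable_upto n (\<lambda>x. f x * g x)"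
proof (induction n arbitrary: f g)
  case (Suc n)
  then obtain f' g' where f': "\<forall>x. (f has_real_derivative f' x) (at x)" "diffable_upto n f'"
    and g': "\<forall>x. (g has_real_derivative g' x) (at x)" "diffable_upto n g'"
    by auto
  have "diffable_upto n f" "diffable_upto n g"
    using Suc.prems diffable_upto_SucD by blast+
  then have "diffable_upto n (\<lambda>x. f' x * g x + g' x * f x)"
    using f'(2) g'(2) Suc.IH by (intro diffable_upto_add) auto
  moreover have "((\<lambda>x. f x * g x) has_real_derivative f' x * g x + g' x * f x) (at x)" for x
    using f' g' by (intro DERIV_mult) auto
  ultimately show ?case by (auto simp: intro!: exI[of _ "\<lambda>x. f' x * g x + g' x * f x"])
qed simp

lemma diffable_upto_affine:
  "diffable_upto n f \<Longrightarrow> diffable_upto n (\<lambda>x. f (a * x + b))"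
proof (induction n arbitrary: f)
  case (Suc n)
  then obtain f' where f': "\<forall>x. (f has_real_derivative f' x) (at x)" "diffable_upto n f'"
    by auto
  have "((\<lambda>x. f (a * x + b)) has_real_derivative f' (a * x + b) * a) (at x)" for x
    by (rule DERIV_chain2[where f = f and g = "\<lambda>x. a * x + b"])
       (use f' in \<open>auto intro!: derivative_eq_intros\<close>)
  moreover have "diffable_upto n (\<lambda>x. f' (a * x + b) * a)"
    using Suc.IH[OF f'(2)] by (intro diffable_upto_mult diffable_upto_const)
  ultimately show ?case by (auto intro!: exI[of _ "\<lambda>x. f' (a * x + b) * a"])
qed simp

definition flat_exp :: "nat \<Rightarrow> real \<Rightarrow> real" where
  "flat_exp k t = (if t > 0 then (1 / t) ^ k * exp (- (1 / t)) else 0)"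

lemma flat_exp_tendsto_0: "(flat_exp k \<longlongrightarrow> 0) (at 0)"
proof -
  have "((\<lambda>t::real. (1 / t) ^ k * exp (- (1 / t))) \<longlongrightarrow> 0) (at_right 0)"
  proof -
    have "((\<lambda>s::real. s ^ k / exp s) \<longlongrightarrow> 0) at_top" by (rule tendsto_power_div_exp_0)
    moreover have "filterlim (\<lambda>t::real. 1 / t) at_top (at_right 0)"
      using filterlim_inverse_at_top_right by (simp add: inverse_eq_divide)
    ultimately have "((\<lambda>t::real. (1 / t) ^ k / exp (1 / t)) \<longlongrightarrow> 0) (at_right 0)"
      by (rule filterlim_compose)
    then show ?thesis by (simp add: exp_minus field_simps)
  qed
  then have "(flat_exp k \<longlongrightarrow> 0) (at_right 0)"
    by (rule Lim_transform_eventually)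
       (auto simp: flat_exp_def eventually_at_right_field intro!: exI[of _ 1])
  moreover have "(flat_exp k \<longlongrightarrow> 0) (at_left 0)"
    by (rule Lim_transform_eventually[of "\<lambda>_. 0"])
       (auto simp: flat_exp_def eventually_at_left_field intro!: exI[of _ "-1"])
  ultimately show ?thesis by (simp add: filterlim_at_split)
qed

lemma flat_exp_deriv: "(flat_exp k has_real_derivative - real k * flat_exp (Suc k) t + flat_exp (Suc (Suc k)) t) (at t)"
proof -
  consider "t > 0" | "t < 0" | "t = 0" by linarith
  then show ?thesis
  proof cases
    case 1
    have "((\<lambda>t. (1 / t) ^ k * exp (- (1 / t))) has_real_derivative
             - real k * flat_exp (Suc k) t + flat_exp (Suc (Suc k)) t) (at t)"
    proof (cases k)
      case 0
      then show ?thesis using 1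
        by (auto intro!: derivative_eq_intros simp: flat_exp_def field_simps power2_eq_square)
    next
      case (Suc m)
      have "((\<lambda>t. (1 / t) ^ Suc m) has_real_derivative
          real (Suc m) * (1 / t) ^ m * (- (1 / t\<^sup>2))) (at t)"
      proof -
        have "((\<lambda>t. 1 / t) has_real_derivative - (1 / t\<^sup>2)) (at t)"
          using 1 by (auto intro!: derivative_eq_intros simp: power2_eq_square)
        from DERIV_power[OF this, of "Suc m"] show ?thesis by (simp add: algebra_simps add_divide_distrib)
      qed
      moreover have "((\<lambda>t. exp (- (1 / t))) has_real_derivative exp (- (1 / t)) * (1 / t\<^sup>2)) (at t)"
        using 1 by (auto intro!: derivative_eq_intros simp: power2_eq_square field_simps)
      ultimately have "((\<lambda>t. (1 / t) ^ Suc m * exp (- (1 / t))) has_real_derivative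
          real (Suc m) * (1 / t) ^ m * (- (1 / t\<^sup>2)) * exp (- (1 / t))
          + exp (- (1 / t)) * (1 / t\<^sup>2) * (1 / t) ^ Suc m) (at t)"
        by (rule DERIV_mult)
      then show ?thesis
        using 1 Suc by (simp add: flat_exp_def power2_eq_square power_divide field_simps)
    qed
    then show ?thesis
      by (rule has_field_derivative_transform_within_open[where S = "{0<..}"])
         (use 1 in \<open>auto simp: flat_exp_def\<close>)
  next
    case 2
    have "((\<lambda>t. 0) has_real_derivative - real k * flat_exp (Suc k) t + flat_exp (Suc (Suc k)) t) (at t)"
      using 2 by (auto simp: flat_exp_def)
    then show ?thesis
      by (rule has_field_derivative_transform_within_open[where S = "{..<0}"])
         (use 2 in \<open>auto simp: flat_exp_def\<close>)
  next
    case 3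
    have "((\<lambda>h. (flat_exp k (0 + h) - flat_exp k 0) / h) \<longlongrightarrow> 0) (at 0)"
      by (rule Lim_transform_eventually[OF flat_exp_tendsto_0[of "Suc k"]])
         (auto simp: flat_exp_def eventually_at_filter)
    then show ?thesis using 3 by (simp add: DERIV_def flat_exp_def)
  qed
qed

lemma diffable_upto_flat_exp: "diffable_upto n (flat_exp k)"
proof (induction n arbitrary: k)
  case (Suc n)
  have "diffable_upto n (\<lambda>t. - real k * flat_exp (Suc k) t + flat_exp (Suc (Suc k)) t)"
    by (intro diffable_upto_add diffable_upto_mult diffable_upto_const Suc)
  then show ?case unfolding diffable_upto.simps
    by (intro exI[of _ "\<lambda>t. - real k * flat_exp (Suc k) t + flat_exp (Suc (Suc k)) t"] conjI allI flat_exp_deriv)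
qed simp

definition smooth1 :: "(real \<Rightarrow> real) \<Rightarrow> bool" where
  "smooth1 f \<longleftrightarrow> (\<forall>n. diffable_upto n f)"

lemma smooth1_deriv: "smooth1 f \<Longrightarrow> (\<forall>x. (f has_real_derivative f' x) (at x)) \<Longrightarrow> smooth1 f'"
  unfolding smooth1_def
proof
  fix n assume "\<forall>n. diffable_upto n f" and *: "\<forall>x. (f has_real_derivative f' x) (at x)"
  then obtain g where g: "\<forall>x. (f has_real_derivative g x) (at x)" "diffable_upto n g"
    by (meson diffable_upto.simps(2))
  with * have "g = f'" by (intro ext) (blast intro: DERIV_unique)
  with g show "diffable_upto n f'" by simp
qed

lemma smooth1_antideriv: "smooth1 f' \<Longrightarrow> (\<forall>x. (f has_real_derivative f' x) (at x)) \<Longrightarrow> smooth1 f"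
  unfolding smooth1_def by (metis diffable_upto.simps(2) not0_implies_Suc diffable_upto.simps(1))

lemma smooth1E:
  assumes "smooth1 f" obtains f' where "smooth1 f'" "\<forall>x. (f has_real_derivative f' x) (at x)"
  using assms smooth1_deriv unfolding smooth1_def by (metis diffable_upto.simps(2))

definition tensor :: "(3 \<Rightarrow> real \<Rightarrow> real) \<Rightarrow> real^3 \<Rightarrow> real" where
  "tensor a x = (\<Prod>i\<in>UNIV. a i (x $ i))"

lemma tensor_has_derivative:
  assumes "\<And>i x. (a i has_real_derivative a' i x) (at x)"
  shows "(tensor a has_derivative (\<lambda>h. (\<chi> k. tensor (a(k := a' k)) x) \<bullet> h)) (at x)"
proof -
  have 1: "((\<lambda>x. a i (x $ i)) has_derivative (\<lambda>h. a' i (x $ i) * (h $ i))) (at x)" for i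
  proof -
    have "((\<lambda>x. x $ i) has_derivative (\<lambda>h. h $ i)) (at x)"
      by (rule bounded_linear.has_derivative[OF bounded_linear_vec_nth has_derivative_ident])
    moreover have "(a i has_derivative (\<lambda>h. a' i (x $ i) * h)) (at (x $ i))"
      using assms[of i "x $ i"] by (simp add: has_field_derivative_def)
    ultimately show ?thesis by (rule has_derivative_compose)
  qed
  have "((\<lambda>x. \<Prod>i\<in>UNIV. a i (x $ i)) has_derivative
     (\<lambda>h. \<Sum>i\<in>UNIV. a' i (x $ i) * (h $ i) * (\<Prod>j\<in>UNIV - {i}. a j (x $ j)))) (at x)"
    by (rule has_derivative_prod) (rule 1)
  moreover have "a' i (x $ i) * (h $ i) * (\<Prod>j\<in>UNIV - {i}. a j (x $ j))
      = tensor (a(i := a' i)) x * h $ i" for i h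
    unfolding tensor_def by (subst (2) prod.remove[of _ i]) (auto intro!: prod.cong)
  ultimately show ?thesis by (simp add: tensor_def[abs_def] inner_vec_def)
qed

lemma smooth_tensor:
  assumes "\<And>i. smooth1 (a i)" shows "smooth (tensor a)"
  using assms
proof (coinduction arbitrary: a rule: smooth.coinduct)
  case (smooth a)
  then have "\<forall>i. \<exists>f'. smooth1 f' \<and> (\<forall>x. (a i has_real_derivative f' x) (at x))"
    using smooth1E by metis
  then obtain a' where a': "\<And>i. smooth1 (a' i)" "\<And>i x. (a i has_real_derivative a' i x) (at x)"
    by metis
  show ?case
    apply (rule exI[of _ "tensor a"], rule exI[of _ "\<lambda>x. (\<chi> k. tensor (a(k := a' k)) x)"])
    using tensor_has_derivative[OF a'(2)] smooth a'(1)
    by (auto intro!: exI[of _ "a(_ := a' _)"] )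
qed

lemma partial_deriv_eq:
  assumes "(\<phi> has_derivative (\<lambda>h. G \<bullet> h)) (at x)"
  shows "partial_deriv i \<phi> x = G $ i"
  using fun_cong[OF frechet_derivative_at[OF assms], of "axis i 1"]
  by (simp add: partial_deriv_def inner_axis)

lemma smooth_continuous: "smooth \<phi> \<Longrightarrow> continuous_on UNIV \<phi>"
  by (erule smooth.cases) (metis continuous_at_imp_continuous_on has_derivative_continuous)

lemma smooth_partial_deriv: "smooth \<phi> \<Longrightarrow> smooth (partial_deriv i \<phi>)"
proof (erule smooth.cases)
  fix \<psi> G assume "\<phi> = \<psi>" and 1: "\<And>x. (\<psi> has_derivative (\<lambda>h. G x \<bullet> h)) (at x)"
    and 2: "\<And>i. smooth (\<lambda>x. G x $ i)"
  have "partial_deriv i \<phi> = (\<lambda>x. G x $ i)"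
    using partial_deriv_eq[OF 1] \<open>\<phi> = \<psi>\<close> by auto
  with 2 show ?thesis by simp
qed

lemma test_function_partial_deriv:
  assumes "test_function \<phi>" shows "test_function (partial_deriv i \<phi>)"
proof -
  have "partial_deriv i \<phi> x = 0" if "x \<notin> closure {x. \<phi> x \<noteq> 0}" for x
  proof -
    have "(\<phi> has_derivative (\<lambda>h. 0)) (at x)"
    proof (rule has_derivative_transform_within_open)
      show "((\<lambda>x. 0) has_derivative (\<lambda>h. 0)) (at x)" by simp
      show "open (- closure {x. \<phi> x \<noteq> 0})" by (intro open_Compl closed_closure)
      show "x \<in> - closure {x. \<phi> x \<noteq> 0}" using that by simp
      show "0 = \<phi> y" if "y \<in> - closure {x. \<phi> x \<noteq> 0}" for y
      proof (rule ccontr)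
        assume "0 \<noteq> \<phi> y"
        then have "y \<in> closure {x. \<phi> x \<noteq> 0}" by (intro subsetD[OF closure_subset]) simp
        with that show False by simp
      qed
    qed
    then have "(\<phi> has_derivative (\<lambda>h. 0 \<bullet> h)) (at x)" by simp
    then have "partial_deriv i \<phi> x = 0 $ i" by (rule partial_deriv_eq)
    then show ?thesis by simp
  qed
  then have "{x. partial_deriv i \<phi> x \<noteq> 0} \<subseteq> closure {x. \<phi> x \<noteq> 0}" by auto
  then have "closure {x. partial_deriv i \<phi> x \<noteq> 0} \<subseteq> closure {x. \<phi> x \<noteq> 0}"
    by (rule closure_minimal[OF _ closed_closure])
  moreover have "compact (closure {x. \<phi> x \<noteq> 0})" "smooth \<phi>"
    using assms by (simp_all add: test_function_def)
  ultimately show ?thesis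
    using compact_Int_closed[of "closure {x. \<phi> x \<noteq> 0}" "closure {x. partial_deriv i \<phi> x \<noteq> 0}"]
    by (simp add: test_function_def smooth_partial_deriv Int_absorb1)
qed

lemma test_function_bound:
  assumes "test_function \<phi>"
  obtains C l u where "C \<ge> 0" "\<And>x. \<bar>\<phi> x\<bar> \<le> C * indicator (cbox l u) x"
proof -
  let ?K = "closure {x. \<phi> x \<noteq> 0}"
  have "compact (\<phi> ` ?K)"
    using assms unfolding test_function_def
    by (auto intro!: compact_continuous_image intro: continuous_on_subset[OF smooth_continuous])
  then obtain C where C: "\<And>x. x \<in> ?K \<Longrightarrow> \<bar>\<phi> x\<bar> \<le> C"
    using compact_imp_bounded[of "\<phi> ` ?K"] unfolding bounded_iff real_norm_def by blast
  obtain l u where lu: "?K \<subseteq> cbox l u"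
    using assms bounded_subset_cbox_symmetric[of ?K] compact_imp_bounded[of ?K]
    unfolding test_function_def by blast
  have "\<bar>\<phi> x\<bar> \<le> max C 0 * indicator (cbox l u) x" for x
  proof (cases "\<phi> x = 0")
    case False
    then have "x \<in> ?K" by (intro subsetD[OF closure_subset]) simp
    with C[of x] lu show ?thesis by (auto simp: indicator_def)
  qed auto
  then show thesis using that[of "max C 0" l u] by simp
qed

lemma test_function_measurable: "test_function \<phi> \<Longrightarrow> \<phi> \<in> borel_measurable lborel"
  using borel_measurable_continuous_onI smooth_continuous test_function_def by auto

definition loc_integrable :: "(real^3 \<Rightarrow> real) \<Rightarrow> bool" where
  "loc_integrable v \<longleftrightarrow> v \<in> borel_measurable lborel \<and>
     (\<forall>l u. integrable lborel (\<lambda>x. indicator (cbox l u) x * v x))"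

lemma loc_integrable_measurable: "loc_integrable v \<Longrightarrow> v \<in> borel_measurable lborel"
  by (simp add: loc_integrable_def)

lemma loc_integrable_cmul: "loc_integrable v \<Longrightarrow> loc_integrable (\<lambda>x. c * v x)"
  unfolding loc_integrable_def by (auto simp: mult.left_commute)

lemma loc_integrable_add: "loc_integrable v \<Longrightarrow> loc_integrable w \<Longrightarrow> loc_integrable (\<lambda>x. v x + w x)"
  unfolding loc_integrable_def by (auto simp: distrib_left)

lemma loc_integrable_diff: "loc_integrable v \<Longrightarrow> loc_integrable w \<Longrightarrow> loc_integrable (\<lambda>x. v x - w x)"
  unfolding loc_integrable_def by (auto simp: right_diff_distrib)

lemma integrable_cbox_indicator: "integrable lborel (indicator (cbox l u) :: real^3 \<Rightarrow> real)"
  using emeasure_lborel_cbox_finite by (simp add: integrable_indicator_iff)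

lemma power_bound: 
  fixes a :: real assumes "a \<ge> 0" "n > 0" shows "a \<le> 1 + a ^ n"
proof (cases "a \<le> 1")
  case False
  then have "a ^ 1 \<le> a ^ n" using assms by (intro power_increasing) auto
  then show ?thesis by simp
qed (use assms in \<open>auto intro: order_trans\<close>)

lemma loc_integrable_power:
  assumes [measurable]: "v \<in> borel_measurable lborel" 
    and w: "integrable lborel w" "\<And>x. \<bar>v x\<bar> ^ n \<le> w x" and "n > 0"
  shows "loc_integrable v"
  unfolding loc_integrable_def
proof safe
  fix l u :: "real^3"
  show "integrable lborel (\<lambda>x. indicator (cbox l u) x * v x)"
  proof (rule Bochner_Integration.integrable_bound)
    show "integrable lborel (\<lambda>x. indicator (cbox l u) x + w x)"
      using w(1) integrable_cbox_indicator by (rule Bochner_Integration.integrable_add[rotated])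
    show "AE x in lborel. norm (indicator (cbox l u) x * v x) \<le> norm (indicator (cbox l u) x + w x)"
    proof (rule AE_I2)
      fix x
      have "0 \<le> \<bar>v x\<bar> ^ n" by simp
      then have "w x \<ge> 0" using w(2)[of x] by linarith
      moreover have "\<bar>v x\<bar> \<le> 1 + w x" using power_bound[of "\<bar>v x\<bar>" n] w(2)[of x] \<open>n > 0\<close> by simp
      ultimately show "norm (indicator (cbox l u) x * v x) \<le> norm (indicator (cbox l u) x + w x)"
        by (auto simp: indicator_def)
    qed
  qed measurable
qed fact

lemma loc_integrable_mult_test:
  assumes v: "loc_integrable v" and "test_function \<phi>"
  shows "integrable lborel (\<lambda>x. v x * \<phi> x)"
proof -
  note [measurable] = loc_integrable_measurable[OF v] test_function_measurable[OF assms(2)]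
  obtain C l u where C: "C \<ge> 0" "\<And>x. \<bar>\<phi> x\<bar> \<le> C * indicator (cbox l u) x"
    using test_function_bound[OF assms(2)] by metis
  show ?thesis
  proof (rule Bochner_Integration.integrable_bound)
    show "integrable lborel (\<lambda>x. C * (indicator (cbox l u) x * v x))"
      using v by (auto simp: loc_integrable_def)
    have "norm (v x * \<phi> x) \<le> norm (C * (indicator (cbox l u) x * v x))" for x
      using mult_left_mono[OF C(2)[of x], of "\<bar>v x\<bar>"] C(1)
      by (auto simp: abs_mult mult_ac)
    then show "AE x in lborel. norm (v x * \<phi> x) \<le> norm (C * (indicator (cbox l u) x * v x))"
      by simp
  qed measurable
qed

lemma tensor_outside:
  assumes "\<And>i t. t \<notin> {l $ i..u $ i} \<Longrightarrow> a i t = 0" and "x \<notin> cbox l u"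
  shows "tensor a x = 0"
proof -
  obtain i where "x $ i \<notin> {l $ i..u $ i}"
    using assms(2) unfolding mem_box_cart atLeastAtMost_iff by blast
  then have "a i (x $ i) = 0" by (rule assms(1))
  then show ?thesis unfolding tensor_def by (intro prod_zero) auto
qed

lemma test_function_tensor:
  assumes "\<And>i. smooth1 (a i)" and "\<And>i t. t \<notin> {l $ i..u $ i} \<Longrightarrow> a i t = 0"
  shows "test_function (tensor a)"
proof -
  have "tensor a x = 0" if "x \<notin> cbox l u" for x
    by (rule tensor_outside[OF assms(2) that])
  then have "{x. tensor a x \<noteq> 0} \<subseteq> cbox l u" by blast
  then have "closure {x. tensor a x \<noteq> 0} \<subseteq> cbox l u" by (rule closure_minimal[OF _ closed_cbox])
  then have "compact (closure {x. tensor a x \<noteq> 0})"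
    using compact_Int_closed[of "cbox l u" "closure {x. tensor a x \<noteq> 0}"]
    by (simp add: Int_absorb1)
  with smooth_tensor assms show ?thesis by (simp add: test_function_def)
qed

definition bump :: "nat \<Rightarrow> real \<Rightarrow> real \<Rightarrow> real \<Rightarrow> real" where
  "bump n l u t = flat_exp 0 (real n * t + (- real n * l)) * flat_exp 0 ((- real n) * t + real n * u)"

lemma smooth1_bump: "smooth1 (bump n l u)"
  unfolding smooth1_def bump_def[abs_def]
  by (intro allI diffable_upto_mult diffable_upto_affine[OF diffable_upto_flat_exp])

lemma bump_alt: "bump n l u t = flat_exp 0 (real n * (t - l)) * flat_exp 0 (real n * (u - t))"
  by (simp add: bump_def algebra_simps)

lemma flat_exp_0_bounds: "0 \<le> flat_exp 0 t" "flat_exp 0 t \<le> 1"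
  by (auto simp: flat_exp_def)

lemma bump_bounds: "0 \<le> bump n l u t" "bump n l u t \<le> 1"
  unfolding bump_alt by (simp_all add: flat_exp_0_bounds mult_le_one)

lemma bump_outside: "t \<notin> {l<..<u} \<Longrightarrow> bump n l u t = 0"
  by (auto simp: bump_alt flat_exp_def zero_less_mult_iff)

lemma flat_exp_tendsto_1: 
  assumes "s > 0" shows "(\<lambda>n. flat_exp 0 (real n * s)) \<longlonglongrightarrow> 1"
proof -
  have "(\<lambda>n. exp (- (inverse (real n) * inverse s))) \<longlonglongrightarrow> exp (- (0 * inverse s))"
    by (intro tendsto_intros lim_inverse_n)
  then have "(\<lambda>n. exp (- (inverse (real n) * inverse s))) \<longlonglongrightarrow> 1" by simp
  then show ?thesis
    by (rule Lim_transform_eventually)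
       (use assms in \<open>auto simp: flat_exp_def inverse_eq_divide eventually_at_top_linorder intro!: exI[of _ 1]\<close>)
qed

lemma bump_tendsto: "(\<lambda>n. bump n l u t) \<longlonglongrightarrow> indicator {l<..<u} t"
proof (cases "t \<in> {l<..<u}")
  case True
  have "(\<lambda>n. bump n l u t) \<longlonglongrightarrow> 1 * 1" unfolding bump_alt
    using True by (intro tendsto_mult flat_exp_tendsto_1) auto
  with True show ?thesis by simp
qed (simp add: bump_outside)

definition box_bump :: "nat \<Rightarrow> real^3 \<Rightarrow> real^3 \<Rightarrow> real^3 \<Rightarrow> real" where
  "box_bump n l u = tensor (\<lambda>i. bump n (l $ i) (u $ i))"

lemma test_function_box_bump: "test_function (box_bump n l u)"
  unfolding box_bump_def
proof (rule test_function_tensor[of _ l u])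
  show "bump n (l $ i) (u $ i) t = 0" if "t \<notin> {l $ i..u $ i}" for i t
    using that by (intro bump_outside) auto
qed (rule smooth1_bump)

lemma box_bump_tendsto: "(\<lambda>n. box_bump n l u x) \<longlonglongrightarrow> indicator (box l u) x"
proof -
  have "(\<lambda>n. box_bump n l u x) \<longlonglongrightarrow> (\<Prod>i\<in>UNIV. indicator {l $ i<..<u $ i} (x $ i))"
    unfolding box_bump_def tensor_def by (intro tendsto_prod bump_tendsto)
  also have "(\<Prod>i\<in>UNIV. indicator {l $ i<..<u $ i} (x $ i)) = (indicator (box l u) x :: real)"
  proof (cases "x \<in> box l u")
    case True
    then have "x $ i \<in> {l $ i<..<u $ i}" for i by (simp add: mem_box_cart)
    with True show ?thesis by simp
  next
    case False
    then obtain i where "x $ i \<notin> {l $ i<..<u $ i}"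
      unfolding mem_box_cart greaterThanLessThan_iff by blast
    then have "indicator {l $ i<..<u $ i} (x $ i) = (0 :: real)" by simp
    then have "(\<Prod>i\<in>UNIV. indicator {l $ i<..<u $ i} (x $ i)) = (0 :: real)"
      by (intro prod_zero) auto
    with False show ?thesis by simp
  qed
  finally show ?thesis .
qed

lemma tensor_bound:
  assumes "\<And>i t. \<bar>a i t\<bar> \<le> 1" "\<And>i t. t \<notin> {l $ i..u $ i} \<Longrightarrow> a i t = 0"
  shows "\<bar>tensor a x\<bar> \<le> indicator (cbox l u) x"
proof (cases "x \<in> cbox l u")
  case True
  have "\<bar>tensor a x\<bar> \<le> 1" unfolding tensor_def abs_prod
    by (rule prod_le_1) (simp add: assms(1))
  with True show ?thesis by simp
next
  case False
  then show ?thesis using tensor_outside[OF assms(2)] by simp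
qed

lemma du_Bois_Reymond:
  assumes v: "loc_integrable v" and 0: "\<And>n l u. (LINT x|lborel. v x * box_bump n l u x) = 0"
  shows "AE x in lborel. v x = 0"
proof -
  note [measurable] = loc_integrable_measurable[OF v] 
  have box0: "(LINT x|lborel. v x * indicator (box l u) x) = 0" for l u
  proof -
    have [measurable]: "box_bump n l u \<in> borel_measurable lborel" for n
      by (rule test_function_measurable[OF test_function_box_bump])
    have "(\<lambda>n. LINT x|lborel. v x * box_bump n l u x) \<longlonglongrightarrow> (LINT x|lborel. v x * indicator (box l u) x)"
    proof (rule integral_dominated_convergence)
      show "integrable lborel (\<lambda>x. \<bar>indicator (cbox l u) x * v x\<bar>)"
        using v by (auto simp: loc_integrable_def)
      show "AE x in lborel. (\<lambda>n. v x * box_bump n l u x) \<longlonglongrightarrow> v x * indicator (box l u) x"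
        by (intro AE_I2 tendsto_mult tendsto_const box_bump_tendsto)
      fix n
      have "\<bar>box_bump n l u x\<bar> \<le> indicator (cbox l u) x" for x
        unfolding box_bump_def
      proof (rule tensor_bound)
        show "\<bar>bump n (l $ i) (u $ i) t\<bar> \<le> 1" for i t
          using bump_bounds by (simp add: abs_of_nonneg)
        show "bump n (l $ i) (u $ i) t = 0" if "t \<notin> {l $ i..u $ i}" for i t
          using that by (intro bump_outside) auto
      qed
      then have "\<bar>v x * box_bump n l u x\<bar> \<le> \<bar>indicator (cbox l u) x * v x\<bar>" for x
        using mult_right_mono[of "\<bar>box_bump n l u x\<bar>" "indicator (cbox l u) x" "\<bar>v x\<bar>"]
        by (simp add: abs_mult mult_ac)
      then show "AE x in lborel. norm (v x * box_bump n l u x) \<le> \<bar>indicator (cbox l u) x * v x\<bar>"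
        by simp
    qed measurable
    then show ?thesis using 0 by (simp add: LIMSEQ_const_iff)
  qed
  define B where "B k = box (- (real k *\<^sub>R One)) (real k *\<^sub>R One :: real^3)" for k
  have B_int: "integrable lborel (\<lambda>x. indicator (B k) x * v x)" for k
  proof (rule Bochner_Integration.integrable_bound)
    let ?C = "cbox (- (real k *\<^sub>R One)) (real k *\<^sub>R One :: real^3)"
    show "integrable lborel (\<lambda>x. indicator ?C x * v x)" using v by (auto simp: loc_integrable_def)
    show "AE x in lborel. norm (indicator (B k) x * v x) \<le> norm (indicator ?C x * v x)"
      using box_subset_cbox by (auto simp: B_def indicator_def subset_eq)
  qed (auto simp: B_def)
  have "AE x in lborel. indicator (B k) x * v x = 0" for k
  proof (rule sigma_finite_measure.density_zero[OF sigma_finite_lborel B_int])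
    fix A :: "(real^3) set" assume "A \<in> sets lborel"
    let ?E = "range (\<lambda>(a, b). box a b::(real^3) set)"
    let ?w = "\<lambda>x. indicator (B k) x * v x"
    have "Int_stable ?E" by (auto simp: Int_stable_def box_Int_box)
    moreover have "?E \<subseteq> Pow UNIV" by simp
    moreover have "A \<in> sigma_sets UNIV ?E" using \<open>A \<in> sets lborel\<close> by (simp add: borel_eq_box)
    ultimately show "set_lebesgue_integral lborel A ?w = 0"
    proof (induction rule: sigma_sets_induct_disjoint)
      case (basic A)
      then obtain a b where A: "A = box a b" by auto
      obtain c d where cd: "B k \<inter> box a b = box c d" 
        unfolding B_def box_Int_box by blast
      have eq: "indicator A x *\<^sub>R ?w x = v x * indicator (box c d) x" for x
        unfolding A cd[symmetric] by (auto simp: indicator_def)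
      show ?case unfolding set_lebesgue_integral_def eq by (rule box0)
    next
      case empty then show ?case by (simp add: set_lebesgue_integral_def)
    next
      case (compl A)
      have UN: "(LINT x|lborel. ?w x) = 0"
        using box0 by (simp add: B_def mult.commute)
      have A: "A \<in> sets lborel" using compl by (simp add: borel_eq_box)
      have iA: "integrable lborel (\<lambda>x. indicator A x *\<^sub>R ?w x)"
        by (rule integrable_mult_indicator[OF A B_int])
      have eq: "indicator (UNIV - A) x *\<^sub>R ?w x = ?w x - indicator A x *\<^sub>R ?w x" for x
        by (auto simp: indicator_def)
      show ?case
        unfolding set_lebesgue_integral_def eq Bochner_Integration.integral_diff[OF B_int iA]
        using UN compl by (simp add: set_lebesgue_integral_def)
    next
      case (union A)
      have A: "A i \<in> sets lborel" for i using union by (auto simp: borel_eq_box)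
      have "(LINT x:(\<Union>i. A i)|lborel. ?w x) = (\<Sum>i. LINT x:A i|lborel. ?w x)"
      proof (rule lebesgue_integral_countable_add)
        show "set_integrable lborel (\<Union>i. A i) ?w"
          unfolding set_integrable_def using A by (intro integrable_mult_indicator B_int) auto
        show "A i \<inter> A j = {}" if "i \<noteq> j" for i j
          using union(1) that by (auto simp: disjoint_family_on_def)
      qed (rule A)
      then show ?case using union by simp
    qed
  qed
  then have "AE x in lborel. \<forall>k. indicator (B k) x * v x = 0" by (subst AE_all_countable) blast
  then show ?thesis
  proof (rule AE_mp, intro AE_I2 impI)
    fix x assume *: "\<forall>k. indicator (B k) x * v x = 0"
    have "(\<Union>k. B k) = UNIV" unfolding B_def UN_box_eq_UNIV by simp
    then obtain k where "x \<in> B k" by blast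
    with *[rule_format, of k] show "v x = 0" by simp
  qed
qed

lemma borel_measurable_vec_nth:
  fixes g :: "'a \<Rightarrow> real^3"
  assumes "g \<in> borel_measurable M" shows "(\<lambda>x. g x $ i) \<in> borel_measurable M"
proof -
  have "(\<lambda>y::real^3. y $ i) \<in> borel_measurable borel"
    by (rule borel_measurable_continuous_onI, rule linear_continuous_on, rule bounded_linear_vec_nth)
  from measurable_compose[OF assms this] show ?thesis .
qed

lemma weak_gradient_unique:
  assumes "weak_gradient v g" "weak_gradient v' g'" "AE x in lborel. v x = v' x"
    and [measurable]: "v \<in> borel_measurable lborel" "v' \<in> borel_measurable lborel"
    and g: "\<And>i. loc_integrable (\<lambda>x. g x $ i)" "\<And>i. loc_integrable (\<lambda>x. g' x $ i)"
  shows "AE x in lborel. g x = g' x"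
proof -
  have "AE x in lborel. g x $ i - g' x $ i = 0" for i
  proof (rule du_Bois_Reymond)
    fix n l u
    let ?\<phi> = "box_bump n l u"
    note t = test_function_box_bump[of n l u]
    have [measurable]: "partial_deriv i ?\<phi> \<in> borel_measurable lborel"
      by (rule test_function_measurable[OF test_function_partial_deriv[OF t]])
    have "(LINT x|lborel. v x * partial_deriv i ?\<phi> x) = (LINT x|lborel. v' x * partial_deriv i ?\<phi> x)"
      by (rule integral_cong_AE) (use assms(3) in auto)
    then have "(LINT x|lborel. g x $ i * ?\<phi> x) = (LINT x|lborel. g' x $ i * ?\<phi> x)"
      using assms(1)[unfolded weak_gradient_def, rule_format, OF t, of i]
        assms(2)[unfolded weak_gradient_def, rule_format, OF t, of i] by linarith
    then show "(LINT x|lborel. (g x $ i - g' x $ i) * ?\<phi> x) = 0"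
      using loc_integrable_mult_test[OF g(1) t] loc_integrable_mult_test[OF g(2) t]
      by (simp add: left_diff_distrib)
  qed (intro loc_integrable_diff g)
  then have "AE x in lborel. \<forall>i. g x $ i - g' x $ i = 0" by (simp add: AE_all_countable)
  then show ?thesis by (rule eventually_mono) (simp add: vec_eq_iff)
qed

lemma antiderivative:
  assumes "continuous_on UNIV (b::real \<Rightarrow> real)"
  obtains F where "\<forall>x. (F has_real_derivative b x) (at x)"
proof -
  have "isCont b x" for x using assms by (simp add: continuous_on_eq_continuous_at)
  then have "\<exists>F. \<forall>x::real. -\<infinity> < ereal x \<longrightarrow> ereal x < \<infinity> \<longrightarrow> (F has_vector_derivative b x) (at x)"
    by (intro einterval_antiderivative) simp_all
  then show thesis using that
    by (auto simp: has_real_derivative_iff_has_vector_derivative)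
qed

lemma tensor_upd:
  "tensor (b(k := f)) x = f (x $ k) * (\<Prod>i\<in>UNIV - {k}. b i (x $ i))"
proof -
  have "(\<Prod>i\<in>UNIV - {k}. (b(k := f)) i (x $ i)) = (\<Prod>i\<in>UNIV - {k}. b i (x $ i))"
    by (rule prod.cong) auto
  then show ?thesis unfolding tensor_def by (subst prod.remove[of _ k]) auto
qed

lemma shift_test:
  fixes l u :: "real^3" and T :: real and n :: nat
  assumes "T \<ge> 0"
  defines "b \<equiv> \<lambda>i. bump n (l $ i) (u $ i)"
  obtains \<phi> where "test_function \<phi>"
    "\<And>x. partial_deriv 1 \<phi> x = box_bump n l u x - tensor (b(1 := \<lambda>t. b 1 (t - T))) x"
proof -
  have b1: "smooth1 (b i)" for i by (simp add: b_def smooth1_bump)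
  have out: "b i t = 0" if "t \<notin> {l $ i..u $ i}" for i t
    unfolding b_def using that by (auto intro!: bump_outside)
  have "continuous_on UNIV (b 1)"
    using b1[of 1] by (metis DERIV_continuous_on UNIV_I smooth1E)
  then obtain F where F: "\<forall>x. (F has_real_derivative b 1 x) (at x)" using antiderivative by metis
  define h where "h t = F t + (-1) * F (1 * t + (- T))" for t
  have h': "(h has_real_derivative b 1 t - b 1 (t - T)) (at t)" for t
  proof -
    have "((\<lambda>t. F (1 * t + (- T))) has_real_derivative b 1 (1 * t + (- T)) * 1) (at t)"
      by (rule DERIV_chain2[where f = F]) (use F in \<open>auto intro!: derivative_eq_intros\<close>)
    from DERIV_add[OF F[rule_format, of t] DERIV_cmult[OF this, of "-1"]]
    show ?thesis unfolding h_def[abs_def] by simp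
  qed
  have sF: "smooth1 F" using smooth1_antideriv[OF b1 F] .
  have sh: "smooth1 h" unfolding smooth1_def h_def[abs_def]
  proof
    fix m
    have "diffable_upto m F" using sF by (simp add: smooth1_def)
    then show "diffable_upto m (\<lambda>t. F t + (-1) * F (1 * t + (- T)))"
      by (intro diffable_upto_add diffable_upto_mult[OF diffable_upto_const] diffable_upto_affine[of m F])
  qed
  define u' where "u' = u + axis 1 T"
  have const: "F s = F t" if "s \<le> t" "\<And>r. s < r \<Longrightarrow> r < t \<Longrightarrow> b 1 r = 0" for s t
  proof (cases "s = t")
    case False
    then have "s < t" using that by simp
    have "F t = F s"
    proof (rule DERIV_isconst_end[OF \<open>s < t\<close>])
      show "continuous_on {s..t} F"
        using F by (intro continuous_at_imp_continuous_on ballI DERIV_isCont) blast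
      show "(F has_real_derivative 0) (at r)" if "s < r" "r < t" for r
        using F[rule_format, of r] \<open>\<And>r. s < r \<Longrightarrow> r < t \<Longrightarrow> b 1 r = 0\<close>[OF that] by simp
    qed
    then show ?thesis by simp
  qed simp
  have hout: "h t = 0" if t: "t \<notin> {l $ 1..u' $ 1}" for t
  proof -
    have "F (t - T) = F t"
    proof (rule const)
      show "t - T \<le> t" using \<open>T \<ge> 0\<close> by simp
      fix r assume "t - T < r" "r < t"
      then show "b 1 r = 0" using t by (intro out) (auto simp: u'_def)
    qed
    then show ?thesis by (simp add: h_def)
  qed
  define a' where "a' i t = (if i = 1 then b 1 t - b 1 (t - T) else deriv (b i) t)" for i t
  have hd: "((b(1 := h)) i has_real_derivative a' i t) (at t)" for i t
  proof (cases "i = 1")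
    case False
    obtain f' where "\<forall>x. (b i has_real_derivative f' x) (at x)" using b1[of i] by (rule smooth1E)
    with False show ?thesis using DERIV_imp_deriv[of "b i" "f' t" t] by (simp add: a'_def)
  qed (simp add: h' a'_def)
  have "partial_deriv 1 (tensor (b(1 := h))) x = box_bump n l u x - tensor (b(1 := \<lambda>t. b 1 (t - T))) x" for x
  proof -
    have "partial_deriv 1 (tensor (b(1 := h))) x = (\<chi> k. tensor ((b(1 := h))(k := a' k)) x) $ 1"
      by (rule partial_deriv_eq[OF tensor_has_derivative[OF hd]])
    also have "\<dots> = tensor (b(1 := \<lambda>t. b 1 t - b 1 (t - T))) x"
      by (simp add: a'_def[abs_def])
    also have "\<dots> = tensor (b(1 := b 1)) x - tensor (b(1 := \<lambda>t. b 1 (t - T))) x"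
      unfolding tensor_upd by (simp add: left_diff_distrib)
    also have "b(1 := b 1) = b" by simp
    also have "tensor b = box_bump n l u" by (simp add: box_bump_def b_def)
    finally show ?thesis .
  qed
  moreover have "test_function (tensor (b(1 := h)))"
  proof (rule test_function_tensor[of _ l u'])
    show "smooth1 ((b(1 := h)) i)" for i using b1 sh by simp
    show "(b(1 := h)) i t = 0" if "t \<notin> {l $ i..u' $ i}" for i t
      using that hout[of t] out[of t i] by (auto simp: u'_def axis_def split: if_splits)
  qed
  ultimately show thesis using that by blast
qed

lemma Young6: 
  fixes y :: real assumes "\<epsilon> > 0" "y \<ge> 0" shows "y \<le> \<epsilon> + y ^ 6 / \<epsilon> ^ 5"
proof (cases "y \<le> \<epsilon>")
  case False
  then have "y * \<epsilon> ^ 5 \<le> y * y ^ 5" using assms by (intro mult_left_mono power_mono) auto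
  then have "y \<le> y ^ 6 / \<epsilon> ^ 5" using assms by (simp add: field_simps numeral_eq_Suc)
  then show ?thesis using assms by simp
qed (use assms in \<open>auto intro: add_increasing2\<close>)

lemma weak_gradient_zero:
  assumes wg: "weak_gradient v g" and g0: "AE x in lborel. g x = 0"
    and [measurable]: "v \<in> borel_measurable lborel" "g \<in> borel_measurable lborel"
    and L6: "integrable lborel (\<lambda>x. \<bar>v x\<bar> ^ 6)"
  shows "AE x in lborel. v x = 0"
proof (rule du_Bois_Reymond)
  show v: "loc_integrable v" by (rule loc_integrable_power[OF _ L6, of _ 6]) auto
  fix n and l u :: "real^3"
  have deriv0: "(LINT x|lborel. v x * partial_deriv i \<phi> x) = 0" if "test_function \<phi>" for i \<phi>
  proof -
    have [measurable]: "\<phi> \<in> borel_measurable lborel" using that by (rule test_function_measurable)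
    have [measurable]: "(\<lambda>x. g x $ i) \<in> borel_measurable lborel"
      by (rule borel_measurable_vec_nth) fact
    have "(LINT x|lborel. g x $ i * \<phi> x) = (LINT x|(lborel :: (real^3) measure). 0)"
      by (rule integral_cong_AE) (use g0 in auto)
    then show ?thesis using wg that by (simp add: weak_gradient_def)
  qed
  define b where "b i = bump n (l $ i) (u $ i)" for i
  define s where "s k = tensor (b(1 := \<lambda>t. b 1 (t - real k)))" for k :: nat
  define e where "e k = axis (1::3) (real k)" for k
  let ?Q = "\<lambda>k. cbox (l + e k) (u + e k)"
  have out: "b i t = 0" if "t \<notin> {l $ i..u $ i}" for i t
    unfolding b_def using that by (auto intro!: bump_outside)
  have bb: "\<bar>b i t\<bar> \<le> 1" for i t unfolding b_def using bump_bounds[of n "l $ i" "u $ i" t] by auto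
  have s_bound: "\<bar>s k x\<bar> \<le> indicator (?Q k) x" for k x
    unfolding s_def
  proof (rule tensor_bound)
    show "\<bar>(b(1 := \<lambda>t. b 1 (t - real k))) i t\<bar> \<le> 1" for i t using bb by auto
    show "(b(1 := \<lambda>t. b 1 (t - real k))) i t = 0" if "t \<notin> {(l + e k) $ i..(u + e k) $ i}" for i t
      using that out[of "t - real k" 1] out[of t i]
      by (auto simp: e_def axis_def split: if_splits)
  qed
  have vs: "(LINT x|lborel. v x * box_bump n l u x) = (LINT x|lborel. v x * s k x)"
    and s_int: "integrable lborel (\<lambda>x. v x * s k x)" for k
  proof -
    obtain \<phi> where \<phi>: "test_function \<phi>" "\<And>x. partial_deriv 1 \<phi> x = box_bump n l u x - s k x"
      using shift_test[of "real k" n l u] unfolding s_def b_def by auto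
    have 1: "integrable lborel (\<lambda>x. v x * box_bump n l u x)"
      by (intro loc_integrable_mult_test v test_function_box_bump)
    have 2: "integrable lborel (\<lambda>x. v x * partial_deriv 1 \<phi> x)"
      by (intro loc_integrable_mult_test v test_function_partial_deriv \<phi>)
    have "integrable lborel (\<lambda>x. v x * box_bump n l u x - v x * partial_deriv 1 \<phi> x)"
      using 1 2 by simp
    then show 3: "integrable lborel (\<lambda>x. v x * s k x)" by (simp add: \<phi>(2) algebra_simps)
    have "0 = (LINT x|lborel. v x * box_bump n l u x - v x * s k x)"
      using deriv0[OF \<phi>(1), of 1] by (simp add: \<phi>(2) right_diff_distrib)
    also have "\<dots> = (LINT x|lborel. v x * box_bump n l u x) - (LINT x|lborel. v x * s k x)"
      using 1 3 by simp
    finally show "(LINT x|lborel. v x * box_bump n l u x) = (LINT x|lborel. v x * s k x)" by simp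
  qed
  define V where "V = measure lborel (cbox l u)"
  have VQ: "measure lborel (?Q k) = V" for k
    unfolding V_def by (cases "cbox l u = {}") (auto simp: content_cbox_if_cart interval_ne_empty_cart interval_eq_empty_cart)
  have Qlim: "(\<lambda>k. LINT x|(lborel :: (real^3) measure). \<bar>v x\<bar> ^ 6 * indicator (?Q k) x) \<longlonglongrightarrow> (LINT x|(lborel :: (real^3) measure). 0)"
  proof (rule integral_dominated_convergence[OF _ _ L6])
    show "AE x in (lborel :: (real^3) measure). (\<lambda>k. \<bar>v x\<bar> ^ 6 * indicator (?Q k) x) \<longlonglongrightarrow> 0"
    proof (rule AE_I2)
      fix x :: "real^3"
      obtain k0 :: nat where k0: "real k0 > x $ 1 - l $ 1" using reals_Archimedean2 by blast
      have "indicator (?Q k) x = (0::real)" if "k \<ge> k0" for k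
      proof -
        have "x $ 1 < (l + e k) $ 1" using k0 that by (simp add: e_def)
        then have "x \<notin> ?Q k" unfolding mem_box_cart by (meson not_less)
        then show ?thesis by simp
      qed
      then show "(\<lambda>k. \<bar>v x\<bar> ^ 6 * indicator (?Q k) x) \<longlonglongrightarrow> 0"
        by (intro tendsto_eventually eventually_sequentiallyI[of k0]) simp
    qed
    show "AE x in lborel. norm (\<bar>v x\<bar> ^ 6 * indicator (?Q k) x) \<le> \<bar>v x\<bar> ^ 6" for k
      by (auto simp: indicator_def)
  qed measurable
  let ?J = "\<bar>LINT x|lborel. v x * box_bump n l u x\<bar>"
  have J: "?J \<le> \<epsilon> * V" if "\<epsilon> > 0" for \<epsilon>
  proof -
    have "?J \<le> \<epsilon> * V + (LINT x|(lborel :: (real^3) measure). \<bar>v x\<bar> ^ 6 * indicator (?Q k) x) / \<epsilon> ^ 5" for k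
    proof -
      have i1: "integrable lborel (\<lambda>x. \<bar>v x\<bar> ^ 6 * indicator (?Q k) x)"
        by (rule Bochner_Integration.integrable_bound[OF L6]) (auto simp: indicator_def)
      have i2: "integrable lborel (\<lambda>x. \<epsilon> * indicator (?Q k) x + \<bar>v x\<bar> ^ 6 * indicator (?Q k) x / \<epsilon> ^ 5)"
        using i1 integrable_cbox_indicator by auto
      have "?J \<le> (LINT x|lborel. \<bar>v x * s k x\<bar>)" unfolding vs[of k] by (rule integral_abs_bound)
      also have "\<dots> \<le> (LINT x|lborel. \<epsilon> * indicator (?Q k) x + \<bar>v x\<bar> ^ 6 * indicator (?Q k) x / \<epsilon> ^ 5)"
      proof (rule integral_mono[OF _ i2])
        show "integrable lborel (\<lambda>x. \<bar>v x * s k x\<bar>)" using s_int by simp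
        fix x
        have "\<bar>v x * s k x\<bar> \<le> \<bar>v x\<bar> * indicator (?Q k) x"
          unfolding abs_mult by (intro mult_left_mono s_bound) simp
        also have "\<dots> \<le> (\<epsilon> + \<bar>v x\<bar> ^ 6 / \<epsilon> ^ 5) * indicator (?Q k) x"
          by (intro mult_right_mono Young6 that) auto
        finally show "\<bar>v x * s k x\<bar> \<le> \<epsilon> * indicator (?Q k) x + \<bar>v x\<bar> ^ 6 * indicator (?Q k) x / \<epsilon> ^ 5"
          by (simp add: distrib_right)
      qed
      also have "\<dots> = \<epsilon> * V + (LINT x|(lborel :: (real^3) measure). \<bar>v x\<bar> ^ 6 * indicator (?Q k) x) / \<epsilon> ^ 5"
        using i1 integrable_cbox_indicator[of "l + e k" "u + e k"] VQ[of k] by simp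
      finally show ?thesis .
    qed
    moreover have "(\<lambda>k. \<epsilon> * V + (LINT x|(lborel :: (real^3) measure). \<bar>v x\<bar> ^ 6 * indicator (?Q k) x) / \<epsilon> ^ 5) \<longlonglongrightarrow> \<epsilon> * V + 0 / \<epsilon> ^ 5"
      using Qlim by (intro tendsto_intros) (use that in auto)
    ultimately show ?thesis using LIMSEQ_le_const[of _ "\<epsilon> * V + 0 / \<epsilon> ^ 5" ?J] by auto
  qed
  have "((\<lambda>\<epsilon>. \<epsilon> * V) \<longlongrightarrow> 0 * V) (at_right 0)" by (intro tendsto_intros)
  then have "?J \<le> 0 * V"
    by (rule tendsto_lowerbound) (use J in \<open>auto simp: eventually_at_right_field intro!: exI[of _ 1]\<close>)
  then show "(LINT x|lborel. v x * box_bump n l u x) = 0" by simp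
qed

section \<open>The homogeneous Sobolev space\<close>

definition L2_field :: "(real^3 \<Rightarrow> real^3) \<Rightarrow> bool" where
  "L2_field g \<longleftrightarrow> g \<in> borel_measurable lborel \<and> integrable lborel (\<lambda>x. (norm (g x))\<^sup>2)"

definition L6_fun :: "(real^3 \<Rightarrow> real) \<Rightarrow> bool" where
  "L6_fun v \<longleftrightarrow> v \<in> borel_measurable lborel \<and> integrable lborel (\<lambda>x. \<bar>v x\<bar> ^ 6)"

definition sobolev_fun :: "(real^3 \<Rightarrow> real) \<Rightarrow> bool" where
  "sobolev_fun v \<longleftrightarrow> L6_fun v \<and> (\<exists>g. L2_field g \<and> weak_gradient v g)"

definition weak_grad :: "(real^3 \<Rightarrow> real) \<Rightarrow> real^3 \<Rightarrow> real^3" where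
  "weak_grad v = (SOME g. L2_field g \<and> weak_gradient v g)"

lemma L2_field_loc_integrable:
  assumes "L2_field g" shows "loc_integrable (\<lambda>x. g x $ i)"
proof (rule loc_integrable_power)
  show "(\<lambda>x. g x $ i) \<in> borel_measurable lborel"
    using assms by (intro borel_measurable_vec_nth) (simp add: L2_field_def)
  show "integrable lborel (\<lambda>x. (norm (g x))\<^sup>2)" using assms by (simp add: L2_field_def)
  show "\<bar>g x $ i\<bar> ^ 2 \<le> (norm (g x))\<^sup>2" for x
    by (intro power_mono component_le_norm_cart) simp
qed simp

lemma L6_fun_loc_integrable:
  assumes "L6_fun v" shows "loc_integrable v"
  by (rule loc_integrable_power[where n = 6 and w = "\<lambda>x. \<bar>v x\<bar> ^ 6"])
     (use assms in \<open>auto simp: L6_fun_def\<close>)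

lemma L2_field_scaleR: "L2_field g \<Longrightarrow> L2_field (\<lambda>x. c *\<^sub>R g x)"
  by (auto simp: L2_field_def power_mult_distrib)

lemma L2_field_add:
  assumes "L2_field f" "L2_field g" shows "L2_field (\<lambda>x. f x + g x)"
proof -
  have [measurable]: "f \<in> borel_measurable lborel" "g \<in> borel_measurable lborel"
    using assms by (simp_all add: L2_field_def)
  have le: "(norm (f x + g x))\<^sup>2 \<le> 2 * (norm (f x))\<^sup>2 + 2 * (norm (g x))\<^sup>2" for x
  proof -
    have "(norm (f x + g x))\<^sup>2 \<le> (norm (f x) + norm (g x))\<^sup>2"
      by (intro power_mono norm_triangle_ineq) simp
    also have "\<dots> \<le> 2 * (norm (f x))\<^sup>2 + 2 * (norm (g x))\<^sup>2"
      using zero_le_power2[of "norm (f x) - norm (g x)"]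
      by (simp add: power2_diff power2_sum)
    finally show ?thesis .
  qed
  have "integrable lborel (\<lambda>x. 2 * (norm (f x))\<^sup>2 + 2 * (norm (g x))\<^sup>2)"
    using assms by (auto simp: L2_field_def)
  then have "integrable lborel (\<lambda>x. (norm (f x + g x))\<^sup>2)"
    by (rule Bochner_Integration.integrable_bound) (use le in auto)
  then show ?thesis by (simp add: L2_field_def)
qed

lemma L2_field_inner:
  assumes "L2_field f" "L2_field g" shows "integrable lborel (\<lambda>x. f x \<bullet> g x)"
proof -
  have [measurable]: "f \<in> borel_measurable lborel" "g \<in> borel_measurable lborel"
    using assms by (simp_all add: L2_field_def)
  have le: "\<bar>f x \<bullet> g x\<bar> \<le> (norm (f x))\<^sup>2 + (norm (g x))\<^sup>2" for x
  proof -
    have "\<bar>f x \<bullet> g x\<bar> \<le> norm (f x) * norm (g x)" by (rule Cauchy_Schwarz_ineq2)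
    also have "\<dots> \<le> (norm (f x))\<^sup>2 + (norm (g x))\<^sup>2"
      using zero_le_power2[of "norm (f x) - norm (g x)"]
        mult_nonneg_nonneg[OF norm_ge_zero[of "f x"] norm_ge_zero[of "g x"]]
      unfolding power2_diff by linarith
    finally show ?thesis .
  qed
  have "integrable lborel (\<lambda>x. (norm (f x))\<^sup>2 + (norm (g x))\<^sup>2)"
    using assms by (auto simp: L2_field_def)
  then show ?thesis
    by (rule Bochner_Integration.integrable_bound) (use le in auto)
qed

lemma L6_fun_cmul: "L6_fun v \<Longrightarrow> L6_fun (\<lambda>x. c * v x)"
  by (auto simp: L6_fun_def abs_mult power_mult_distrib)

lemma L6_fun_add:
  assumes "L6_fun v" "L6_fun w" shows "L6_fun (\<lambda>x. v x + w x)"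
proof -
  have [measurable]: "v \<in> borel_measurable lborel" "w \<in> borel_measurable lborel"
    using assms by (simp_all add: L6_fun_def)
  have le: "\<bar>v x + w x\<bar> ^ 6 \<le> 64 * \<bar>v x\<bar> ^ 6 + 64 * \<bar>w x\<bar> ^ 6" for x
  proof -
    have "\<bar>v x + w x\<bar> ^ 6 \<le> (2 * max \<bar>v x\<bar> \<bar>w x\<bar>) ^ 6" by (intro power_mono) auto
    also have "\<dots> = 64 * max \<bar>v x\<bar> \<bar>w x\<bar> ^ 6" by (simp only: power_mult_distrib) simp
    also have "\<dots> \<le> 64 * \<bar>v x\<bar> ^ 6 + 64 * \<bar>w x\<bar> ^ 6"
      by (cases "\<bar>v x\<bar> \<le> \<bar>w x\<bar>") (simp_all add: max_def)
    finally show ?thesis .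
  qed
  have "integrable lborel (\<lambda>x. 64 * \<bar>v x\<bar> ^ 6 + 64 * \<bar>w x\<bar> ^ 6)"
    using assms by (auto simp: L6_fun_def)
  then have "integrable lborel (\<lambda>x. \<bar>v x + w x\<bar> ^ 6)"
    by (rule Bochner_Integration.integrable_bound) (use le in auto)
  then show ?thesis by (simp add: L6_fun_def)
qed

lemma weak_gradient_add:
  assumes "L6_fun v" "L6_fun w" "L2_field f" "L2_field g" "weak_gradient v f" "weak_gradient w g"
  shows "weak_gradient (\<lambda>x. v x + w x) (\<lambda>x. f x + g x)"
  unfolding weak_gradient_def
proof (intro allI impI)
  fix \<phi> :: "real^3 \<Rightarrow> real" and i assume t: "test_function \<phi>"
  note t' = test_function_partial_deriv[OF t, of i]
  note 1 = loc_integrable_mult_test[OF L6_fun_loc_integrable[OF assms(1)] t']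
    loc_integrable_mult_test[OF L6_fun_loc_integrable[OF assms(2)] t']
    loc_integrable_mult_test[OF L2_field_loc_integrable[OF assms(3)] t, of i]
    loc_integrable_mult_test[OF L2_field_loc_integrable[OF assms(4)] t, of i]
  show "(LINT x|lborel. (v x + w x) * partial_deriv i \<phi> x) = - (LINT x|lborel. (f x + g x) $ i * \<phi> x)"
    using 1 assms(5,6)[unfolded weak_gradient_def, rule_format, OF t, of i]
    by (simp add: distrib_right)
qed

lemma weak_gradient_cmul:
  assumes "weak_gradient v f"
  shows "weak_gradient (\<lambda>x. c * v x) (\<lambda>x. c *\<^sub>R f x)"
  using assms unfolding weak_gradient_def by (simp add: mult.assoc)

lemma weak_grad:
  assumes "sobolev_fun v" shows "L2_field (weak_grad v)" "weak_gradient v (weak_grad v)"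
  using someI_ex[of "\<lambda>g. L2_field g \<and> weak_gradient v g"] assms
  unfolding sobolev_fun_def weak_grad_def by blast+

lemma weak_grad_eqI:
  assumes "sobolev_fun v" "sobolev_fun w" "L2_field g" "weak_gradient w g" "AE x in lborel. v x = w x"
  shows "AE x in lborel. weak_grad v x = g x"
proof (rule weak_gradient_unique[OF weak_grad(2)[OF assms(1)] assms(4) assms(5)])
  show "v \<in> borel_measurable lborel" "w \<in> borel_measurable lborel"
    using assms(1,2) by (simp_all add: sobolev_fun_def L6_fun_def)
  show "loc_integrable (\<lambda>x. weak_grad v x $ i)" for i
    by (rule L2_field_loc_integrable[OF weak_grad(1)[OF assms(1)]])
  show "loc_integrable (\<lambda>x. g x $ i)" for i
    by (rule L2_field_loc_integrable[OF assms(3)])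
qed

lemma weak_grad_unique:
  assumes "sobolev_fun v" "L2_field g" "weak_gradient v g"
  shows "AE x in lborel. weak_grad v x = g x"
  by (rule weak_grad_eqI[OF assms(1) assms(1) assms(2) assms(3)]) simp

lemma weak_grad_cong:
  assumes "sobolev_fun v" "sobolev_fun w" "AE x in lborel. v x = w x"
  shows "AE x in lborel. weak_grad v x = weak_grad w x"
  by (rule weak_grad_eqI[OF assms(1) assms(2) weak_grad[OF assms(2)] assms(3)])

lemma sobolev_funI: "L6_fun v \<Longrightarrow> L2_field g \<Longrightarrow> weak_gradient v g \<Longrightarrow> sobolev_fun v"
  unfolding sobolev_fun_def by blast

lemma sobolev_fun_L6: "sobolev_fun v \<Longrightarrow> L6_fun v"
  unfolding sobolev_fun_def by blast

lemma weak_gradient_weak_grad_add: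
  assumes "sobolev_fun v" "sobolev_fun w"
  shows "weak_gradient (\<lambda>x. v x + w x) (\<lambda>x. weak_grad v x + weak_grad w x)"
  by (rule weak_gradient_add[OF sobolev_fun_L6[OF assms(1)] sobolev_fun_L6[OF assms(2)]
      weak_grad(1)[OF assms(1)] weak_grad(1)[OF assms(2)]
      weak_grad(2)[OF assms(1)] weak_grad(2)[OF assms(2)]])

lemma sobolev_fun_add:
  assumes "sobolev_fun v" "sobolev_fun w" shows "sobolev_fun (\<lambda>x. v x + w x)"
  by (rule sobolev_funI[OF L6_fun_add[OF sobolev_fun_L6[OF assms(1)] sobolev_fun_L6[OF assms(2)]]
      L2_field_add[OF weak_grad(1)[OF assms(1)] weak_grad(1)[OF assms(2)]]
      weak_gradient_weak_grad_add[OF assms]])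

lemma sobolev_fun_cmul:
  assumes "sobolev_fun v" shows "sobolev_fun (\<lambda>x. c * v x)"
  by (rule sobolev_funI[OF L6_fun_cmul[OF sobolev_fun_L6[OF assms]]
      L2_field_scaleR[OF weak_grad(1)[OF assms]] weak_gradient_cmul[OF weak_grad(2)[OF assms]]])

lemma L2_field_zero: "L2_field (\<lambda>x. 0)"
  by (simp add: L2_field_def)

lemma weak_gradient_zero_fun: "weak_gradient (\<lambda>x. 0) (\<lambda>x. 0)"
  by (simp add: weak_gradient_def)

lemma sobolev_fun_zero: "sobolev_fun (\<lambda>x. 0)"
  by (rule sobolev_funI[OF _ L2_field_zero weak_gradient_zero_fun]) (simp add: L6_fun_def)

lemma weak_grad_add_AE:
  assumes "sobolev_fun v" "sobolev_fun w"
  shows "AE x in lborel. weak_grad (\<lambda>x. v x + w x) x = weak_grad v x + weak_grad w x"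
  by (rule weak_grad_unique[OF sobolev_fun_add[OF assms]
      L2_field_add[OF weak_grad(1)[OF assms(1)] weak_grad(1)[OF assms(2)]]
      weak_gradient_weak_grad_add[OF assms]])

lemma weak_grad_cmul_AE:
  assumes "sobolev_fun v"
  shows "AE x in lborel. weak_grad (\<lambda>x. c * v x) x = c *\<^sub>R weak_grad v x"
  by (rule weak_grad_unique[OF sobolev_fun_cmul[OF assms]
      L2_field_scaleR[OF weak_grad(1)[OF assms]] weak_gradient_cmul[OF weak_grad(2)[OF assms]]])

text \<open>The space $\dot H^1(\mathbb{R}^3)$: functions modulo equality almost everywhere, with inner
  product $(u,v) = \int \nabla u \cdot \nabla v$.\<close>

quotient_type hom_sobolev = "real^3 \<Rightarrow> real" / partial:
    "\<lambda>u v. sobolev_fun u \<and> sobolev_fun v \<and> (AE x in lborel. u x = v x)"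
proof (rule part_equivpI)
  show "\<exists>u. sobolev_fun u \<and> sobolev_fun u \<and> (AE x in lborel. u x = u x)"
    by (rule exI[of _ "\<lambda>x. 0"]) (simp add: sobolev_fun_zero)
  show "symp (\<lambda>u v. sobolev_fun u \<and> sobolev_fun v \<and> (AE x in lborel. u x = v x))"
    by (rule sympI) (simp add: eq_commute)
  show "transp (\<lambda>u v. sobolev_fun u \<and> sobolev_fun v \<and> (AE x in lborel. u x = v x))"
  proof (rule transpI, elim conjE, intro conjI)
    fix u v w :: "real^3 \<Rightarrow> real"
    assume "AE x in lborel. u x = v x" "AE x in lborel. v x = w x"
    then show "AE x in lborel. u x = w x" by eventually_elim simp
  qed
qed

instantiation hom_sobolev :: real_vector
begin

lift_definition zero_hom_sobolev :: hom_sobolev is "\<lambda>x. 0"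
  by (simp add: sobolev_fun_zero)

lift_definition plus_hom_sobolev :: "hom_sobolev \<Rightarrow> hom_sobolev \<Rightarrow> hom_sobolev"
  is "\<lambda>u v x. u x + v x"
proof (elim conjE, intro conjI sobolev_fun_add)
  fix u u' v v' :: "real^3 \<Rightarrow> real"
  assume "AE x in lborel. u x = u' x" "AE x in lborel. v x = v' x"
  then show "AE x in lborel. u x + v x = u' x + v' x" by eventually_elim simp
qed

lift_definition scaleR_hom_sobolev :: "real \<Rightarrow> hom_sobolev \<Rightarrow> hom_sobolev"
  is "\<lambda>c v x. c * v x"
proof (elim conjE, intro conjI sobolev_fun_cmul)
  fix c and v v' :: "real^3 \<Rightarrow> real"
  assume "AE x in lborel. v x = v' x"
  then show "AE x in lborel. c * v x = c * v' x" by eventually_elim simp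
qed

definition "uminus v = (-1) *\<^sub>R v" for v :: hom_sobolev
definition "u - v = u + (-1) *\<^sub>R v" for u v :: hom_sobolev
instance
proof
  fix u v w :: hom_sobolev and a b :: real
  show "u + v + w = u + (v + w)"
    by transfer (simp add: add.assoc sobolev_fun_add)
  show "u + v = v + u"
    by transfer (simp add: add.commute sobolev_fun_add)
  show "0 + u = u" by transfer simp
  show "- u + u = 0"
    unfolding uminus_hom_sobolev_def
    by transfer (use sobolev_fun_cmul[of _ "-1"] in \<open>simp add: sobolev_fun_zero\<close>)
  show "u - v = u + - v"
    by (simp add: minus_hom_sobolev_def uminus_hom_sobolev_def)
  show "a *\<^sub>R (u + v) = a *\<^sub>R u + a *\<^sub>R v"
    by transfer (simp add: distrib_left sobolev_fun_add sobolev_fun_cmul)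
  show "(a + b) *\<^sub>R u = a *\<^sub>R u + b *\<^sub>R u"
    by transfer (simp add: distrib_right sobolev_fun_add sobolev_fun_cmul)
  show "a *\<^sub>R b *\<^sub>R u = (a * b) *\<^sub>R u"
    by transfer (simp add: mult.assoc sobolev_fun_cmul)
  show "1 *\<^sub>R u = u" by transfer simp
qed

end

instantiation hom_sobolev :: real_inner
begin

lift_definition inner_hom_sobolev :: "hom_sobolev \<Rightarrow> hom_sobolev \<Rightarrow> real"
  is "\<lambda>u v. LINT x|lborel. weak_grad u x \<bullet> weak_grad v x"
proof -
  fix u u' v v'
  assume u: "sobolev_fun u \<and> sobolev_fun u' \<and> (AE x in lborel. u x = u' x)"
    and v: "sobolev_fun v \<and> sobolev_fun v' \<and> (AE x in lborel. v x = v' x)"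
  have m: "weak_grad w \<in> borel_measurable lborel" if "sobolev_fun w" for w
    using weak_grad(1)[OF that] by (simp add: L2_field_def)
  have [measurable]: "weak_grad u \<in> borel_measurable lborel" "weak_grad u' \<in> borel_measurable lborel"
    "weak_grad v \<in> borel_measurable lborel" "weak_grad v' \<in> borel_measurable lborel"
    using m u v by auto
  have "AE x in lborel. weak_grad u x = weak_grad u' x" "AE x in lborel. weak_grad v x = weak_grad v' x"
    using u v by (simp_all add: weak_grad_cong)
  then have "AE x in lborel. weak_grad u x \<bullet> weak_grad v x = weak_grad u' x \<bullet> weak_grad v' x"
    by eventually_elim simp
  then show "(LINT x|lborel. weak_grad u x \<bullet> weak_grad v x)
      = (LINT x|lborel. weak_grad u' x \<bullet> weak_grad v' x)"
    by (intro integral_cong_AE) simp_all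
qed

definition "norm v = sqrt (inner v v)" for v :: hom_sobolev
definition "sgn v = v /\<^sub>R norm v" for v :: hom_sobolev
definition "dist u v = norm (u - v)" for u v :: hom_sobolev
definition [code del]: "(uniformity :: (hom_sobolev \<times> hom_sobolev) filter) =
  (INF e\<in>{0 <..}. principal {(u, v). dist u v < e})"
definition [code del]: "open U \<longleftrightarrow>
  (\<forall>u\<in>U. eventually (\<lambda>(u', v). u' = u \<longrightarrow> v \<in> U) uniformity)" for U :: "hom_sobolev set"

instance
proof
  fix u v w :: hom_sobolev and a :: real
  show "sgn u = u /\<^sub>R norm u" by (rule sgn_hom_sobolev_def)
  show "dist u v = norm (u - v)" by (rule dist_hom_sobolev_def)
  show "uniformity = (INF e\<in>{0<..}. principal {(u :: hom_sobolev, v). dist u v < e})"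
    by (rule uniformity_hom_sobolev_def)
  show "open U \<longleftrightarrow> (\<forall>u\<in>U. \<forall>\<^sub>F (u', v) in uniformity. u' = u \<longrightarrow> v \<in> U)" for U :: "hom_sobolev set"
    by (rule open_hom_sobolev_def)
  show "norm u = sqrt (inner u u)" by (rule norm_hom_sobolev_def)
  show "inner u v = inner v u" by transfer (simp add: inner_commute)
  show "inner (u + v) w = inner u w + inner v w"
  proof transfer
    fix u v w
    assume "sobolev_fun u \<and> sobolev_fun u \<and> (AE x in lborel. u x = u x)"
      "sobolev_fun v \<and> sobolev_fun v \<and> (AE x in lborel. v x = v x)"
      "sobolev_fun w \<and> sobolev_fun w \<and> (AE x in lborel. w x = w x)"
    then have u: "sobolev_fun u" and v: "sobolev_fun v" and w: "sobolev_fun w" by auto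
    note g = weak_grad(1)[OF u] weak_grad(1)[OF v] weak_grad(1)[OF w]
      weak_grad(1)[OF sobolev_fun_add[OF u v]]
    have [measurable]: "weak_grad u \<in> borel_measurable lborel" "weak_grad v \<in> borel_measurable lborel"
      "weak_grad w \<in> borel_measurable lborel" "weak_grad (\<lambda>x. u x + v x) \<in> borel_measurable lborel"
      using g by (simp_all add: L2_field_def)
    have "(LINT x|lborel. weak_grad (\<lambda>x. u x + v x) x \<bullet> weak_grad w x)
      = (LINT x|lborel. weak_grad u x \<bullet> weak_grad w x + weak_grad v x \<bullet> weak_grad w x)"
      by (intro integral_cong_AE eventually_mono[OF weak_grad_add_AE[OF u v]])
         (simp_all add: inner_add_left)
    also have "\<dots> = (LINT x|lborel. weak_grad u x \<bullet> weak_grad w x)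
        + (LINT x|lborel. weak_grad v x \<bullet> weak_grad w x)"
      by (intro Bochner_Integration.integral_add L2_field_inner g)
    finally show "(LINT x|lborel. weak_grad (\<lambda>x. u x + v x) x \<bullet> weak_grad w x) = \<dots>" .
  qed
  show "inner (a *\<^sub>R u) v = a * inner u v"
  proof transfer
    fix a u v
    assume "sobolev_fun u \<and> sobolev_fun u \<and> (AE x in lborel. u x = u x)"
      "sobolev_fun v \<and> sobolev_fun v \<and> (AE x in lborel. v x = v x)"
    then have u: "sobolev_fun u" and v: "sobolev_fun v" by auto
    have [measurable]: "weak_grad u \<in> borel_measurable lborel" "weak_grad v \<in> borel_measurable lborel"
      "weak_grad (\<lambda>x. a * u x) \<in> borel_measurable lborel"
      using weak_grad(1) u v sobolev_fun_cmul[OF u] by (auto simp: L2_field_def)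
    have "(LINT x|lborel. weak_grad (\<lambda>x. a * u x) x \<bullet> weak_grad v x)
      = (LINT x|lborel. a * (weak_grad u x \<bullet> weak_grad v x))"
      by (intro integral_cong_AE eventually_mono[OF weak_grad_cmul_AE[OF u, of a]]) simp_all
    then show "(LINT x|lborel. weak_grad (\<lambda>x. a * u x) x \<bullet> weak_grad v x)
        = a * (LINT x|lborel. weak_grad u x \<bullet> weak_grad v x)" by simp
  qed
  show "0 \<le> inner u u" by transfer simp
  show "inner u u = 0 \<longleftrightarrow> u = 0"
  proof transfer
    fix u
    assume "sobolev_fun u \<and> sobolev_fun u \<and> (AE x in lborel. u x = u x)"
    then have u: "sobolev_fun u" by auto
    note g = weak_grad(1)[OF u]
    have "(LINT x|lborel. weak_grad u x \<bullet> weak_grad u x) = 0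
        \<longleftrightarrow> (AE x in lborel. weak_grad u x \<bullet> weak_grad u x = 0)"
      by (intro integral_nonneg_eq_0_iff_AE L2_field_inner g) simp
    also have "\<dots> \<longleftrightarrow> (AE x in lborel. weak_grad u x = 0)" by simp
    also have "\<dots> \<longleftrightarrow> (AE x in lborel. u x = 0)"
    proof
      assume "AE x in lborel. weak_grad u x = 0"
      then show "AE x in lborel. u x = 0"
        by (rule weak_gradient_zero[OF weak_grad(2)[OF u]])
           (use g u in \<open>simp_all add: L2_field_def sobolev_fun_def L6_fun_def\<close>)
    next
      assume "AE x in lborel. u x = 0"
      then show "AE x in lborel. weak_grad u x = 0"
        by (rule weak_grad_eqI[OF u sobolev_fun_zero L2_field_zero weak_gradient_zero_fun])
    qed
    finally show "(LINT x|lborel. weak_grad u x \<bullet> weak_grad u x) = 0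
        \<longleftrightarrow> sobolev_fun u \<and> sobolev_fun (\<lambda>x. 0) \<and> (AE x in lborel. u x = 0)"
      using u sobolev_fun_zero by simp
  qed
qed

end

section \<open>The operators and the boundary value problem\<close>

text \<open>The dual space is the space of bounded functionals \<^typ>\<open>hom_sobolev \<Rightarrow>\<^sub>L real\<close>; the (weak)
  operator $-\Delta$ sends \<^term>\<open>u\<close> to the functional $v \mapsto \int \nabla u \cdot \nabla v$, and
  its inverse is \<^term>\<open>inv neg_laplacian\<close>.\<close>

definition neg_laplacian :: "hom_sobolev \<Rightarrow> (hom_sobolev \<Rightarrow>\<^sub>L real)" where
  "neg_laplacian u = blinfun_inner_right u"

lift_definition vanishes_on :: "hom_sobolev \<Rightarrow> (real^3) set \<Rightarrow> bool"
  is "\<lambda>v A. AE x in lborel. x \<in> A \<longrightarrow> v x = 0"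
proof (rule ext)
  fix v v' :: "real^3 \<Rightarrow> real" and A
  assume "sobolev_fun v \<and> sobolev_fun v' \<and> (AE x in lborel. v x = v' x)"
  then have *: "AE x in lborel. v x = v' x" by simp
  show "(AE x in lborel. x \<in> A \<longrightarrow> v x = 0) = (AE x in lborel. x \<in> A \<longrightarrow> v' x = 0)"
  proof
    assume "AE x in lborel. x \<in> A \<longrightarrow> v x = 0"
    with * show "AE x in lborel. x \<in> A \<longrightarrow> v' x = 0" by eventually_elim auto
  next
    assume "AE x in lborel. x \<in> A \<longrightarrow> v' x = 0"
    with * show "AE x in lborel. x \<in> A \<longrightarrow> v x = 0" by eventually_elim auto
  qed
qed

definition orth_proj :: "'a::real_inner set \<Rightarrow> 'a \<Rightarrow> 'a" where
  "orth_proj W w = (THE p. p \<in> W \<and> w - p \<in> orthogonal_comp W)"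

definition Q_proj :: "real^3 \<Rightarrow> real \<Rightarrow> hom_sobolev \<Rightarrow> hom_sobolev" where
  "Q_proj a \<rho> = orth_proj (orthogonal_comp {v. vanishes_on v (cball a \<rho>)})"

text \<open>The term $e^{-|x_j|} Q_j$ of the operator series. For infinite index sets the series converges
  strongly, not in operator norm in general, so it is summed pointwise in $\dot H^1$.\<close>

definition weighted_Q :: "(nat \<Rightarrow> real^3) \<Rightarrow> (nat \<Rightarrow> real) \<Rightarrow> nat \<Rightarrow> hom_sobolev \<Rightarrow> hom_sobolev" where
  "weighted_Q x r j w = exp (- norm (x j)) *\<^sub>R Q_proj (x j) (r j) w"

text \<open>Particle configurations are indexed by a set of natural numbers, which covers all finite or
  countable index sets up to reindexing. The distance to the nearest other centre is the infimum
  in $[0,\infty]$: it is $\infty$ for a single particle, whose contribution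
  $r_j d_j^{-3}$ to the supremum is then $0$.\<close>

definition nearest_dist :: "nat set \<Rightarrow> (nat \<Rightarrow> real^3) \<Rightarrow> nat \<Rightarrow> ennreal" where
  "nearest_dist I x j = (INF k\<in>I - {j}. ennreal (norm (x j - x k)))"

definition capacity_density :: "nat set \<Rightarrow> (nat \<Rightarrow> real^3) \<Rightarrow> (nat \<Rightarrow> real) \<Rightarrow> ennreal" where
  "capacity_density I x r = (SUP j\<in>I. ennreal (r j) * inverse (nearest_dist I x j ^ 3))"

definition particle_union :: "nat set \<Rightarrow> (nat \<Rightarrow> real^3) \<Rightarrow> (nat \<Rightarrow> real) \<Rightarrow> (real^3) set" where
  "particle_union I x r = (\<Union>j\<in>I. closure (ball (x j) (r j)))"

definition is_solution :: "(real^3) set \<Rightarrow> (hom_sobolev \<Rightarrow>\<^sub>L real) \<Rightarrow> hom_sobolev \<Rightarrow> bool" where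
  "is_solution K f u \<longleftrightarrow>
     vanishes_on u K \<and> (\<forall>v. vanishes_on v K \<longrightarrow> u \<bullet> v = blinfun_apply f v)"

end

theory Submission
  imports Defs
begin

text \<open>With \<open>A = \<Sum> e\<^bsup>-|x\<^sub>j|\<^esup> Q\<^sub>j\<close> and \<open>0 \<le> \<gamma>A \<le> 1\<close>, the powers \<open>(1 - \<gamma>A)\<^sup>N\<close> converge strongly to the
  orthogonal projection onto the kernel of \<open>A\<close>: the squared norms of the iterates drop by at least
  \<open>\<parallel>\<gamma>A e\<^sub>N\<parallel>\<^sup>2\<close> in each step, so the iteration tends to zero on the range of \<open>A\<close>. The kernel consists
  of the functions vanishing in all the balls, and projecting the Riesz representative of \<open>f\<close> onto it
  gives the solution.

  The analytic content is the bound \<open>\<Sum> e\<^bsup>-|x\<^sub>j|\<^esup> \<parallel>Q\<^sub>j w\<parallel>\<^sup>2 \<le> C \<parallel>w\<parallel>\<^sup>2\<close>. Since \<open>Q\<^sub>j w\<close> has minimal energy among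
  the extensions of \<open>w\<close> from the ball, it is estimated by \<open>\<theta>\<^sub>j w\<close> with a cutoff \<open>\<theta>\<^sub>j\<close> supported in the
  ball of radius \<open>\<kappa>r\<^sub>j\<close>. Comparing \<open>w\<close> with its dilation by \<open>\<rho>\<^sub>j / (\<kappa>r\<^sub>j)\<close>, \<open>\<rho>\<^sub>j = d\<^sub>j/2\<close>, bounds the energy of
  \<open>\<theta>\<^sub>j w\<close> by \<open>\<integral>\<bar>\<nabla>w\<bar>\<^sup>2\<close> plus \<open>r\<^sub>j \<rho>\<^sub>j\<^bsup>-3\<^esup> \<integral>w\<^sup>2\<close> over the ball of radius \<open>\<rho>\<^sub>j\<close>; these balls are disjoint, and
  the second terms add up to Hardy's integral \<open>\<integral>w\<^sup>2/\<bar>x\<bar>\<^sup>2\<close> by the bound on the capacity density.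

  Completeness of the space rests on the Sobolev inequality for compactly supported functions
  and on their density. A function orthogonal to all of them is weakly harmonic; its
  mollifications have vanishing gradient by Caccioppoli's inequality, so it is zero.\<close>

section \<open>Orthogonal projections and Richardson iteration in Hilbert spaces\<close>

text \<open>The local estimates leave behind the L^2 mass of w over disjoint balls, which a function
  of the energy space need not have. The factor e^{-|x|}, through the boundedness of e^{-t} t^2,
  turns this mass into Hardy's integral; this explains the weights and why the constant depends only
  on \<kappa> and the density bound. No spectral gap is assumed, so the iteration converges strongly
  and without a rate.

  The space is a quotient of functions with weak gradients, and nothing in its definition bounds the
  L^6 norm by the energy. Existence of projections and closedness of the functions vanishing on a
  ball both hinge on such a bound. It is available at first only for compactly supported functions,
  and their density cannot presuppose completeness. The way out is that a projection onto a complete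
  subspace exists in any inner product space: project onto the closure of the compactly supported
  functions and show that the residual is zero.

  The Sobolev and Hardy estimates use the fundamental theorem of calculus along lines or rays, so
  they are proved for \<open>C1c_fun\<close> functions, and their consequences are extended by
  density.\<close>

lemma mem_orthogonal_comp: "x \<in> orthogonal_comp W \<longleftrightarrow> (\<forall>y\<in>W. x \<bullet> y = 0)"
  by (auto simp: orthogonal_comp_def orthogonal_def inner_commute)

lemma closed_orthogonal_comp: "closed (orthogonal_comp W)"
proof -
  have "orthogonal_comp W = (\<Inter>y\<in>W. {x. x \<bullet> y = 0})"
    by (auto simp: mem_orthogonal_comp)
  also have "closed \<dots>"
    by (intro closed_INT ballI closed_Collect_eq continuous_intros)
  finally show ?thesis .
qed

text \<open>Completeness is asked of \<open>M\<close> alone, not of the ambient space: the lemma is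
  later applied to the closure of the compactly supported functions, before the whole space is known
  to be complete. A minimizing sequence is Cauchy by the parallelogram identity, and its limit is
  the nearest point.\<close>

lemma projection_exists:
  fixes M :: "'a::real_inner set"
  assumes M: "subspace M" and "complete M"
  shows "\<exists>p\<in>M. x - p \<in> orthogonal_comp M"
proof -
  define d where "d = (INF m\<in>M. norm (x - m))"
  have ne: "M \<noteq> {}" using subspace_0[OF M] by auto
  have bdd: "bdd_below ((\<lambda>m. norm (x - m)) ` M)" by (intro bdd_belowI[of _ 0]) auto
  have d0: "d \<ge> 0" unfolding d_def using ne by (intro cINF_greatest) auto
  have dle: "d \<le> norm (x - m)" if "m \<in> M" for m
    unfolding d_def using that by (intro cINF_lower bdd)
  have "\<exists>m\<in>M. norm (x - m) < d + 1 / real (Suc n)" for n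
    using cINF_less_iff[OF ne bdd, of "d + 1 / real (Suc n)"] unfolding d_def[symmetric] by simp
  then obtain s where sM: "\<And>n. s n \<in> M" and s: "\<And>n. norm (x - s n) < d + 1 / real (Suc n)"
    by metis
  have lim: "(\<lambda>n. norm (x - s n)) \<longlonglongrightarrow> d"
  proof (rule tendsto_sandwich[of "\<lambda>_. d" _ _ "\<lambda>n. d + 1 / real (Suc n)"])
    have "(\<lambda>n. d + 1 / real (Suc n)) \<longlonglongrightarrow> d + 0"
      by (intro tendsto_intros filterlim_compose[OF LIMSEQ_inverse_real_of_nat[unfolded inverse_eq_divide]] filterlim_ident)
    then show "(\<lambda>n. d + 1 / real (Suc n)) \<longlonglongrightarrow> d" by simp
  qed (use dle sM s in \<open>auto intro!: always_eventually simp: less_imp_le\<close>)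
  \<comment> \<open>The parallelogram identity for \<open>x - a\<close> and \<open>x - b\<close>;
    their midpoint is \<open>x\<close> minus the point \<open>(1/2) *\<^sub>R (a + b)\<close> of
    \<open>M\<close>, so it has norm at least \<open>d\<close>.\<close>
  have para: "(norm (a - b))\<^sup>2 \<le> 2 * (norm (x - a))\<^sup>2 + 2 * (norm (x - b))\<^sup>2 - 4 * d\<^sup>2"
    if "a \<in> M" "b \<in> M" for a b
  proof -
    have "(1/2) *\<^sub>R (a + b) \<in> M" using that M by (simp add: subspace_add subspace_scale)
    from dle[OF this] have "d\<^sup>2 \<le> (norm (x - (1/2) *\<^sub>R (a + b)))\<^sup>2"
      using d0 by (intro power_mono) auto
    moreover have "(norm (a - b))\<^sup>2 = 2 * (norm (x - a))\<^sup>2 + 2 * (norm (x - b))\<^sup>2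
        - 4 * (norm (x - (1/2) *\<^sub>R (a + b)))\<^sup>2"
      unfolding power2_norm_eq_inner by (simp add: algebra_simps inner_commute)
    ultimately show ?thesis by linarith
  qed
  have "Cauchy s"
  proof (rule metric_CauchyI)
    fix e :: real assume "e > 0"
    have "(\<lambda>n. (norm (x - s n))\<^sup>2) \<longlonglongrightarrow> d\<^sup>2" by (intro tendsto_intros lim)
    moreover have "d\<^sup>2 < d\<^sup>2 + e\<^sup>2 / 4" using \<open>e > 0\<close> by simp
    ultimately have "\<forall>\<^sub>F n in sequentially. (norm (x - s n))\<^sup>2 < d\<^sup>2 + e\<^sup>2 / 4"
      by (rule order_tendstoD(2))
    then obtain N where N: "\<And>n. n \<ge> N \<Longrightarrow> (norm (x - s n))\<^sup>2 < d\<^sup>2 + e\<^sup>2 / 4"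
      unfolding eventually_sequentially by auto
    have "dist (s m) (s n) < e" if "m \<ge> N" "n \<ge> N" for m n
    proof -
      have "(norm (s m - s n))\<^sup>2 < e\<^sup>2"
        using para[OF sM[of m] sM[of n]] N[OF that(1)] N[OF that(2)] by linarith
      then show ?thesis using \<open>e > 0\<close> by (simp add: dist_norm power_less_imp_less_base)
    qed
    then show "\<exists>M. \<forall>m\<ge>M. \<forall>n\<ge>M. dist (s m) (s n) < e" by blast
  qed
  then obtain p where p: "p \<in> M" "s \<longlonglongrightarrow> p"
    using \<open>complete M\<close> sM unfolding complete_def by blast
  have "(\<lambda>n. norm (x - s n)) \<longlonglongrightarrow> norm (x - p)" by (intro tendsto_intros p)
  with lim have dp: "norm (x - p) = d" by (rule LIMSEQ_unique[symmetric])
  have "(x - p) \<bullet> y = 0" if "y \<in> M" for y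
  proof (cases "y = 0")
    case False
    \<comment> \<open>The minimizer of the squared distance to \<open>x\<close> along the line
      through \<open>p\<close> in direction \<open>y\<close>; unless the inner product vanishes, the
      distance would fall below \<open>d\<close>.\<close>
    define t where "t = (x - p) \<bullet> y / (y \<bullet> y)"
    have "p + t *\<^sub>R y \<in> M" using that p(1) M by (simp add: subspace_add subspace_scale)
    from dle[OF this] have "(norm (x - p))\<^sup>2 \<le> (norm (x - p - t *\<^sub>R y))\<^sup>2"
      unfolding dp using d0 by (intro power_mono) (simp_all add: algebra_simps)
    also have "\<dots> = (norm (x - p))\<^sup>2 - 2 * t * ((x - p) \<bullet> y) + t * t * (y \<bullet> y)"
      unfolding power2_norm_eq_inner by (simp add: inner_diff inner_commute algebra_simps)
    also have "\<dots> = (norm (x - p))\<^sup>2 - ((x - p) \<bullet> y)\<^sup>2 / (y \<bullet> y)"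
      using False by (simp add: t_def power2_eq_square field_simps)
    finally have "((x - p) \<bullet> y)\<^sup>2 / (y \<bullet> y) \<le> 0" by simp
    moreover have "y \<bullet> y > 0" using False by simp
    ultimately have "((x - p) \<bullet> y)\<^sup>2 \<le> 0" by (simp add: divide_le_0_iff)
    then show ?thesis by simp
  qed simp
  with p(1) show ?thesis by (auto simp: mem_orthogonal_comp)
qed

lemma orth_proj_eqI:
  assumes M: "subspace M" and "p \<in> M" "x - p \<in> orthogonal_comp M"
  shows "orth_proj M x = p"
  unfolding orth_proj_def
proof (rule the_equality)
  fix q assume q: "q \<in> M \<and> x - q \<in> orthogonal_comp M"
  then have "q - p \<in> M" using assms by (simp add: subspace_diff)
  then have "(x - p) \<bullet> (q - p) = 0" "(x - q) \<bullet> (q - p) = 0"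
    using q assms(3) by (auto simp: mem_orthogonal_comp)
  then have "(q - p) \<bullet> (q - p) = 0" by (simp add: inner_diff)
  then show "q = p" by simp
qed (use assms in auto)

context
  fixes M :: "'a::real_inner set"
  assumes M: "subspace M" "complete M"
begin

lemma orth_proj_in: "orth_proj M x \<in> M"
  and orth_proj_diff: "x - orth_proj M x \<in> orthogonal_comp M"
  using projection_exists[OF M, of x] orth_proj_eqI[OF M(1)] by blast+

lemma orth_proj_add: "orth_proj M (x + y) = orth_proj M x + orth_proj M y"
proof (rule orth_proj_eqI[OF M(1)])
  have "(x - orth_proj M x) + (y - orth_proj M y) \<in> orthogonal_comp M"
    by (intro subspace_add subspace_orthogonal_comp orth_proj_diff)
  then show "x + y - (orth_proj M x + orth_proj M y) \<in> orthogonal_comp M"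
    by (simp add: algebra_simps)
qed (intro subspace_add M orth_proj_in)

lemma orth_proj_scale: "orth_proj M (c *\<^sub>R x) = c *\<^sub>R orth_proj M x"
proof (rule orth_proj_eqI[OF M(1)])
  have "c *\<^sub>R (x - orth_proj M x) \<in> orthogonal_comp M"
    by (intro subspace_scale subspace_orthogonal_comp orth_proj_diff)
  then show "c *\<^sub>R x - c *\<^sub>R orth_proj M x \<in> orthogonal_comp M"
    by (simp add: algebra_simps)
qed (intro subspace_scale M orth_proj_in)

lemma inner_orth_proj: "y \<in> M \<Longrightarrow> y \<bullet> orth_proj M x = y \<bullet> x"
  using orth_proj_diff[of x] by (auto simp: mem_orthogonal_comp inner_diff inner_commute)

lemma orth_proj_symmetric: "orth_proj M x \<bullet> y = x \<bullet> orth_proj M y"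
  using inner_orth_proj[OF orth_proj_in, of x y] inner_orth_proj[OF orth_proj_in, of y x]
  by (metis inner_commute)

lemma orth_proj_inner_self: "orth_proj M x \<bullet> x = (norm (orth_proj M x))\<^sup>2"
  using inner_orth_proj[OF orth_proj_in, of x x] by (simp add: power2_norm_eq_inner)

lemma norm_orth_proj_le: "norm (orth_proj M x) \<le> norm x"
proof (cases "orth_proj M x = 0")
  case False
  have "norm (orth_proj M x) * norm (orth_proj M x) \<le> norm (orth_proj M x) * norm x"
    using norm_cauchy_schwarz[of "orth_proj M x" x] orth_proj_inner_self[of x]
    by (simp add: power2_eq_square)
  with False show ?thesis by simp
qed simp

lemma bounded_linear_orth_proj: "bounded_linear (orth_proj M)"
  by (rule bounded_linear_intro[of _ 1]) (auto simp: orth_proj_add orth_proj_scale norm_orth_proj_le)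

end

lemma orthogonal_comp_orthogonal_comp_complete:
  fixes M :: "'a::real_inner set"
  assumes "subspace M" "complete M"
  shows "orthogonal_comp (orthogonal_comp M) = M"
proof
  show "orthogonal_comp (orthogonal_comp M) \<subseteq> M"
  proof
    fix x assume x: "x \<in> orthogonal_comp (orthogonal_comp M)"
    let ?p = "orth_proj M x"
    have "x \<bullet> (x - ?p) = 0"
      using x orth_proj_diff[OF assms, of x] by (auto simp: mem_orthogonal_comp)
    moreover have "?p \<bullet> (x - ?p) = 0"
      using orth_proj_in[OF assms, of x] orth_proj_diff[OF assms, of x]
      by (auto simp: mem_orthogonal_comp inner_commute)
    ultimately have "(x - ?p) \<bullet> (x - ?p) = 0" by (simp add: inner_diff inner_commute)
    then show "x \<in> M" using orth_proj_in[OF assms, of x] by simp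
  qed
qed (metis (no_types, lifting) inner_commute mem_orthogonal_comp subsetI)

lemma Riesz_representation:
  fixes f :: "'a::{real_inner, complete_space} \<Rightarrow>\<^sub>L real"
  shows "\<exists>u. \<forall>v. u \<bullet> v = f v"
proof (cases "f = 0")
  case False
  define M where "M = {v. f v = 0}"
  have "closed M" unfolding M_def by (intro closed_Collect_eq continuous_intros)
  then have M: "subspace M" "complete M"
    by (auto simp: M_def subspace_def blinfun.bilinear_simps complete_eq_closed)
  obtain x where x: "f x \<noteq> 0" using False blinfun_eqI[of f 0] by auto
  define e where "e = x - orth_proj M x"
  have fe: "f e = f x"
    using orth_proj_in[OF M, of x] by (simp add: e_def M_def blinfun.bilinear_simps)
  have e: "e \<bullet> m = 0" if "f m = 0" for m
    using orth_proj_diff[OF M, of x] that unfolding e_def mem_orthogonal_comp by (auto simp: M_def)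
  have "e \<noteq> 0" using fe x by auto
  have "((f e / (e \<bullet> e)) *\<^sub>R e) \<bullet> v = f v" for v
  proof -
    have "f (v - (f v / f e) *\<^sub>R e) = 0" using fe x by (simp add: blinfun.bilinear_simps)
    from e[OF this] have "e \<bullet> v = (f v / f e) * (e \<bullet> e)" by (simp add: inner_diff_right)
    then show ?thesis using fe x \<open>e \<noteq> 0\<close> by simp
  qed
  then show ?thesis by blast
qed (auto intro!: exI[of _ 0])

text \<open>The \<open>f i\<close> need not be absolutely summable. The sums of \<open>g\<close> are
  increasing and bounded, so they are nearly maximal at some finite \<open>F0\<close>; beyond it the
  sums of \<open>g\<close>, and with them the norms of the sums of \<open>f\<close>, are small. This
  is the Cauchy criterion for the net of finite subsets.\<close>

lemma summable_on_if_sum_norm_le: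
  fixes f :: "'i \<Rightarrow> 'a::{real_normed_vector, complete_space}" and g :: "'i \<Rightarrow> real"
  assumes g: "\<And>i. i \<in> I \<Longrightarrow> g i \<ge> 0" "\<And>F. finite F \<Longrightarrow> F \<subseteq> I \<Longrightarrow> sum g F \<le> B"
    and le: "\<And>F. finite F \<Longrightarrow> F \<subseteq> I \<Longrightarrow> (norm (sum f F))\<^sup>2 \<le> C * sum g F"
  shows "f summable_on I"
proof -
  have C: "(norm (sum f F))\<^sup>2 \<le> \<bar>C\<bar> * sum g F" if "finite F" "F \<subseteq> I" for F
    using le[OF that] mult_right_mono[of C "\<bar>C\<bar>" "sum g F"] g(1) that
    by (smt (verit) subsetD sum_nonneg)
  define S where "S = (SUP F\<in>{F. finite F \<and> F \<subseteq> I}. sum g F)"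
  have bdd: "bdd_above (sum g ` {F. finite F \<and> F \<subseteq> I})" using g(2) by (auto intro!: bdd_aboveI[of _ B])
  have "\<exists>P. eventually P (finite_subsets_at_top I) \<and>
              (\<forall>F F'. P F \<and> P F' \<longrightarrow> dist (sum f F) (sum f F') < e)" if "e > 0" for e
  proof -
    \<comment> \<open>Chosen so that \<open>\<bar>C\<bar> * d\<close> stays below
      \<open>(e / 2)\<^sup>2\<close>; the added 1 covers \<open>C = 0\<close>.\<close>
    define d where "d = (e / 2)\<^sup>2 / (\<bar>C\<bar> + 1)"
    have "d > 0" using that by (simp add: d_def)
    then have "S - d < S" by simp
    then obtain F0 where F0: "finite F0" "F0 \<subseteq> I" "S - d < sum g F0"
      unfolding S_def by (subst (asm) less_cSUP_iff) (use bdd in auto)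
    have *: "norm (sum f F - sum f F0) < e / 2" if F: "finite F" "F0 \<subseteq> F" "F \<subseteq> I" for F
    proof -
      have "sum g F \<le> S" unfolding S_def using F by (intro cSUP_upper bdd) auto
      then have "sum g (F - F0) < d" using F F0 by (simp add: sum_diff)
      then have "(norm (sum f (F - F0)))\<^sup>2 \<le> \<bar>C\<bar> * d"
        using C[of "F - F0"] F mult_left_mono[of "sum g (F - F0)" d "\<bar>C\<bar>"] by fastforce
      also have "\<dots> < (\<bar>C\<bar> + 1) * d" using \<open>d > 0\<close> by simp
      also have "\<dots> = (e / 2)\<^sup>2" unfolding d_def by simp
      finally have "norm (sum f (F - F0)) < e / 2"
        by (rule power_less_imp_less_base) (use \<open>e > 0\<close> in simp)
      then show ?thesis using F by (simp add: sum_diff)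
    qed
    show ?thesis
    proof (intro exI[of _ "\<lambda>F. finite F \<and> F0 \<subseteq> F \<and> F \<subseteq> I"] conjI allI impI)
      show "\<forall>\<^sub>F F in finite_subsets_at_top I. finite F \<and> F0 \<subseteq> F \<and> F \<subseteq> I"
        unfolding eventually_finite_subsets_at_top using F0 by auto
      fix F F' assume "(finite F \<and> F0 \<subseteq> F \<and> F \<subseteq> I) \<and> (finite F' \<and> F0 \<subseteq> F' \<and> F' \<subseteq> I)"
      then have "norm (sum f F - sum f F0) < e / 2" "norm (sum f F' - sum f F0) < e / 2"
        using * by auto
      then show "dist (sum f F) (sum f F') < e"
        unfolding dist_norm using norm_diff_triangle_less[of "sum f F" "sum f F0" "e/2" "sum f F'" "e/2"]
        by (simp add: norm_minus_commute)
    qed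
  qed
  then have "cauchy_filter (filtermap (sum f) (finite_subsets_at_top I))"
    by (simp add: cauchy_filter_metric_filtermap)
  moreover have "complete (UNIV::'a set)"
    by (meson Cauchy_convergent UNIV_I complete_def convergent_def)
  ultimately obtain L where "(sum f \<longlongrightarrow> L) (finite_subsets_at_top I)"
    using complete_uniform[where S=UNIV] by (force simp add: filterlim_def)
  then show ?thesis using summable_on_def has_sum_def by blast
qed

lemma subspace_closure:
  fixes S :: "'a::real_normed_vector set"
  assumes "subspace S" shows "subspace (closure S)"
  unfolding subspace_def
proof (intro conjI allI ballI)
  show "0 \<in> closure S" using subspace_0[OF assms] closure_subset by blast
  fix x assume "x \<in> closure S"
  then obtain f where f: "\<And>n. f n \<in> S" "f \<longlonglongrightarrow> x" unfolding closure_sequential by blast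
  show "x + y \<in> closure S" if y: "y \<in> closure S" for y
  proof -
    obtain g where g: "\<And>n. g n \<in> S" "g \<longlonglongrightarrow> y" using y unfolding closure_sequential by blast
    have "(\<lambda>n. f n + g n) \<longlonglongrightarrow> x + y" by (intro tendsto_intros f g)
    moreover have "\<forall>n. f n + g n \<in> S" by (intro allI subspace_add[OF assms] f g)
    ultimately show ?thesis unfolding closure_sequential by (intro exI[of _ "\<lambda>n. f n + g n"]) auto
  qed
  show "c *\<^sub>R x \<in> closure S" for c
  proof -
    have "(\<lambda>n. c *\<^sub>R f n) \<longlonglongrightarrow> c *\<^sub>R x" by (intro tendsto_intros f)
    moreover have "\<forall>n. c *\<^sub>R f n \<in> S" by (intro allI subspace_scale[OF assms] f)
    ultimately show ?thesis unfolding closure_sequential by (intro exI[of _ "\<lambda>n. c *\<^sub>R f n"]) auto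
  qed
qed

text \<open>Nonnegativity of the form at the single point \<open>w - (1 / C) *\<^sub>R A w\<close>
  already gives the claim. It upgrades a bound on the quadratic form to a bound on norms without a
  square root of \<open>A\<close>.\<close>

lemma norm_le_quadratic_form:
  fixes A :: "'a::real_inner \<Rightarrow> 'a"
  assumes "linear A" and sym: "\<And>v w. A v \<bullet> w = v \<bullet> A w" and pos: "\<And>w. 0 \<le> A w \<bullet> w"
    and C: "\<And>w. A w \<bullet> w \<le> C * (norm w)\<^sup>2" and "C > 0"
  shows "(norm (A w))\<^sup>2 \<le> C * (A w \<bullet> w)"
proof -
  interpret linear A by fact
  let ?n = "(norm (A w))\<^sup>2"
  define t where "t = 1 / C"
  have "0 \<le> A (w - t *\<^sub>R A w) \<bullet> (w - t *\<^sub>R A w)" by (rule pos)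
  also have "\<dots> = A w \<bullet> w - 2 * t * ?n + t * t * (A (A w) \<bullet> A w)"
    using sym[of "A w" w] by (simp add: diff scale inner_diff inner_commute power2_norm_eq_inner algebra_simps)
  also have "\<dots> \<le> A w \<bullet> w - 2 * t * ?n + t * t * (C * ?n)"
    using C[of "A w"] by (intro add_left_mono mult_left_mono) auto
  also have "\<dots> = A w \<bullet> w - ?n / C" using \<open>C > 0\<close> by (simp add: t_def)
  finally show ?thesis using \<open>C > 0\<close> by (simp add: field_simps)
qed

text \<open>For a symmetric operator the orthogonal complement of the closed range is the kernel, so
  \<open>w\<close> splits into a kernel part, which the iteration fixes, and a part in the closure
  of the range. That closure can be strictly larger than the range; the limit zero carries over to
  it because all powers of \<open>T\<close> are nonexpansive.\<close>

lemma Richardson_iteration: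
  fixes B :: "'a::{real_inner, complete_space} \<Rightarrow> 'a"
  assumes B: "linear B" and sym: "\<And>v w. B v \<bullet> w = v \<bullet> B w" and pos: "\<And>w. 0 \<le> B w \<bullet> w"
    and le: "\<And>w. B w \<bullet> w \<le> (norm w)\<^sup>2"
  defines "T \<equiv> \<lambda>w. w - B w" and "M \<equiv> {w. B w = 0}"
  shows "(\<lambda>N. (T ^^ N) w) \<longlonglongrightarrow> orth_proj M w"
proof -
  interpret B: linear B by fact
  have Ble: "(norm (B w))\<^sup>2 \<le> B w \<bullet> w" for w
    using norm_le_quadratic_form[OF B sym pos, of 1 w] le by simp
  have Bn: "norm (B w) \<le> norm w" for w
    using order_trans[OF Ble le, of w] by (simp add: power2_le_iff_abs_le)
  have bl: "bounded_linear B"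
    by (rule bounded_linear_intro[of _ 1]) (auto simp: B.add B.scale Bn)
  have T: "linear T" unfolding T_def by (intro linear_compose_sub linear_ident B)
  have TN: "linear (T ^^ N)" for N
  proof (induction N)
    case (Suc N)
    from linear_compose[OF this T] show ?case by (simp add: o_def)
  qed (simp add: linear_ident)
  have dec: "(norm (T w))\<^sup>2 \<le> (norm w)\<^sup>2 - (norm (B w))\<^sup>2" for w
  proof -
    have "(norm (T w))\<^sup>2 = (norm w)\<^sup>2 - 2 * (B w \<bullet> w) + (norm (B w))\<^sup>2"
      unfolding T_def power2_norm_eq_inner by (simp add: inner_diff inner_commute)
    with Ble[of w] show ?thesis by linarith
  qed
  have nT: "norm (T w) \<le> norm w" for w
  proof (rule power2_le_imp_le)
    show "(norm (T w))\<^sup>2 \<le> (norm w)\<^sup>2"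
      using dec[of w] zero_le_power2[of "norm (B w)"] by linarith
  qed simp
  have nTN: "norm ((T ^^ N) w) \<le> norm w" for N w
  proof (induction N)
    case (Suc N)
    from order_trans[OF nT this] show ?case by simp
  qed simp
  have comm: "B ((T ^^ N) w) = (T ^^ N) (B w)" for N w
    by (induction N) (auto simp: T_def B.diff)
  have rng: "(\<lambda>N. (T ^^ N) (B w)) \<longlonglongrightarrow> 0" for w
  proof -
    \<comment> \<open>\<open>dec\<close> telescopes along the iterates, so the total drop is bounded
      by the initial energy.\<close>
    have "(\<Sum>k<N. (norm (B ((T ^^ k) w)))\<^sup>2) \<le> (norm w)\<^sup>2 - (norm ((T ^^ N) w))\<^sup>2" for N
    proof (induction N)
      case (Suc N)
      then show ?case using dec[of "(T ^^ N) w"] by simp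
    qed simp
    then have "(\<Sum>k<N. (norm (B ((T ^^ k) w)))\<^sup>2) \<le> (norm w)\<^sup>2" for N
      by (meson diff_le_eq le_add_same_cancel1 order_trans zero_le_power2)
    then have "summable (\<lambda>k. (norm (B ((T ^^ k) w)))\<^sup>2)"
      by (intro summableI_nonneg_bounded) auto
    then have "(\<lambda>k. (norm (B ((T ^^ k) w)))\<^sup>2) \<longlonglongrightarrow> 0" by (rule summable_LIMSEQ_zero)
    then have "(\<lambda>k. sqrt ((norm (B ((T ^^ k) w)))\<^sup>2)) \<longlonglongrightarrow> sqrt 0" by (rule tendsto_real_sqrt)
    then show ?thesis by (simp add: comm tendsto_norm_zero_iff)
  qed
  have cl: "(\<lambda>N. (T ^^ N) y) \<longlonglongrightarrow> 0" if y: "y \<in> closure (range B)" for y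
  proof (rule LIMSEQ_I)
    fix e :: real assume "e > 0"
    then obtain x where x: "dist (B x) y < e / 2"
      using y unfolding closure_approachable by (metis half_gt_zero rangeE)
    obtain N0 where N0: "\<And>N. N \<ge> N0 \<Longrightarrow> norm ((T ^^ N) (B x)) < e / 2"
      using LIMSEQ_D[OF rng[of x], of "e / 2"] \<open>e > 0\<close> by auto
    have "norm ((T ^^ N) y - 0) < e" if "N \<ge> N0" for N
    proof -
      have "(T ^^ N) y = (T ^^ N) (B x) + (T ^^ N) (y - B x)"
        using linear_add[OF TN, of N "B x" "y - B x"] by simp
      then have "norm ((T ^^ N) y) \<le> norm ((T ^^ N) (B x)) + norm ((T ^^ N) (y - B x))"
        by (simp add: norm_triangle_ineq)
      also have "\<dots> < e / 2 + e / 2"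
        using N0[OF that] nTN[of N "y - B x"] x by (auto simp: dist_norm norm_minus_commute)
      finally show ?thesis by simp
    qed
    then show "\<exists>no. \<forall>n\<ge>no. norm ((T ^^ n) y - 0) < e" by blast
  qed
  have "closed M" unfolding M_def
    by (intro closed_Collect_eq continuous_intros bounded_linear.continuous_on[OF bl])
  then have M: "subspace M" "complete M"
    by (auto simp: M_def subspace_def B.add B.scale B.zero complete_eq_closed)
  let ?R = "closure (range B)"
  have R: "subspace ?R" "complete ?R"
    using linear_subspace_image[OF B subspace_UNIV]
    by (auto intro!: subspace_closure simp: complete_eq_closed)
  let ?p = "orth_proj ?R w"
  have wp: "B (w - ?p) = 0"
  proof -
    have "(w - ?p) \<bullet> B (B (w - ?p)) = 0"
      using orth_proj_diff[OF R, of w] closure_subset[of "range B"] unfolding mem_orthogonal_comp by blast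
    then have "B (w - ?p) \<bullet> B (w - ?p) = 0" by (simp add: sym)
    then show ?thesis by simp
  qed
  have "w - (w - ?p) \<in> orthogonal_comp M"
    unfolding mem_orthogonal_comp
  proof
    fix y assume y: "y \<in> M"
    have "range B \<subseteq> {x. x \<bullet> y = 0}" using y by (auto simp: sym M_def)
    then have "?R \<subseteq> {x. x \<bullet> y = 0}"
      by (rule closure_minimal) (intro closed_Collect_eq continuous_intros)
    then show "(w - (w - ?p)) \<bullet> y = 0" using orth_proj_in[OF R, of w] by auto
  qed
  then have proj: "orth_proj M w = w - ?p"
    by (intro orth_proj_eqI M) (use wp in \<open>auto simp: M_def\<close>)
  have fix_M: "(T ^^ N) (w - ?p) = w - ?p" for N
    by (induction N) (use wp in \<open>auto simp: T_def\<close>)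
  have "(\<lambda>N. (w - ?p) + (T ^^ N) ?p) \<longlonglongrightarrow> (w - ?p) + 0"
    by (intro tendsto_intros cl orth_proj_in[OF R])
  moreover have "(w - ?p) + (T ^^ N) ?p = (T ^^ N) w" for N
    using linear_add[OF TN, of N "w - ?p" ?p] fix_M by simp
  ultimately show ?thesis using proj by simp
qed

text \<open>The operator \<open>\<Sum> c\<^sub>j Q\<^sub>j\<close> converges strongly because a quadratic form bound on its finite
  partial sums controls their norms; its kernel is the intersection of the kernels of the \<open>Q\<^sub>j\<close>.\<close>

lemma projection_series_iteration:
  fixes W :: "'i \<Rightarrow> 'a::{real_inner, complete_space} set" and c :: "'i \<Rightarrow> real"
  assumes W: "\<And>j. j \<in> I \<Longrightarrow> subspace (W j)" "\<And>j. j \<in> I \<Longrightarrow> closed (W j)"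
    and c: "\<And>j. j \<in> I \<Longrightarrow> c j > 0"
  defines "Q \<equiv> \<lambda>j. orth_proj (orthogonal_comp (W j))"
  assumes bound: "\<And>F w. finite F \<Longrightarrow> F \<subseteq> I \<Longrightarrow> (\<Sum>j\<in>F. c j * (norm (Q j w))\<^sup>2) \<le> C * (norm w)\<^sup>2"
    and "C > 0" "\<gamma> > 0" "\<gamma> * C \<le> 1"
  shows "(\<lambda>j. c j *\<^sub>R Q j w) summable_on I"
    and "(\<lambda>N. ((\<lambda>w. w - \<gamma> *\<^sub>R (\<Sum>\<^sub>\<infinity>j\<in>I. c j *\<^sub>R Q j w)) ^^ N) w) \<longlonglongrightarrow> orth_proj (\<Inter>j\<in>I. W j) w"
proof -
  have P: "subspace (orthogonal_comp (W j))" "complete (orthogonal_comp (W j))" for j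
    by (auto simp: subspace_orthogonal_comp closed_orthogonal_comp complete_eq_closed)
  have c0: "0 \<le> c j" if "j \<in> I" for j using c[OF that] by simp
  have Q: "Q j = orth_proj (orthogonal_comp (W j))" for j by (simp add: Q_def)
  note Qadd = orth_proj_add[OF P, folded Q] and Qscale = orth_proj_scale[OF P, folded Q]
    and Qsym = orth_proj_symmetric[OF P, folded Q]
    and Qself = orth_proj_inner_self[OF P, folded Q]
  \<comment> \<open>Closedness of \<open>W j\<close> enters here: it makes the double orthogonal
    complement equal to \<open>W j\<close>.\<close>
  have Q0: "Q j w = 0 \<longleftrightarrow> w \<in> W j" if "j \<in> I" for j w
  proof -
    have "Q j w = 0 \<longleftrightarrow> w \<in> orthogonal_comp (orthogonal_comp (W j))"
      unfolding Q_def using orth_proj_diff[OF P, of w j] orth_proj_eqI[OF P(1), of 0 j w]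
      by (auto simp: subspace_0[OF subspace_orthogonal_comp])
    then show ?thesis
      using orthogonal_comp_orthogonal_comp_complete[of "W j"] W[OF that] by (simp add: complete_eq_closed)
  qed
  have fin: "(norm (\<Sum>j\<in>F. c j *\<^sub>R Q j w))\<^sup>2 \<le> C * (\<Sum>j\<in>F. c j * (norm (Q j w))\<^sup>2)"
    if F: "finite F" "F \<subseteq> I" for F w
  proof -
    let ?A = "\<lambda>w. \<Sum>j\<in>F. c j *\<^sub>R Q j w"
    have q: "?A w \<bullet> w = (\<Sum>j\<in>F. c j * (norm (Q j w))\<^sup>2)" for w
      by (simp add: inner_sum_left Qself)
    have "(norm (?A w))\<^sup>2 \<le> C * (?A w \<bullet> w)"
    proof (rule norm_le_quadratic_form)
      show "linear ?A"
        by (intro linear_compose_sum linear_compose_scale_right ballI) (auto intro: linearI simp: Qadd Qscale)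
      show "?A v \<bullet> w = v \<bullet> ?A w" for v w
        by (simp add: inner_sum_left inner_sum_right Qsym)
      show "0 \<le> ?A w \<bullet> w" for w
        unfolding q using c0 F by (intro sum_nonneg mult_nonneg_nonneg) auto
      show "?A w \<bullet> w \<le> C * (norm w)\<^sup>2" for w unfolding q using bound[OF F] .
    qed fact
    then show ?thesis by (simp add: q)
  qed
  have summ: "(\<lambda>j. c j *\<^sub>R Q j w) summable_on I" for w
  proof (rule summable_on_if_sum_norm_le[of I "\<lambda>j. c j * (norm (Q j w))\<^sup>2"])
    show "0 \<le> c j * (norm (Q j w))\<^sup>2" if "j \<in> I" for j using c[OF that] by simp
  qed (use bound fin in auto)
  then show "(\<lambda>j. c j *\<^sub>R Q j w) summable_on I" .
  define A where "A w = (\<Sum>\<^sub>\<infinity>j\<in>I. c j *\<^sub>R Q j w)" for w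
  have A: "((\<lambda>j. c j *\<^sub>R Q j w) has_sum A w) I" for w
    using summ unfolding A_def by (rule has_sum_infsum)
  have Ain: "((\<lambda>j. c j * (Q j v \<bullet> w)) has_sum (A v \<bullet> w)) I" for v w
    using has_sum_bounded_linear[OF bounded_linear_inner_left A, of v w] by (simp add: o_def)
  have Aself: "((\<lambda>j. c j * (norm (Q j w))\<^sup>2) has_sum (A w \<bullet> w)) I" for w
    using Ain[of w w] by (simp add: Qself)
  have linA: "linear A"
  proof (rule linearI)
    show "A (v + w) = A v + A w" for v w
      by (rule has_sum_unique[OF A]) (use has_sum_add[OF A A, of v w] in \<open>simp add: Qadd scaleR_add_right\<close>)
    show "A (t *\<^sub>R v) = t *\<^sub>R A v" for t v
      by (rule has_sum_unique[OF A])
         (use has_sum_bounded_linear[OF bounded_linear_scaleR_right A, of t v] in \<open>simp add: Qscale o_def mult.commute\<close>)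
  qed
  have symA: "A v \<bullet> w = v \<bullet> A w" for v w
  proof -
    have "Q j w \<bullet> v = Q j v \<bullet> w" for j by (metis Qsym inner_commute)
    with Ain[of w v] have "((\<lambda>j. c j * (Q j v \<bullet> w)) has_sum (A w \<bullet> v)) I" by simp
    then show ?thesis using has_sum_unique[OF Ain] by (simp add: inner_commute)
  qed
  have posA: "0 \<le> A w \<bullet> w" for w
    by (rule has_sum_nonneg[OF Aself]) (simp add: c0)
  have leA: "A w \<bullet> w \<le> C * (norm w)\<^sup>2" for w
    by (rule has_sum_le_finite_sums[OF Aself]) (use bound in auto)
  have kerA: "\<gamma> *\<^sub>R A w = 0 \<longleftrightarrow> w \<in> (\<Inter>j\<in>I. W j)" for w
  proof
    assume "\<gamma> *\<^sub>R A w = 0"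
    then have "A w \<bullet> w = 0" using \<open>\<gamma> > 0\<close> by simp
    then have "((\<lambda>j. c j * (norm (Q j w))\<^sup>2) has_sum 0) I" using Aself[of w] by simp
    then have "c j * (norm (Q j w))\<^sup>2 = 0" if "j \<in> I" for j
      by (rule nonneg_has_sum_le_0D[OF _ order_refl]) (use that in \<open>simp_all add: c0\<close>)
    then show "w \<in> (\<Inter>j\<in>I. W j)" using Q0 c by fastforce
  next
    assume "w \<in> (\<Inter>j\<in>I. W j)"
    then have "A w = (\<Sum>\<^sub>\<infinity>j\<in>I. 0)" unfolding A_def by (intro infsum_cong) (use Q0 in auto)
    then show "\<gamma> *\<^sub>R A w = 0" by simp
  qed
  have ker: "{w. \<gamma> *\<^sub>R A w = 0} = (\<Inter>j\<in>I. W j)" by (intro set_eqI) (simp only: kerA mem_Collect_eq)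
  have "(\<lambda>N. ((\<lambda>w. w - \<gamma> *\<^sub>R A w) ^^ N) w) \<longlonglongrightarrow> orth_proj {w. \<gamma> *\<^sub>R A w = 0} w"
  proof (rule Richardson_iteration)
    show "linear (\<lambda>w. \<gamma> *\<^sub>R A w)" by (intro linear_compose_scale_right linA)
    show "(\<gamma> *\<^sub>R A w) \<bullet> w \<le> (norm w)\<^sup>2" for w
    proof -
      have "\<gamma> * (A w \<bullet> w) \<le> \<gamma> * (C * (norm w)\<^sup>2)" using leA[of w] \<open>\<gamma> > 0\<close> by simp
      also have "\<dots> \<le> 1 * (norm w)\<^sup>2"
        using mult_right_mono[OF \<open>\<gamma> * C \<le> 1\<close>, of "(norm w)\<^sup>2"] by (simp add: mult.assoc)
      finally show ?thesis by simp
    qed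
  qed (use \<open>\<gamma> > 0\<close> posA symA in auto)
  then show "(\<lambda>N. ((\<lambda>w. w - \<gamma> *\<^sub>R (\<Sum>\<^sub>\<infinity>j\<in>I. c j *\<^sub>R Q j w)) ^^ N) w) \<longlonglongrightarrow> orth_proj (\<Inter>j\<in>I. W j) w"
    by (simp only: ker A_def[symmetric])
qed

section \<open>Continuously differentiable functions with compact support\<close>

text \<open>The gradient field is an argument rather than a derivative chosen afterwards, and one
  continuous derivative is asked for because the cutoffs used below are built from squares of
  \<open>max 0\<close> and are not smooth.\<close>

definition C1_fun :: "(real^3 \<Rightarrow> real) \<Rightarrow> (real^3 \<Rightarrow> real^3) \<Rightarrow> bool" where
  "C1_fun \<phi> G \<longleftrightarrow> (\<forall>x. (\<phi> has_derivative (\<lambda>h. G x \<bullet> h)) (at x)) \<and> continuous_on UNIV G"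

definition C1c_fun :: "(real^3 \<Rightarrow> real) \<Rightarrow> (real^3 \<Rightarrow> real^3) \<Rightarrow> bool" where
  "C1c_fun \<phi> G \<longleftrightarrow> C1_fun \<phi> G \<and> (\<exists>R. \<forall>x. norm x \<ge> R \<longrightarrow> \<phi> x = 0 \<and> G x = 0)"

lemma C1_fun_continuous:
  assumes "C1_fun \<phi> G" shows "continuous_on UNIV \<phi>" "continuous_on UNIV G"
  using assms has_derivative_continuous continuous_at_imp_continuous_on
  unfolding C1_fun_def by (blast, blast)

lemma C1c_fun_C1: "C1c_fun \<phi> G \<Longrightarrow> C1_fun \<phi> G"
  by (simp add: C1c_fun_def)

lemmas C1c_fun_continuous = C1_fun_continuous[OF C1c_fun_C1]

lemma continuous_imp_borel: "continuous_on UNIV f \<Longrightarrow> f \<in> borel_measurable lborel"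
  by (simp add: borel_measurable_continuous_onI)

lemma C1_fun_mult:
  assumes "C1_fun \<psi> H" "C1_fun \<phi> G"
  shows "C1_fun (\<lambda>x. \<psi> x * \<phi> x) (\<lambda>x. \<psi> x *\<^sub>R G x + \<phi> x *\<^sub>R H x)"
  unfolding C1_fun_def
proof (intro conjI allI)
  fix x
  have "((\<lambda>x. \<psi> x * \<phi> x) has_derivative (\<lambda>h. \<psi> x * (G x \<bullet> h) + (H x \<bullet> h) * \<phi> x)) (at x)"
    using assms unfolding C1_fun_def by (intro has_derivative_mult) auto
  then show "((\<lambda>x. \<psi> x * \<phi> x) has_derivative (\<lambda>h. (\<psi> x *\<^sub>R G x + \<phi> x *\<^sub>R H x) \<bullet> h)) (at x)"
    by (simp add: inner_add_left mult.commute)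
qed (intro continuous_intros C1_fun_continuous[OF assms(1)] C1_fun_continuous[OF assms(2)])

lemma C1c_fun_mult:
  assumes "C1_fun \<psi> H" "C1c_fun \<phi> G"
  shows "C1c_fun (\<lambda>x. \<psi> x * \<phi> x) (\<lambda>x. \<psi> x *\<^sub>R G x + \<phi> x *\<^sub>R H x)"
  using assms C1_fun_mult[OF assms(1) C1c_fun_C1[OF assms(2)]] unfolding C1c_fun_def by force

lemma smooth_C1: "smooth \<psi> \<Longrightarrow> C1_fun \<psi> (\<lambda>x. \<chi> i. partial_deriv i \<psi> x)"
proof (erule smooth.cases)
  fix \<phi> G assume "\<psi> = \<phi>" and G: "\<And>x. (\<phi> has_derivative (\<lambda>h. G x \<bullet> h)) (at x)"
    and sm: "\<And>i. smooth (\<lambda>x. G x $ i)"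
  have "(\<lambda>x. \<chi> i. partial_deriv i \<psi> x) = G"
    using partial_deriv_eq[OF G] \<open>\<psi> = \<phi>\<close> by (auto simp: vec_eq_iff)
  moreover have "continuous_on UNIV (\<lambda>x. \<chi> i. G x $ i)"
    by (intro continuous_on_vec_lambda smooth_continuous sm)
  ultimately show ?thesis using G \<open>\<psi> = \<phi>\<close> by (simp add: C1_fun_def)
qed

lemma integrable_compact_support:
  fixes f :: "'a::euclidean_space \<Rightarrow> 'b::{banach, second_countable_topology}"
  assumes "continuous_on UNIV f" "\<And>x. norm x \<ge> R \<Longrightarrow> f x = 0"
  shows "integrable lborel f"
proof -
  have "integrable lborel (\<lambda>x. indicator (cball 0 R) x *\<^sub>R f x)"
    by (rule borel_integrable_compact) (use assms in \<open>auto intro: continuous_on_subset\<close>)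
  moreover have "(\<lambda>x. indicator (cball 0 R) x *\<^sub>R f x) = f"
    using assms(2) by (force simp: indicator_def)
  ultimately show ?thesis by simp
qed

lemma bounded_compact_support:
  fixes f :: "'a::euclidean_space \<Rightarrow> 'b::real_normed_vector"
  assumes "continuous_on UNIV f" "\<And>x. norm x \<ge> R \<Longrightarrow> f x = 0"
  obtains M where "M \<ge> 0" "\<And>x. norm (f x) \<le> M"
proof -
  have "compact (f ` cball 0 R)"
    by (intro compact_continuous_image continuous_on_subset[OF assms(1)]) auto
  then have "bounded (f ` cball 0 R)" by (rule compact_imp_bounded)
  then obtain M where "\<forall>y\<in>f ` cball 0 R. norm y \<le> M" unfolding bounded_iff ..
  then have M: "norm (f x) \<le> M" if "x \<in> cball 0 R" for x using that by simp
  have "norm (f x) \<le> max M 0" for x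
    using M[of x] assms(2)[of x] by (cases "norm x \<le> R") auto
  then show thesis using that[of "max M 0"] by simp
qed

lemma LINT_translate:
  fixes f :: "'a::euclidean_space \<Rightarrow> 'b::{banach, second_countable_topology}"
  assumes "f \<in> borel_measurable borel"
  shows "(LINT x|lborel. f (c + x)) = (LINT x|lborel. f x)"
  using integral_distr[of "(+) c" lborel borel f] assms by (simp add: lborel_distr_plus)

lemma nn_integral_lborel_affine:
  fixes f :: "'a::euclidean_space \<Rightarrow> ennreal"
  assumes [measurable]: "f \<in> borel_measurable borel" and c: "c \<noteq> 0"
  shows "(\<integral>\<^sup>+x. f x \<partial>lborel) = ennreal (\<bar>c\<bar> ^ DIM('a)) * (\<integral>\<^sup>+x. f (t + c *\<^sub>R x) \<partial>lborel)"
  by (subst lborel_affine[OF c, of t])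
     (simp add: nn_integral_density nn_integral_distr nn_integral_cmult)

lemma C1_fun_line:
  assumes "C1_fun \<phi> G"
  shows "((\<lambda>t. \<phi> (q + t *\<^sub>R e)) has_real_derivative G (q + s *\<^sub>R e) \<bullet> e) (at s)"
proof -
  have "((\<lambda>t. q + t *\<^sub>R e) has_derivative (\<lambda>t. t *\<^sub>R e)) (at s)"
    by (auto intro!: derivative_eq_intros)
  moreover have "(\<phi> has_derivative (\<lambda>h. G (q + s *\<^sub>R e) \<bullet> h)) (at (q + s *\<^sub>R e))"
    using assms by (simp add: C1_fun_def)
  ultimately have "((\<lambda>t. \<phi> (q + t *\<^sub>R e)) has_derivative (\<lambda>t. G (q + s *\<^sub>R e) \<bullet> (t *\<^sub>R e))) (at s)"
    by (rule has_derivative_compose)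
  then show ?thesis by (simp add: has_field_derivative_def mult.commute[of _ "_ \<bullet> _"])
qed

lemma C1c_fun_Lipschitz:
  assumes "C1c_fun \<phi> G" and M: "\<And>x. norm (G x) \<le> M"
  shows "\<bar>\<phi> y - \<phi> x\<bar> \<le> M * norm (y - x)"
proof -
  have "norm (\<phi> y - \<phi> x) \<le> M * norm (y - x)"
  proof (rule differentiable_bound[of UNIV \<phi> "\<lambda>x h. G x \<bullet> h"])
    show "onorm (\<lambda>h. G z \<bullet> h) \<le> M" for z
      by (rule onorm_bound) (use M[of z] in \<open>auto intro!: order_trans[OF Cauchy_Schwarz_ineq2] mult_right_mono
            order_trans[OF norm_ge_zero M[of z]]\<close>)
  qed (use assms in \<open>auto simp: C1c_fun_def C1_fun_def\<close>)
  then show ?thesis by simp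
qed

text \<open>Translation invariance makes every difference quotient integrate to zero; the quotients
  are dominated by the gradient bound on a fixed ball.\<close>

lemma C1c_fun_integral_derivative:
  assumes "C1c_fun \<phi> G" shows "(LINT x|lborel. G x $ i) = 0"
proof -
  obtain R where R: "\<And>x. norm x \<ge> R \<Longrightarrow> \<phi> x = 0 \<and> G x = 0" using assms by (auto simp: C1c_fun_def)
  note cont = C1c_fun_continuous[OF assms]
  obtain M where M: "M \<ge> 0" "\<And>x. norm (G x) \<le> M"
    using bounded_compact_support[OF cont(2), of R] R by auto
  have [measurable]: "\<phi> \<in> borel_measurable borel" using continuous_imp_borel[OF cont(1)] by simp
  have [measurable]: "(\<lambda>x. G x $ i) \<in> borel_measurable borel"
    using borel_measurable_vec_nth[OF continuous_imp_borel[OF cont(2)]] by simp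
  define e where "e = (axis i 1 :: real^3)"
  have ne: "norm e = 1" by (simp add: e_def)
  define d where "d n x = (\<phi> (inverse (real (Suc n)) *\<^sub>R e + x) - \<phi> x) / inverse (real (Suc n))" for n x
  have int: "integrable lborel \<phi>" using integrable_compact_support[OF cont(1), of R] R by auto
  have d0: "(LINT x|lborel. d n x) = 0" for n
  proof -
    let ?c = "inverse (real (Suc n)) *\<^sub>R e"
    have "integrable lborel (\<lambda>x. \<phi> (?c + x))"
      by (rule integrable_compact_support[of _ "R + norm ?c"])
         (use norm_triangle_ineq4[of "?c + _" "?c"] R in \<open>auto intro!: continuous_on_compose2[OF cont(1)] continuous_intros\<close>,
          smt (verit) R add_diff_cancel_left' norm_triangle_ineq4)
    then show ?thesis using int LINT_translate[of \<phi> ?c] unfolding d_def by simp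
  qed
  have "(\<lambda>n. LINT x|lborel. d n x) \<longlonglongrightarrow> (LINT x|lborel. G x $ i)"
  proof (rule integral_dominated_convergence)
    show "(\<lambda>x. G x $ i) \<in> borel_measurable lborel" by simp
    show "d n \<in> borel_measurable lborel" for n unfolding d_def[abs_def] by measurable
    \<comment> \<open>Shifts of length at most 1 keep the quotients supported in the ball of radius
      \<open>R + 1\<close>.\<close>
    show "integrable lborel (\<lambda>x. M * indicator (cball 0 (R + 1)) x :: real)"
      using emeasure_lborel_cball_finite by (intro integrable_mult_right) (simp add: integrable_indicator_iff)
    show "AE x in lborel. (\<lambda>n. d n x) \<longlonglongrightarrow> G x $ i"
    proof (rule AE_I2)
      fix x
      have "((\<lambda>h. (\<phi> (x + (0 + h) *\<^sub>R e) - \<phi> (x + 0 *\<^sub>R e)) / h) \<longlongrightarrow> G (x + 0 *\<^sub>R e) \<bullet> e) (at 0)"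
        using C1_fun_line[OF C1c_fun_C1[OF assms], of x e 0] unfolding DERIV_def .
      then have "((\<lambda>h. (\<phi> (h *\<^sub>R e + x) - \<phi> x) / h) \<longlongrightarrow> G x $ i) (at 0)"
        by (simp add: e_def inner_axis add.commute)
      moreover have "filterlim (\<lambda>n. inverse (real (Suc n))) (at 0) sequentially"
        by (rule filterlim_atI[OF LIMSEQ_inverse_real_of_nat]) simp
      ultimately show "(\<lambda>n. d n x) \<longlonglongrightarrow> G x $ i"
        unfolding d_def by (rule filterlim_compose)
    qed
    fix n
    show "AE x in lborel. norm (d n x) \<le> M * indicator (cball 0 (R + 1)) x"
    proof (rule AE_I2)
      fix x
      define c where "c = inverse (real (Suc n))"
      have c: "0 < c" "c \<le> 1" by (auto simp: c_def inverse_le_1_iff)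
      have "\<bar>\<phi> (c *\<^sub>R e + x) - \<phi> x\<bar> \<le> M * c"
        using C1c_fun_Lipschitz[OF assms M(2), of "c *\<^sub>R e + x" x] c ne by simp
      then have b: "\<bar>d n x\<bar> \<le> M" using c unfolding d_def c_def[symmetric] by (simp add: field_simps)
      show "norm (d n x) \<le> M * indicator (cball 0 (R + 1)) x"
      proof (cases "norm x \<le> R + 1")
        case False
        have "norm x \<le> norm (c *\<^sub>R e + x) + norm (c *\<^sub>R e)"
          using norm_triangle_ineq4[of "c *\<^sub>R e + x" "c *\<^sub>R e"] by simp
        then have "norm (c *\<^sub>R e + x) \<ge> R" using False c ne by simp
        with False R show ?thesis unfolding d_def c_def[symmetric] by simp
      qed (use b in simp)
    qed
  qed
  with d0 show ?thesis by (simp add: LIMSEQ_const_iff)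
qed

text \<open>Integration by parts: the product \<open>\<psi> x * \<phi> x\<close> is again of class
  \<open>C1c_fun\<close>, so its derivative has integral zero.\<close>

lemma C1c_fun_weak_gradient:
  assumes "C1c_fun \<phi> G" shows "weak_gradient \<phi> G"
  unfolding weak_gradient_def
proof (intro allI impI)
  fix \<psi> :: "real^3 \<Rightarrow> real" and i assume t: "test_function \<psi>"
  let ?H = "\<lambda>x. \<chi> i. partial_deriv i \<psi> x"
  obtain R where R: "\<And>x. norm x \<ge> R \<Longrightarrow> \<phi> x = 0 \<and> G x = 0" using assms by (auto simp: C1c_fun_def)
  have H: "C1_fun \<psi> ?H" using t smooth_C1 by (simp add: test_function_def)
  note cont = C1c_fun_continuous[OF assms] C1_fun_continuous[OF H]
  have ci: "continuous_on UNIV (\<lambda>x. G x $ i)" "continuous_on UNIV (partial_deriv i \<psi>)"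
    using bounded_linear.continuous_on[OF bounded_linear_vec_nth cont(2), of i]
      bounded_linear.continuous_on[OF bounded_linear_vec_nth cont(4), of i] by simp_all
  have "0 = (LINT x|lborel. (\<psi> x *\<^sub>R G x + \<phi> x *\<^sub>R ?H x) $ i)"
    using C1c_fun_integral_derivative[OF C1c_fun_mult[OF H assms], of i] by simp
  also have "\<dots> = (LINT x|lborel. G x $ i * \<psi> x + \<phi> x * partial_deriv i \<psi> x)"
    by (simp add: mult.commute)
  also have "\<dots> = (LINT x|lborel. G x $ i * \<psi> x) + (LINT x|lborel. \<phi> x * partial_deriv i \<psi> x)"
    by (intro Bochner_Integration.integral_add integrable_compact_support[of _ R] continuous_intros cont ci)
       (use R in auto)
  finally show "(LINT x|lborel. \<phi> x * partial_deriv i \<psi> x) = - (LINT x|lborel. G x $ i * \<psi> x)"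
    by simp
qed

lemma C1c_fun_sobolev:
  assumes "C1c_fun \<phi> G" shows "sobolev_fun \<phi>" "L2_field G" "L6_fun \<phi>"
proof -
  obtain R where R: "\<And>x. norm x \<ge> R \<Longrightarrow> \<phi> x = 0 \<and> G x = 0" using assms by (auto simp: C1c_fun_def)
  note cont = C1c_fun_continuous[OF assms]
  show 1: "L2_field G" unfolding L2_field_def
    by (intro conjI continuous_imp_borel cont integrable_compact_support[of _ R] continuous_intros)
       (use R in auto)
  show 2: "L6_fun \<phi>" unfolding L6_fun_def
    by (intro conjI continuous_imp_borel cont integrable_compact_support[of _ R] continuous_intros)
       (use R in auto)
  show "sobolev_fun \<phi>" by (rule sobolev_funI[OF 2 1 C1c_fun_weak_gradient[OF assms]])
qed

section \<open>The Sobolev inequality\<close>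

text \<open>Stated for extended nonnegative functions with a pointwise hypothesis on
  \<open>h\<close>, so that it applies to iterated integrals whose finiteness is not known in
  advance. In the finite case it is the arithmetic-geometric mean inequality with an optimal
  weight.\<close>

lemma nn_integral_Cauchy_Schwarz:
  fixes f g h :: "'a \<Rightarrow> ennreal"
  assumes [measurable]: "f \<in> borel_measurable M" "g \<in> borel_measurable M" "h \<in> borel_measurable M"
    and le: "\<And>x. (h x)\<^sup>2 \<le> f x * g x"
  shows "(\<integral>\<^sup>+x. h x \<partial>M)\<^sup>2 \<le> (\<integral>\<^sup>+x. f x \<partial>M) * (\<integral>\<^sup>+x. g x \<partial>M)"
proof -
  define F G H where "F = (\<integral>\<^sup>+x. f x \<partial>M)" and "G = (\<integral>\<^sup>+x. g x \<partial>M)" and "H = (\<integral>\<^sup>+x. h x \<partial>M)"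
  note defs = F_def G_def H_def
  have z: "h x = 0" if "f x = 0 \<or> g x = 0" for x using le[of x] that by auto
  consider "F = 0 \<or> G = 0" | "F \<noteq> 0" "G \<noteq> 0" "F = top \<or> G = top"
    | a b where "F = ennreal a" "G = ennreal b" "a > 0" "b > 0"
  proof (cases "F = 0 \<or> G = 0 \<or> F = top \<or> G = top")
    case False
    then have "F = ennreal (enn2real F)" "G = ennreal (enn2real G)" by (auto simp: less_top)
    moreover have "enn2real F > 0" "enn2real G > 0"
      using False by (auto simp: enn2real_positive_iff less_top zero_less_iff_neq_zero)
    ultimately show ?thesis using that(3) by blast
  qed (use that(1,2) in blast)
  then have "H\<^sup>2 \<le> F * G"
  proof cases
    case 1
    then have "(AE x in M. f x = 0) \<or> (AE x in M. g x = 0)" by (simp add: defs nn_integral_0_iff_AE)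
    then have "AE x in M. h x = 0" using z by (auto elim!: eventually_mono)
    then have "H = 0" by (simp add: defs nn_integral_0_iff_AE)
    then show ?thesis by simp
  next
    case 2
    then show ?thesis by (auto simp: ennreal_mult_top ennreal_top_mult)
  next
    case (3 a b)
    \<comment> \<open>The weight that balances the two terms: \<open>t * a\<close> and
      \<open>b / t\<close> both equal \<open>sqrt (a * b)\<close>.\<close>
    define t where "t = sqrt (b / a)"
    have t: "t > 0" using 3 by (simp add: t_def)
    have "2 * h x \<le> ennreal t * f x + ennreal (1 / t) * g x" for x
    proof (cases "f x = top \<or> g x = top")
      case True
      then show ?thesis using t by (auto simp: ennreal_mult_top)
    next
      case False
      then obtain p q where pq: "f x = ennreal p" "g x = ennreal q" "p \<ge> 0" "q \<ge> 0"
        by (cases "f x"; cases "g x") auto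
      have "h x \<noteq> top"
        using le[of x] pq by (auto simp: ennreal_mult[symmetric] power2_eq_square ennreal_mult_top top_unique)
      then obtain k where k: "h x = ennreal k" "k \<ge> 0" by (cases "h x") auto
      have "k\<^sup>2 \<le> p * q"
        using le[of x] pq k by (simp add: ennreal_power ennreal_mult[symmetric])
      also have "\<dots> \<le> ((t * p + q / t) / 2)\<^sup>2"
      proof -
        have "0 \<le> (t * p - q / t)\<^sup>2" by simp
        also have "(t * p - q / t)\<^sup>2 = (t * p + q / t)\<^sup>2 - 4 * (p * q)"
          using t by (simp add: power2_eq_square field_simps)
        finally show ?thesis by (simp add: power_divide)
      qed
      finally have "k \<le> (t * p + q / t) / 2"
        by (rule power2_le_imp_le) (use t pq in auto)
      then have "2 * k \<le> t * p + 1 / t * q" by simp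
      then have "ennreal (2 * k) \<le> ennreal (t * p + 1 / t * q)" by (rule ennreal_leI)
      moreover have "ennreal (t * p + 1 / t * q) = ennreal t * f x + ennreal (1 / t) * g x"
      proof -
        have "ennreal (t * p + 1 / t * q) = ennreal (t * p) + ennreal (1 / t * q)"
          by (rule ennreal_plus) (use t pq in auto)
        also have "\<dots> = ennreal t * ennreal p + ennreal (1 / t) * ennreal q"
          by (intro arg_cong2[of _ _ _ _ "(+)"] ennreal_mult) (use t pq in auto)
        finally show ?thesis by (simp only: pq)
      qed
      ultimately show ?thesis using k by (simp add: ennreal_mult)
    qed
    then have "(\<integral>\<^sup>+x. 2 * h x \<partial>M) \<le> (\<integral>\<^sup>+x. ennreal t * f x + ennreal (1 / t) * g x \<partial>M)"
      by (intro nn_integral_mono) auto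
    then have "2 * H \<le> ennreal t * ennreal a + ennreal (1 / t) * ennreal b"
      using 3 by (simp add: defs nn_integral_cmult nn_integral_add)
    also have "\<dots> = ennreal (t * a) + ennreal (1 / t * b)"
      by (intro arg_cong2[of _ _ _ _ "(+)"] ennreal_mult[symmetric]) (use t 3 in auto)
    also have "\<dots> = ennreal (t * a + 1 / t * b)"
      by (rule ennreal_plus[symmetric]) (use t 3 in auto)
    also have "t * a + 1 / t * b = 2 * sqrt (a * b)"
    proof -
      have "t * a = sqrt (a * b)" 
        using 3 by (simp add: t_def real_sqrt_divide real_sqrt_mult field_simps real_sqrt_mult_self)
      moreover have "1 / t * b = sqrt (a * b)"
        using 3 by (simp add: t_def real_sqrt_divide real_sqrt_mult field_simps real_sqrt_mult_self)
      ultimately show ?thesis by simp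
    qed
    finally have le2: "2 * H \<le> ennreal (2 * sqrt (a * b))" .
    then have "H \<noteq> top" by (auto simp: ennreal_mult_top top_unique)
    then obtain k where k: "H = ennreal k" "k \<ge> 0" by (cases H) auto
    have "2 * H = ennreal (2 * k)" using k by (simp add: ennreal_mult)
    then have "2 * k \<le> 2 * sqrt (a * b)" using le2 3 k by simp
    then have "k\<^sup>2 \<le> (sqrt (a * b))\<^sup>2" using k by (intro power_mono) auto
    then show ?thesis using 3 k by (simp add: ennreal_power ennreal_mult[symmetric])
  qed
  then show ?thesis by (simp add: defs)
qed


section \<open>Iterated integrals over the three coordinates\<close>

definition point3 :: "real \<Rightarrow> real \<Rightarrow> real \<Rightarrow> real^3" where
  "point3 x y z = x *\<^sub>R axis 1 1 + y *\<^sub>R axis 2 1 + z *\<^sub>R axis 3 1"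

lemma point3_nth: "point3 x y z $ 1 = x" "point3 x y z $ 2 = y" "point3 x y z $ 3 = z"
  by (simp_all add: point3_def axis_def)

lemma measurable_point3 [measurable (raw)]:
  assumes [measurable]: "f \<in> borel_measurable M" "g \<in> borel_measurable M" "h \<in> borel_measurable M"
  shows "(\<lambda>p. point3 (f p) (g p) (h p)) \<in> borel_measurable M"
  unfolding point3_def by measurable

lemma lborel_eq_distr_point3:
  "lborel = distr (lborel \<Otimes>\<^sub>M (lborel \<Otimes>\<^sub>M lborel)) borel (\<lambda>(x, y, z). point3 x y z)"
proof (rule lborel_eqI)
  fix l u :: "real^3" assume lu: "\<And>b. b \<in> Basis \<Longrightarrow> l \<bullet> b \<le> u \<bullet> b"
  have le: "l $ i \<le> u $ i" for i
    using lu[of "axis i 1"] by (simp add: inner_axis axis_in_Basis_iff)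
  have "(\<lambda>(x, y, z). point3 x y z) -` box l u \<inter> space (lborel \<Otimes>\<^sub>M (lborel \<Otimes>\<^sub>M lborel))
      = {l $ 1<..<u $ 1} \<times> ({l $ 2<..<u $ 2} \<times> {l $ 3<..<u $ 3})"
    by (auto simp: mem_box_cart forall_3 point3_nth space_pair_measure)
  then have "emeasure (distr (lborel \<Otimes>\<^sub>M (lborel \<Otimes>\<^sub>M lborel)) borel (\<lambda>(x, y, z). point3 x y z)) (box l u)
      = emeasure (lborel \<Otimes>\<^sub>M (lborel \<Otimes>\<^sub>M lborel)) ({l $ 1<..<u $ 1} \<times> ({l $ 2<..<u $ 2} \<times> {l $ 3<..<u $ 3}))"
    by (subst emeasure_distr) auto
  also have "\<dots> = emeasure lborel {l $ 1<..<u $ 1} * (emeasure lborel {l $ 2<..<u $ 2} * emeasure lborel {l $ 3<..<u $ 3})"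
  proof -
    have P: "sigma_finite_measure (lborel \<Otimes>\<^sub>M lborel :: (real \<times> real) measure)"
      by (simp add: lborel_prod sigma_finite_lborel)
    show ?thesis by (simp add: sigma_finite_measure.emeasure_pair_measure_Times[OF P] lborel.emeasure_pair_measure_Times)
  qed
  also have "\<dots> = ennreal ((u $ 1 - l $ 1) * ((u $ 2 - l $ 2) * (u $ 3 - l $ 3)))"
    using le by (simp add: ennreal_mult)
  also have "(u $ 1 - l $ 1) * ((u $ 2 - l $ 2) * (u $ 3 - l $ 3)) = (\<Prod>i\<in>UNIV. (u - l) $ i)"
    unfolding UNIV_3 by simp
  also have "\<dots> = (\<Prod>b\<in>Basis. (u - l) \<bullet> b)"
  proof -
    have B: "(Basis :: (real^3) set) = range (\<lambda>i. axis i 1)" by (auto simp: Basis_vec_def)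
    show ?thesis unfolding B
      by (subst prod.reindex) (auto simp: inj_on_def axis_eq_axis inner_axis)
  qed
  finally show "emeasure (distr (lborel \<Otimes>\<^sub>M (lborel \<Otimes>\<^sub>M lborel)) borel (\<lambda>(x, y, z). point3 x y z)) (box l u)
      = ennreal (\<Prod>b\<in>Basis. (u - l) \<bullet> b)" .
qed simp

text \<open>Three orders are needed because the line integrals in the Sobolev inequality run along
  different axes, and integrating each of them over its two remaining variables must give the same
  number.\<close>

lemma nn_integral_point3:
  assumes [measurable]: "f \<in> borel_measurable borel"
  shows "(\<integral>\<^sup>+p. f p \<partial>lborel) = (\<integral>\<^sup>+x. \<integral>\<^sup>+y. \<integral>\<^sup>+z. f (point3 x y z) \<partial>lborel \<partial>lborel \<partial>lborel)" (is "_ = ?xyz")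
    and "(\<integral>\<^sup>+p. f p \<partial>lborel) = (\<integral>\<^sup>+z. \<integral>\<^sup>+x. \<integral>\<^sup>+y. f (point3 x y z) \<partial>lborel \<partial>lborel \<partial>lborel)" (is "_ = ?zxy")
    and "(\<integral>\<^sup>+p. f p \<partial>lborel) = (\<integral>\<^sup>+z. \<integral>\<^sup>+y. \<integral>\<^sup>+x. f (point3 x y z) \<partial>lborel \<partial>lborel \<partial>lborel)" (is "_ = ?zyx")
proof -
  have P: "sigma_finite_measure (lborel \<Otimes>\<^sub>M lborel :: (real \<times> real) measure)"
    by (simp add: lborel_prod sigma_finite_lborel)
  have "(\<integral>\<^sup>+p. f p \<partial>lborel) = (\<integral>\<^sup>+q. f (point3 (fst q) (fst (snd q)) (snd (snd q))) \<partial>(lborel \<Otimes>\<^sub>M (lborel \<Otimes>\<^sub>M lborel)))"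
    by (subst lborel_eq_distr_point3, subst nn_integral_distr) (auto simp: split_beta)
  also have "\<dots> = ?xyz"
    by (subst sigma_finite_measure.nn_integral_fst[OF P, symmetric], measurable, subst lborel.nn_integral_fst[symmetric]) (auto)
  finally show xyz: "(\<integral>\<^sup>+p. f p \<partial>lborel) = ?xyz" .
  also have "?xyz = (\<integral>\<^sup>+x. \<integral>\<^sup>+z. \<integral>\<^sup>+y. f (point3 x y z) \<partial>lborel \<partial>lborel \<partial>lborel)"
    by (intro nn_integral_cong lborel_pair.Fubini') measurable
  also have "\<dots> = ?zxy"
    by (intro lborel_pair.Fubini') measurable
  finally show zxy: "(\<integral>\<^sup>+p. f p \<partial>lborel) = ?zxy" .
  also have "?zxy = ?zyx"
    by (intro nn_integral_cong lborel_pair.Fubini') measurable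
  finally show "(\<integral>\<^sup>+p. f p \<partial>lborel) = ?zyx" .
qed

text \<open>The exponent 4 is chosen so that the bounds along the three axes multiply to the twelfth
  power, the square of \<open>\<bar>\<phi>\<bar> ^ 6\<close>.\<close>

lemma C1c_fun_pow4_le_line_integral:
  assumes \<phi>: "C1c_fun \<phi> G"
  shows "ennreal (\<phi> (q + s *\<^sub>R axis i 1) ^ 4)
    \<le> (\<integral>\<^sup>+t. ennreal (4 * \<bar>\<phi> (q + t *\<^sub>R axis i 1)\<bar> ^ 3 * norm (G (q + t *\<^sub>R axis i 1))) \<partial>lborel)"
proof -
  let ?p = "\<lambda>t. q + t *\<^sub>R axis i 1 :: real^3"
  obtain R where R: "\<And>x. norm x \<ge> R \<Longrightarrow> \<phi> x = 0 \<and> G x = 0" using \<phi> by (auto simp: C1c_fun_def)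
  note cont = C1c_fun_continuous[OF \<phi>]
  \<comment> \<open>A parameter so far to the left that the point on the line lies outside the
    support; the integration starts there from the value 0.\<close>
  define T where "T = min s (- (\<bar>R\<bar> + norm q))"
  have "norm (T *\<^sub>R axis i 1 :: real^3) \<ge> \<bar>R\<bar> + norm q" by (simp add: T_def)
  then have "norm (?p T) \<ge> R" using norm_triangle_ineq4[of "?p T" q] by simp
  then have T: "\<phi> (?p T) = 0" "T \<le> s" using R by (auto simp: T_def)
  let ?F' = "\<lambda>t. 4 * \<phi> (?p t) ^ 3 * (G (?p t) \<bullet> axis i 1)"
  have c: "continuous_on UNIV ?F'"
    by (intro continuous_intros continuous_on_compose2[OF cont(1)] continuous_on_compose2[OF cont(2)]) auto
  have d: "((\<lambda>t. \<phi> (?p t) ^ 4) has_real_derivative ?F' t) (at t)" for t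
    using DERIV_power[OF C1_fun_line[OF C1c_fun_C1[OF \<phi>], of q "axis i 1" t], of 4]
    by (simp add: mult_ac)
  have FTC: "has_bochner_integral lborel (\<lambda>t. ?F' t * indicator {T..s} t) (\<phi> (?p s) ^ 4 - \<phi> (?p T) ^ 4)"
    by (rule has_bochner_integral_FTC_Icc_real[OF T(2)])
       (use d c in \<open>auto simp: continuous_on_eq_continuous_at\<close>)
  have "ennreal (\<phi> (?p s) ^ 4) = ennreal (norm (LINT t|lborel. ?F' t * indicator {T..s} t))"
    using FTC T by (simp add: has_bochner_integral_iff)
  also have "\<dots> \<le> (\<integral>\<^sup>+t. ennreal (norm (?F' t * indicator {T..s} t)) \<partial>lborel)"
    using FTC by (intro integral_norm_bound_ennreal) (simp add: has_bochner_integral_iff)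
  also have "\<dots> \<le> (\<integral>\<^sup>+t. ennreal (4 * \<bar>\<phi> (?p t)\<bar> ^ 3 * norm (G (?p t))) \<partial>lborel)"
  proof (intro nn_integral_mono ennreal_leI)
    fix t
    have "\<bar>G (?p t) \<bullet> axis i 1\<bar> \<le> norm (G (?p t))"
      using Cauchy_Schwarz_ineq2[of "G (?p t)" "axis i 1"] by simp
    then have "\<bar>?F' t\<bar> \<le> 4 * \<bar>\<phi> (?p t)\<bar> ^ 3 * norm (G (?p t))"
      by (simp add: abs_mult power_abs mult_left_mono)
    moreover have "\<bar>?F' t * indicator {T..s} t\<bar> \<le> \<bar>?F' t\<bar>" by (auto simp: indicator_def)
    ultimately show "norm (?F' t * indicator {T..s} t) \<le> 4 * \<bar>\<phi> (?p t)\<bar> ^ 3 * norm (G (?p t))"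
      by simp
  qed
  finally show ?thesis .
qed

text \<open>Gagliardo--Nirenberg: bounding \<open>\<phi>\<^sup>4\<close> by its derivative along each of the three coordinate
  lines and integrating (Loomis--Whitney) gives \<open>(\<integral>\<phi>\<^sup>6)\<^sup>2 \<le> (4\<integral>\<bar>\<phi>\<bar>\<^sup>3\<bar>\<nabla>\<phi>\<bar>)\<^sup>3\<close>.\<close>

lemma C1c_fun_Sobolev_inequality:
  assumes \<phi>: "C1c_fun \<phi> G"
  shows "(LINT x|lborel. \<bar>\<phi> x\<bar> ^ 6) \<le> 4096 * (LINT x|lborel. (norm (G x))\<^sup>2) ^ 3"
proof -
  note cont = C1c_fun_continuous[OF \<phi>]
  have [measurable]: "\<phi> \<in> borel_measurable borel" "G \<in> borel_measurable borel"
    using continuous_imp_borel[OF cont(1)] continuous_imp_borel[OF cont(2)] by simp_all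
  define g where "g p = ennreal (4 * \<bar>\<phi> p\<bar> ^ 3 * norm (G p))" for p
  define h where "h p = ennreal (\<bar>\<phi> p\<bar> ^ 6)" for p
  have [measurable]: "g \<in> borel_measurable borel" "h \<in> borel_measurable borel"
    unfolding g_def[abs_def] h_def[abs_def] by measurable
  define a where "a y z = (\<integral>\<^sup>+t. g (point3 t y z) \<partial>lborel)" for y z
  define b where "b x z = (\<integral>\<^sup>+t. g (point3 x t z) \<partial>lborel)" for x z
  define c where "c x y = (\<integral>\<^sup>+t. g (point3 x y t) \<partial>lborel)" for x y
  have [measurable]: "(\<lambda>p. a (fst p) (snd p)) \<in> borel_measurable (lborel \<Otimes>\<^sub>M lborel)"
    "(\<lambda>p. b (fst p) (snd p)) \<in> borel_measurable (lborel \<Otimes>\<^sub>M lborel)"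
    "(\<lambda>p. c (fst p) (snd p)) \<in> borel_measurable (lborel \<Otimes>\<^sub>M lborel)"
    unfolding a_def b_def c_def by measurable
  have ma: "(\<lambda>w. a (f w) (f' w)) \<in> borel_measurable N"
    and mb: "(\<lambda>w. b (f w) (f' w)) \<in> borel_measurable N"
    and mc: "(\<lambda>w. c (f w) (f' w)) \<in> borel_measurable N"
    if [measurable]: "f \<in> borel_measurable N" "f' \<in> borel_measurable N" for N :: "'z measure" and f f'
    unfolding a_def b_def c_def by measurable
  note [measurable (raw)] = ma mb mc
  define S where "S = (\<integral>\<^sup>+p. g p \<partial>lborel)"
  define E where "E = (\<integral>\<^sup>+p. h p \<partial>lborel)"
  have line: "ennreal (\<phi> (point3 x y z) ^ 4) \<le> a y z" "ennreal (\<phi> (point3 x y z) ^ 4) \<le> b x z"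
    "ennreal (\<phi> (point3 x y z) ^ 4) \<le> c x y" for x y z
    using C1c_fun_pow4_le_line_integral[OF \<phi>, of "point3 0 y z" x 1]
      C1c_fun_pow4_le_line_integral[OF \<phi>, of "point3 x 0 z" y 2]
      C1c_fun_pow4_le_line_integral[OF \<phi>, of "point3 x y 0" z 3]
    unfolding a_def b_def c_def g_def by (simp_all add: point3_def algebra_simps)
  have key: "(h (point3 x y z))\<^sup>2 \<le> (a y z * b x z) * c x y" for x y z
  proof -
    let ?v = "\<phi> (point3 x y z)"
    have "(h (point3 x y z))\<^sup>2 = ennreal (?v ^ 4) * ennreal (?v ^ 4) * ennreal (?v ^ 4)"
      unfolding h_def by (simp add: ennreal_power ennreal_mult[symmetric] flip: power_mult power_add)
    also have "\<dots> \<le> (a y z * b x z) * c x y"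
      by (intro mult_mono line) auto
    finally show ?thesis .
  qed
  define \<alpha> where "\<alpha> z = (\<integral>\<^sup>+y. a y z \<partial>lborel)" for z
  define \<beta> where "\<beta> z = (\<integral>\<^sup>+x. b x z \<partial>lborel)" for z
  define J where "J z = (\<integral>\<^sup>+x. \<integral>\<^sup>+y. h (point3 x y z) \<partial>lborel \<partial>lborel)" for z
  have [measurable]: "\<alpha> \<in> borel_measurable lborel" "\<beta> \<in> borel_measurable lborel" "J \<in> borel_measurable lborel"
    unfolding \<alpha>_def[abs_def] \<beta>_def[abs_def] J_def[abs_def] by measurable
  \<comment> \<open>For fixed \<open>z\<close> the Cauchy-Schwarz inequality in \<open>x\<close> and
    \<open>y\<close> separates \<open>c\<close> from the product of \<open>a\<close> and
    \<open>b\<close>, and in that product each factor depends on only one of the two variables. A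
    second application, in \<open>z\<close>, then completes the bound on \<open>E\<close>.\<close>
  have slice: "(J z)\<^sup>2 \<le> \<alpha> z * (\<beta> z * S)" for z
  proof -
    have "(\<integral>\<^sup>+p. h (point3 (fst p) (snd p) z) \<partial>(lborel \<Otimes>\<^sub>M lborel))\<^sup>2
       \<le> (\<integral>\<^sup>+p. a (snd p) z * b (fst p) z \<partial>(lborel \<Otimes>\<^sub>M lborel)) * (\<integral>\<^sup>+p. c (fst p) (snd p) \<partial>(lborel \<Otimes>\<^sub>M lborel))"
      by (rule nn_integral_Cauchy_Schwarz) (measurable, rule key)
    also have "(\<integral>\<^sup>+p. h (point3 (fst p) (snd p) z) \<partial>(lborel \<Otimes>\<^sub>M lborel)) = J z"
      unfolding J_def by (subst lborel.nn_integral_fst[symmetric]) auto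
    also have "(\<integral>\<^sup>+p. a (snd p) z * b (fst p) z \<partial>(lborel \<Otimes>\<^sub>M lborel)) = (\<integral>\<^sup>+x. \<integral>\<^sup>+y. a y z * b x z \<partial>lborel \<partial>lborel)"
      by (subst lborel.nn_integral_fst[symmetric]) auto
    also have "\<dots> = (\<integral>\<^sup>+x. \<alpha> z * b x z \<partial>lborel)"
      unfolding \<alpha>_def by (intro nn_integral_cong nn_integral_multc) measurable
    also have "\<dots> = \<alpha> z * \<beta> z"
      unfolding \<beta>_def by (rule nn_integral_cmult) measurable
    also have "(\<integral>\<^sup>+p. c (fst p) (snd p) \<partial>(lborel \<Otimes>\<^sub>M lborel)) = (\<integral>\<^sup>+x. \<integral>\<^sup>+y. c x y \<partial>lborel \<partial>lborel)"
      by (subst lborel.nn_integral_fst[symmetric]) auto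
    also have "\<dots> = S" unfolding S_def c_def by (rule nn_integral_point3(1)[symmetric]) measurable
    finally show ?thesis by (simp add: mult.assoc)
  qed
  have "E\<^sup>2 = (\<integral>\<^sup>+z. J z \<partial>lborel)\<^sup>2"
    unfolding E_def J_def by (subst nn_integral_point3(2)) auto
  also have "\<dots> \<le> (\<integral>\<^sup>+z. \<alpha> z \<partial>lborel) * (\<integral>\<^sup>+z. \<beta> z * S \<partial>lborel)"
    by (rule nn_integral_Cauchy_Schwarz) (measurable, rule slice)
  also have "(\<integral>\<^sup>+z. \<alpha> z \<partial>lborel) = S"
    unfolding S_def \<alpha>_def a_def by (rule nn_integral_point3(3)[symmetric]) measurable
  also have "(\<integral>\<^sup>+z. \<beta> z * S \<partial>lborel) = (\<integral>\<^sup>+z. \<beta> z \<partial>lborel) * S"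
    by (rule nn_integral_multc) measurable
  also have "(\<integral>\<^sup>+z. \<beta> z \<partial>lborel) = S"
    unfolding S_def \<beta>_def b_def by (rule nn_integral_point3(2)[symmetric]) measurable
  finally have E2: "E\<^sup>2 \<le> S ^ 3" by (simp add: power3_eq_cube mult.assoc)
  define e where "e = (LINT x|lborel. \<bar>\<phi> x\<bar> ^ 6)"
  define n where "n = (LINT x|lborel. (norm (G x))\<^sup>2)"
  have int: "integrable lborel (\<lambda>x. \<bar>\<phi> x\<bar> ^ 6)" "integrable lborel (\<lambda>x. (norm (G x))\<^sup>2)"
    using C1c_fun_sobolev[OF \<phi>] by (simp_all add: L6_fun_def L2_field_def)
  have e: "E = ennreal e" "e \<ge> 0" unfolding E_def h_def e_def using int
    by (auto intro!: nn_integral_eq_integral)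
  have n: "(\<integral>\<^sup>+x. ennreal (16 * (norm (G x))\<^sup>2) \<partial>lborel) = ennreal (16 * n)" "n \<ge> 0"
    unfolding n_def using int by (subst nn_integral_eq_integral) auto
  have "S\<^sup>2 \<le> (\<integral>\<^sup>+x. h x \<partial>lborel) * (\<integral>\<^sup>+x. ennreal (16 * (norm (G x))\<^sup>2) \<partial>lborel)"
    unfolding S_def
  proof (rule nn_integral_Cauchy_Schwarz)
    show "(g x)\<^sup>2 \<le> h x * ennreal (16 * (norm (G x))\<^sup>2)" for x
      unfolding g_def h_def
      by (simp add: ennreal_power ennreal_mult[symmetric] power_mult_distrib flip: power_mult)
  qed measurable
  also have "\<dots> = ennreal (16 * e * n)"
    unfolding E_def[symmetric] e n using e(2) n(2) by (simp add: ennreal_mult[symmetric] mult_ac)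
  finally have S2: "S\<^sup>2 \<le> ennreal (16 * e * n)" .
  \<comment> \<open>The two bounds combine to \<open>e ^ 4 \<le> (16 * e * n) ^ 3\<close>. Since
    \<open>e\<close> is a finite number, \<open>e ^ 3\<close> can be cancelled, which leaves the
    constant \<open>4096 = 16 ^ 3\<close>.\<close>
  have "ennreal (e ^ 4) = (E\<^sup>2)\<^sup>2" using e by (simp add: ennreal_power flip: power_mult)
  also have "\<dots> \<le> (S ^ 3)\<^sup>2" by (intro power_mono E2) simp
  also have "\<dots> = (S\<^sup>2) ^ 3" by (simp flip: power_mult)
  also have "\<dots> \<le> ennreal (16 * e * n) ^ 3" by (intro power_mono S2) simp
  also have "\<dots> = ennreal ((16 * e * n) ^ 3)" using e n by (simp add: ennreal_power)
  finally have "e ^ 4 \<le> (16 * e * n) ^ 3" using e n by simp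
  then have "e ^ 3 * e \<le> e ^ 3 * (4096 * n ^ 3)"
    by (simp add: power_mult_distrib mult_ac eval_nat_numeral)
  then show ?thesis
    using e(2) n(2) unfolding e_def[symmetric] n_def[symmetric] by (cases "e = 0") auto
qed

section \<open>Completeness of Lebesgue spaces\<close>

lemma Fatou_bound:
  fixes u :: "nat \<Rightarrow> 'a \<Rightarrow> ennreal"
  assumes [measurable]: "\<And>k. u k \<in> borel_measurable M"
    and lim: "AE x in M. (\<lambda>k. u k x) \<longlonglongrightarrow> v x"
    and le: "\<forall>\<^sub>F k in sequentially. (\<integral>\<^sup>+x. u k x \<partial>M) \<le> C"
  shows "(\<integral>\<^sup>+x. v x \<partial>M) \<le> C"
proof -
  have "(\<integral>\<^sup>+x. v x \<partial>M) = (\<integral>\<^sup>+x. liminf (\<lambda>k. u k x) \<partial>M)"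
    by (rule nn_integral_cong_AE)
       (use lim in eventually_elim, simp add: lim_imp_Liminf)
  also have "\<dots> \<le> liminf (\<lambda>k. \<integral>\<^sup>+x. u k x \<partial>M)" by (rule nn_integral_liminf) measurable
  also have "\<dots> \<le> C" by (rule Liminf_le) (use le in auto)
  finally show ?thesis .
qed

lemma ennreal_less_top_cases:
  assumes "x < top" obtains s where "x = ennreal s" "s \<ge> 0"
  using assms by (cases x) auto

text \<open>Along a fast subsequence the \<open>p\<close>-th powers of \<open>2 ^ k\<close> times
  the increments have a finite total integral, so at almost every point the increments decay
  geometrically. Working with \<open>p\<close>-th powers throughout replaces the triangle inequality
  in L^p.\<close>

lemma Riesz_Fischer:
  fixes f :: "nat \<Rightarrow> 'a \<Rightarrow> 'b::{banach, second_countable_topology}"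
  assumes [measurable]: "\<And>n. f n \<in> borel_measurable M" and "p > 0"
    and Cauchy: "\<And>e. e > 0 \<Longrightarrow> \<exists>N. \<forall>m\<ge>N. \<forall>n\<ge>N. (\<integral>\<^sup>+x. ennreal (norm (f m x - f n x) ^ p) \<partial>M) \<le> ennreal e"
  obtains g where "g \<in> borel_measurable M"
    "\<And>e. e > 0 \<Longrightarrow> \<exists>N. \<forall>n\<ge>N. (\<integral>\<^sup>+x. ennreal (norm (f n x - g x) ^ p) \<partial>M) \<le> ennreal e"
proof -
  let ?t = "\<lambda>\<Delta> k x. ennreal ((2 ^ k * norm (\<Delta> k x)) ^ p)"
  let ?N = "\<lambda>u v. \<integral>\<^sup>+x. ennreal (norm (u x - v x :: 'b) ^ p) \<partial>M"
  \<comment> \<open>One factor \<open>(1/2) ^ k\<close> makes the series summable; the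
    \<open>p\<close>-th power of the other absorbs the weight \<open>2 ^ k\<close>.\<close>
  define \<epsilon> :: "nat \<Rightarrow> real" where "\<epsilon> k = (1/2) ^ k * ((1/2) ^ k) ^ p" for k
  have \<epsilon>: "\<epsilon> k > 0" for k by (simp add: \<epsilon>_def)
  obtain N where N: "\<And>k m n. m \<ge> N k \<Longrightarrow> n \<ge> N k \<Longrightarrow>
      (\<integral>\<^sup>+x. ennreal (norm (f m x - f n x) ^ p) \<partial>M) \<le> ennreal (\<epsilon> k)"
    using Cauchy[OF \<epsilon>] by metis
  \<comment> \<open>Dominates \<open>N i\<close> for every \<open>i \<le> k\<close>, and the summand
    \<open>k\<close> makes it tend to infinity.\<close>
  define r where "r k = k + (\<Sum>i\<le>k. N i)" for k
  have rN: "r j \<ge> N k" if "j \<ge> k" for j k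
    using member_le_sum[of k "{..j}" N] that unfolding r_def by simp
  define \<Delta> where "\<Delta> k x = f (r (Suc k)) x - f (r k) x" for k x
  have [measurable]: "\<Delta> k \<in> borel_measurable M" for k unfolding \<Delta>_def[abs_def] by measurable
  have "(\<integral>\<^sup>+x. (\<Sum>k. ?t \<Delta> k x) \<partial>M)
      = (\<Sum>k. \<integral>\<^sup>+x. ?t \<Delta> k x \<partial>M)"
    by (rule nn_integral_suminf) measurable
  also have "\<dots> \<le> (\<Sum>k. ennreal ((1/2) ^ k))"
  proof (intro suminf_le summableI)
    fix k
    have "(\<integral>\<^sup>+x. ?t \<Delta> k x \<partial>M)
        = (\<integral>\<^sup>+x. ennreal ((2 ^ k) ^ p) * ennreal (norm (\<Delta> k x) ^ p) \<partial>M)"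
      by (simp add: power_mult_distrib ennreal_mult)
    also have "\<dots> = ennreal ((2 ^ k) ^ p) * (\<integral>\<^sup>+x. ennreal (norm (\<Delta> k x) ^ p) \<partial>M)"
      by (rule nn_integral_cmult) measurable
    also have "\<dots> \<le> ennreal ((2 ^ k) ^ p) * ennreal (\<epsilon> k)"
      unfolding \<Delta>_def by (intro mult_left_mono N rN) auto
    also have "\<dots> = ennreal ((2 ^ k) ^ p * \<epsilon> k)"
      using \<epsilon>[of k] by (simp add: ennreal_mult)
    also have "(2 ^ k) ^ p * \<epsilon> k = (1/2) ^ k"
    proof -
      have "(2::real) ^ k * (1/2) ^ k = 1" by (metis field_sum_of_halves mult_2 mult.commute nonzero_divide_eq_eq one_add_one power_mult_distrib power_one zero_neq_numeral)
      then have "((2::real) ^ k) ^ p * ((1/2) ^ k) ^ p = 1" by (metis power_mult_distrib power_one)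
      then show ?thesis unfolding \<epsilon>_def by (simp only: mult.left_commute[of _ "(1/2) ^ k"] mult_1_right)
    qed
    finally show "(\<integral>\<^sup>+x. ?t \<Delta> k x \<partial>M) \<le> ennreal ((1/2) ^ k)" .
  qed
  also have "\<dots> = ennreal (\<Sum>k. (1/2) ^ k)"
    by (rule suminf_ennreal2) (simp_all add: summable_geometric)
  finally have "(\<integral>\<^sup>+x. (\<Sum>k. ?t \<Delta> k x) \<partial>M) \<noteq> \<infinity>"
    by (auto simp: top_unique)
  then have "AE x in M. (\<Sum>k. ?t \<Delta> k x) \<noteq> \<infinity>"
    by (intro nn_integral_PInf_AE) measurable
  then have conv: "AE x in M. convergent (\<lambda>k. f (r k) x)"
  proof eventually_elim
    fix x assume "(\<Sum>k. ?t \<Delta> k x) \<noteq> \<infinity>"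
    then have "(\<Sum>k. ?t \<Delta> k x) < top" by (simp only: less_top infinity_ennreal_def)
    then obtain s where s: "(\<Sum>k. ?t \<Delta> k x) = ennreal s" "s \<ge> 0"
      by (rule ennreal_less_top_cases)
    have bound: "norm (\<Delta> k x) \<le> (1 + s) * (1/2) ^ k" for k
    proof -
      have "(\<Sum>i\<in>{k}. ennreal ((2 ^ i * norm (\<Delta> i x)) ^ p)) \<le> (\<Sum>k. ?t \<Delta> k x)"
        by (rule sum_le_suminf[OF summableI]) simp_all
      then have "?t \<Delta> k x \<le> ennreal s" by (simp only: s(1)) simp
      then have "(2 ^ k * norm (\<Delta> k x)) ^ p \<le> s" by (simp only: ennreal_le_iff[OF s(2)])
      then have "2 ^ k * norm (\<Delta> k x) \<le> 1 + s"
        using power_bound[of "2 ^ k * norm (\<Delta> k x)" p] \<open>p > 0\<close> by simp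
      then have "norm (\<Delta> k x) \<le> (1 + s) / 2 ^ k"
        by (simp only: pos_le_divide_eq zero_less_power zero_less_numeral mult.commute)
      also have "\<dots> = (1 + s) * (1/2) ^ k" by (simp only: power_one_over divide_inverse mult_1 power_inverse)
      finally show ?thesis .
    qed
    have "summable (\<lambda>k. \<Delta> k x)"
      by (rule summable_comparison_test'[of "\<lambda>k. (1 + s) * (1/2) ^ k" 0])
         (use bound in \<open>auto intro!: summable_mult summable_geometric\<close>)
    then have "convergent (\<lambda>n. f (r 0) x + (\<Sum>k<n. \<Delta> k x))"
      by (intro convergent_add convergent_const) (simp add: summable_iff_convergent)
    moreover have "f (r 0) x + (\<Sum>k<n. \<Delta> k x) = f (r n) x" for n
    proof (induction n)
      case (Suc n)
      have "f (r 0) x + (\<Sum>k<Suc n. \<Delta> k x) = (f (r 0) x + (\<Sum>k<n. \<Delta> k x)) + \<Delta> n x"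
        by (simp only: sum.lessThan_Suc add.assoc)
      also have "\<dots> = f (r n) x + \<Delta> n x" by (simp only: Suc)
      also have "\<dots> = f (r (Suc n)) x" by (simp add: \<Delta>_def)
      finally show ?case .
    qed simp
    ultimately show "convergent (\<lambda>k. f (r k) x)" by simp
  qed
  define g where "g x = lim (\<lambda>k. f (r k) x)" for x
  have [measurable]: "g \<in> borel_measurable M"
    unfolding g_def[abs_def] by (rule borel_measurable_lim_metric) measurable
  have lim: "AE x in M. (\<lambda>k. f (r k) x) \<longlonglongrightarrow> g x"
    using conv by eventually_elim (simp add: g_def convergent_LIMSEQ_iff)
  show thesis
  proof (rule that[of g])
    fix e :: real assume "e > 0"
    then obtain N' where N': "\<And>m n. m \<ge> N' \<Longrightarrow> n \<ge> N' \<Longrightarrow>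
        (\<integral>\<^sup>+x. ennreal (norm (f m x - f n x) ^ p) \<partial>M) \<le> ennreal e"
      using Cauchy by metis
    have r_top: "\<forall>\<^sub>F k in sequentially. r k \<ge> N'"
      by (rule eventually_sequentiallyI[of N']) (simp add: r_def)
    have "?N (f n) g \<le> ennreal e" if n: "n \<ge> N'" for n
    proof (rule Fatou_bound)
      show "(\<lambda>x. ennreal (norm (f n x - f (r k) x) ^ p)) \<in> borel_measurable M" for k by measurable
      show "AE x in M. (\<lambda>k. ennreal (norm (f n x - f (r k) x) ^ p)) \<longlonglongrightarrow> ennreal (norm (f n x - g x) ^ p)"
        using lim by eventually_elim (intro tendsto_intros)
      show "\<forall>\<^sub>F k in sequentially. (\<integral>\<^sup>+x. ennreal (norm (f n x - f (r k) x) ^ p) \<partial>M) \<le> ennreal e"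
        using r_top by eventually_elim (rule N'[OF n])
    qed
    then show "\<exists>N. \<forall>n\<ge>N. ?N (f n) g \<le> ennreal e" by blast
  qed measurable
qed


section \<open>Density of compactly supported functions\<close>

definition has_grad :: "(real^3 \<Rightarrow> real) \<Rightarrow> (real^3 \<Rightarrow> real^3) \<Rightarrow> bool" where
  "has_grad v g \<longleftrightarrow> L6_fun v \<and> L2_field g \<and> weak_gradient v g"

lemma has_grad_sobolev: "has_grad v g \<Longrightarrow> sobolev_fun v"
  unfolding has_grad_def sobolev_fun_def by blast

lemma C1c_fun_has_grad: "C1c_fun \<phi> G \<Longrightarrow> has_grad \<phi> G"
  by (simp add: has_grad_def C1c_fun_sobolev C1c_fun_weak_gradient)

lemma hom_sobolev_cases:
  obtains v g where "has_grad v g" "w = abs_hom_sobolev v"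
proof -
  have "\<exists>v g. has_grad v g \<and> w = abs_hom_sobolev v"
  proof (induction w rule: hom_sobolev.abs_induct)
    case (1 v)
    then have "has_grad v (weak_grad v)"
      using weak_grad[of v] sobolev_fun_L6[of v] by (simp add: has_grad_def)
    then show ?case by blast
  qed
  then show thesis using that by blast
qed

lemma abs_hom_sobolev_eqD:
  "sobolev_fun v \<Longrightarrow> sobolev_fun w \<Longrightarrow> abs_hom_sobolev v = abs_hom_sobolev w \<Longrightarrow> AE x in lborel. v x = w x"
  using Quotient_rel[OF Quotient_hom_sobolev, of v w] by simp

lemma abs_hom_sobolev_add:
  "sobolev_fun v \<Longrightarrow> sobolev_fun w \<Longrightarrow>
    abs_hom_sobolev v + abs_hom_sobolev w = abs_hom_sobolev (\<lambda>x. v x + w x)"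
  by (simp add: plus_hom_sobolev.abs_eq)

lemma abs_hom_sobolev_scaleR:
  "sobolev_fun v \<Longrightarrow> c *\<^sub>R abs_hom_sobolev v = abs_hom_sobolev (\<lambda>x. c * v x)"
  by (simp add: scaleR_hom_sobolev.abs_eq)

lemma has_grad_diff:
  assumes "has_grad v g" "has_grad w h"
  shows "has_grad (\<lambda>x. v x - w x) (\<lambda>x. g x - h x)"
proof -
  have "has_grad (\<lambda>x. -1 * w x) (\<lambda>x. -1 *\<^sub>R h x)"
    using assms(2) L6_fun_cmul[of w "-1"] L2_field_scaleR[of h "-1"] weak_gradient_cmul[of w h "-1"]
    by (simp add: has_grad_def)
  with assms(1) have "has_grad (\<lambda>x. v x + -1 * w x) (\<lambda>x. g x + -1 *\<^sub>R h x)"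
    unfolding has_grad_def
    using L6_fun_add[of v "\<lambda>x. -1 * w x"] L2_field_add[of g "\<lambda>x. -1 *\<^sub>R h x"]
      weak_gradient_add[of v "\<lambda>x. -1 * w x" g "\<lambda>x. -1 *\<^sub>R h x"] by blast
  then show ?thesis by simp
qed

lemma abs_hom_sobolev_diff:
  assumes "sobolev_fun v" "sobolev_fun w"
  shows "abs_hom_sobolev v - abs_hom_sobolev w = abs_hom_sobolev (\<lambda>x. v x - w x)"
  using abs_hom_sobolev_add[OF assms(1) sobolev_fun_cmul[OF assms(2), of "-1"]]
    abs_hom_sobolev_scaleR[OF assms(2), of "-1"]
  by (simp add: minus_hom_sobolev_def)

lemma inner_abs_hom_sobolev:
  assumes "has_grad v g" "has_grad w h"
  shows "abs_hom_sobolev v \<bullet> abs_hom_sobolev w = (LINT x|lborel. g x \<bullet> h x)"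
proof -
  note s = has_grad_sobolev[OF assms(1)] has_grad_sobolev[OF assms(2)]
  have [measurable]: "weak_grad v \<in> borel_measurable lborel" "weak_grad w \<in> borel_measurable lborel"
    "g \<in> borel_measurable lborel" "h \<in> borel_measurable lborel"
    using weak_grad(1)[OF s(1)] weak_grad(1)[OF s(2)] assms by (auto simp: L2_field_def has_grad_def)
  have "AE x in lborel. weak_grad v x = g x" "AE x in lborel. weak_grad w x = h x"
    using weak_grad_unique s assms by (auto simp: has_grad_def)
  then have "AE x in lborel. weak_grad v x \<bullet> weak_grad w x = g x \<bullet> h x" by eventually_elim simp
  then have "(LINT x|lborel. weak_grad v x \<bullet> weak_grad w x) = (LINT x|lborel. g x \<bullet> h x)"
    by (intro integral_cong_AE) auto
  then show ?thesis using s by (simp add: inner_hom_sobolev.abs_eq)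
qed

lemma norm_abs_hom_sobolev:
  assumes "has_grad v g"
  shows "(norm (abs_hom_sobolev v))\<^sup>2 = (LINT x|lborel. (norm (g x))\<^sup>2)"
  by (simp add: power2_norm_eq_inner inner_abs_hom_sobolev[OF assms assms])

text \<open>For \<open>y\<close> above \<epsilon> the factor
  \<open>(y / \<epsilon>) ^ (p - 1)\<close> is at least 1. This splitting takes the place of
  Hoelder's inequality: over a bounded set it trades an arbitrarily small constant against the
  integral of the \<open>p\<close>-th power.\<close>

lemma Young_power:
  fixes y :: real assumes "\<epsilon> > 0" "y \<ge> 0" "p \<ge> 1" shows "y \<le> \<epsilon> + y ^ p / \<epsilon> ^ (p - 1)"
proof (cases "y \<le> \<epsilon>")
  case False
  obtain q where p: "p = Suc q" using \<open>p \<ge> 1\<close> by (cases p) auto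
  have "y * \<epsilon> ^ q \<le> y * y ^ q" using False assms by (intro mult_left_mono power_mono) auto
  then have "y \<le> y ^ p / \<epsilon> ^ (p - 1)" using assms p by (simp add: field_simps)
  then show ?thesis using assms by simp
qed (use assms in \<open>auto intro: add_increasing2\<close>)

text \<open>Used with \<open>p = 6\<close> for functions and \<open>p = 2\<close> for the components
  of gradients, this lets the weak gradient identity pass to the limit.\<close>

lemma tendsto_integral_mult_test:
  fixes f :: "nat \<Rightarrow> real^3 \<Rightarrow> real"
  assumes f: "\<And>n. loc_integrable (f n)" "loc_integrable f'" and "p \<ge> 1"
    and int: "\<And>n. integrable lborel (\<lambda>x. \<bar>f n x - f' x\<bar> ^ p)"
    and lim: "(\<lambda>n. LINT x|lborel. \<bar>f n x - f' x\<bar> ^ p) \<longlonglongrightarrow> 0"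
    and \<psi>: "test_function \<psi>"
  shows "(\<lambda>n. LINT x|lborel. f n x * \<psi> x) \<longlonglongrightarrow> (LINT x|lborel. f' x * \<psi> x)"
proof -
  let ?E = "\<lambda>n. LINT x|lborel. \<bar>f n x - f' x\<bar> ^ p"
  obtain B l u where B: "B \<ge> 0" "\<And>x. \<bar>\<psi> x\<bar> \<le> B * indicator (cbox l u) x"
    using test_function_bound[OF \<psi>] by metis
  have BB: "\<bar>\<psi> x\<bar> \<le> B" for x using B(2)[of x] B(1) by (cases "x \<in> cbox l u") auto
  define V where "V = measure lborel (cbox l u)"
  have V: "V \<ge> 0" by (simp add: V_def)
  define D where "D n = \<bar>(LINT x|lborel. f n x * \<psi> x) - (LINT x|lborel. f' x * \<psi> x)\<bar>" for n
  have D: "D n \<le> \<epsilon> * (B * V) + B / \<epsilon> ^ (p - 1) * ?E n" if "\<epsilon> > 0" for \<epsilon> n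
  proof -
    have i: "integrable lborel (\<lambda>x. f n x * \<psi> x)" "integrable lborel (\<lambda>x. f' x * \<psi> x)"
      by (intro loc_integrable_mult_test f \<psi>)+
    have i2: "integrable lborel (\<lambda>x. \<epsilon> * (B * indicator (cbox l u) x) + B / \<epsilon> ^ (p - 1) * \<bar>f n x - f' x\<bar> ^ p)"
      using int integrable_cbox_indicator by auto
    have "D n = \<bar>LINT x|lborel. f n x * \<psi> x - f' x * \<psi> x\<bar>" unfolding D_def using i by simp
    also have "\<dots> \<le> (LINT x|lborel. \<bar>f n x * \<psi> x - f' x * \<psi> x\<bar>)" by (rule integral_abs_bound)
    also have "\<dots> \<le> (LINT x|lborel. \<epsilon> * (B * indicator (cbox l u) x) + B / \<epsilon> ^ (p - 1) * \<bar>f n x - f' x\<bar> ^ p)"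
    proof (rule integral_mono[OF _ i2])
      show "integrable lborel (\<lambda>x. \<bar>f n x * \<psi> x - f' x * \<psi> x\<bar>)" using i by simp
      fix x
      let ?y = "\<bar>f n x - f' x\<bar>"
      have "\<bar>f n x * \<psi> x - f' x * \<psi> x\<bar> = ?y * \<bar>\<psi> x\<bar>"
        by (simp add: abs_mult[symmetric] left_diff_distrib)
      also have "\<dots> \<le> (\<epsilon> + ?y ^ p / \<epsilon> ^ (p - 1)) * \<bar>\<psi> x\<bar>"
        using that \<open>p \<ge> 1\<close> by (intro mult_right_mono Young_power) auto
      also have "\<dots> = \<epsilon> * \<bar>\<psi> x\<bar> + ?y ^ p / \<epsilon> ^ (p - 1) * \<bar>\<psi> x\<bar>" by (simp add: distrib_right)
      also have "\<dots> \<le> \<epsilon> * (B * indicator (cbox l u) x) + ?y ^ p / \<epsilon> ^ (p - 1) * B"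
        using that by (intro add_mono mult_left_mono B BB) auto
      finally show "\<bar>f n x * \<psi> x - f' x * \<psi> x\<bar> \<le> \<epsilon> * (B * indicator (cbox l u) x) + B / \<epsilon> ^ (p - 1) * ?y ^ p"
        by (simp add: mult.commute)
    qed
    also have "\<dots> = \<epsilon> * (B * V) + B / \<epsilon> ^ (p - 1) * ?E n"
      using int integrable_cbox_indicator[of l u] by (simp add: V_def)
    finally show ?thesis .
  qed
  have "D \<longlonglongrightarrow> 0"
  proof (rule LIMSEQ_I)
    fix e :: real assume "e > 0"
    define \<epsilon> where "\<epsilon> = e / (2 * (B * V + 1))"
    have BV: "B * V \<ge> 0" using B V by simp
    have \<epsilon>: "\<epsilon> > 0" "\<epsilon> * (B * V) < e / 2"
    proof -
      show "\<epsilon> > 0" using \<open>e > 0\<close> BV by (simp add: \<epsilon>_def)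
      then have "\<epsilon> * (B * V) < \<epsilon> * (B * V + 1)" by (intro mult_strict_left_mono) auto
      also have "\<dots> = e / 2" using BV by (simp add: \<epsilon>_def field_simps)
      finally show "\<epsilon> * (B * V) < e / 2" .
    qed
    have "(\<lambda>n. B / \<epsilon> ^ (p - 1) * ?E n) \<longlonglongrightarrow> B / \<epsilon> ^ (p - 1) * 0"
      by (intro tendsto_intros lim)
    then have "\<forall>\<^sub>F n in sequentially. B / \<epsilon> ^ (p - 1) * ?E n < e / 2"
      by (rule order_tendstoD(2)) (use \<open>e > 0\<close> in simp)
    then have "\<forall>\<^sub>F n in sequentially. norm (D n - 0) < e"
    proof eventually_elim
      case (elim n)
      have "D n \<ge> 0" by (simp add: D_def)
      then have "norm (D n - 0) = D n" by simp
      then show ?case using D[OF \<epsilon>(1), of n] \<epsilon>(2) elim by linarith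
    qed
    then show "\<exists>no. \<forall>n\<ge>no. norm (D n - 0) < e" by (simp add: eventually_sequentially)
  qed
  then have "(\<lambda>n. \<bar>(LINT x|lborel. f n x * \<psi> x) - (LINT x|lborel. f' x * \<psi> x)\<bar>) \<longlonglongrightarrow> 0"
    by (simp only: D_def[abs_def])
  then show ?thesis by (simp only: tendsto_rabs_zero_iff LIM_zero_iff)
qed

lemma Riesz_Fischer_integrable:
  fixes f :: "nat \<Rightarrow> 'a \<Rightarrow> 'b::{banach, second_countable_topology}"
  assumes [measurable]: "\<And>n. f n \<in> borel_measurable M" and "p > 0"
    and int: "\<And>m n. integrable M (\<lambda>x. norm (f m x - f n x) ^ p)"
    and Cauchy: "\<And>e. e > 0 \<Longrightarrow> \<exists>N. \<forall>m\<ge>N. \<forall>n\<ge>N. (LINT x|M. norm (f m x - f n x) ^ p) \<le> e"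
  shows "\<exists>g N. g \<in> borel_measurable M \<and> (\<forall>n\<ge>N. integrable M (\<lambda>x. norm (f n x - g x) ^ p)) \<and>
    (\<lambda>n. LINT x|M. norm (f n x - g x) ^ p) \<longlonglongrightarrow> 0"
proof -
  have "\<exists>N. \<forall>m\<ge>N. \<forall>n\<ge>N. (\<integral>\<^sup>+x. ennreal (norm (f m x - f n x) ^ p) \<partial>M) \<le> ennreal e" if "e > 0" for e
  proof -
    have "(\<integral>\<^sup>+x. ennreal (norm (f m x - f n x) ^ p) \<partial>M) = ennreal (LINT x|M. norm (f m x - f n x) ^ p)" for m n
      by (rule nn_integral_eq_integral[OF int]) simp
    then show ?thesis using Cauchy[OF that] by (metis ennreal_leI)
  qed
  from Riesz_Fischer[OF assms(1,2) this] obtain g where [measurable]: "g \<in> borel_measurable M" and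
    g: "\<And>e. e > 0 \<Longrightarrow> \<exists>N. \<forall>n\<ge>N. (\<integral>\<^sup>+x. ennreal (norm (f n x - g x) ^ p) \<partial>M) \<le> ennreal e"
    by blast
  obtain N where N: "\<And>n. n \<ge> N \<Longrightarrow> (\<integral>\<^sup>+x. ennreal (norm (f n x - g x) ^ p) \<partial>M) \<le> ennreal 1"
    using g[of 1] by auto
  have gi: "integrable M (\<lambda>x. norm (f n x - g x) ^ p)" if "n \<ge> N" for n
    by (rule integrableI_bounded) (use N[OF that] in \<open>auto simp: less_top[symmetric] top_unique\<close>)
  have "(\<lambda>n. LINT x|M. norm (f n x - g x) ^ p) \<longlonglongrightarrow> 0"
  proof (rule LIMSEQ_I)
    fix e :: real assume "e > 0"
    then obtain N' where N': "\<And>n. n \<ge> N' \<Longrightarrow> (\<integral>\<^sup>+x. ennreal (norm (f n x - g x) ^ p) \<partial>M) \<le> ennreal (e / 2)"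
      using g[of "e / 2"] by auto
    have "norm ((LINT x|M. norm (f n x - g x) ^ p) - 0) < e" if "n \<ge> max N N'" for n
    proof -
      have "ennreal (LINT x|M. norm (f n x - g x) ^ p) \<le> ennreal (e / 2)"
        using N'[of n] that gi[of n] by (simp add: nn_integral_eq_integral)
      then have "(LINT x|M. norm (f n x - g x) ^ p) \<le> e / 2" using \<open>e > 0\<close> by simp
      moreover have "(LINT x|M. norm (f n x - g x) ^ p) \<ge> 0" by simp
      ultimately show ?thesis using \<open>e > 0\<close> by simp
    qed
    then show "\<exists>no. \<forall>n\<ge>no. norm ((LINT x|M. norm (f n x - g x) ^ p) - 0) < e" by blast
  qed
  with gi \<open>g \<in> borel_measurable M\<close> show ?thesis by blast
qed


section \<open>The subspace of compactly supported functions and its closure\<close>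

lemma C1c_fun_cmul: "C1c_fun \<phi> G \<Longrightarrow> C1c_fun (\<lambda>x. c * \<phi> x) (\<lambda>x. c *\<^sub>R G x)"
  unfolding C1c_fun_def C1_fun_def
  by (auto intro!: derivative_eq_intros continuous_intros exI)

lemma C1c_fun_add:
  assumes "C1c_fun \<phi> G" "C1c_fun \<psi> H"
  shows "C1c_fun (\<lambda>x. \<phi> x + \<psi> x) (\<lambda>x. G x + H x)"
proof -
  obtain R R' where "\<And>x. norm x \<ge> R \<Longrightarrow> \<phi> x = 0 \<and> G x = 0" "\<And>x. norm x \<ge> R' \<Longrightarrow> \<psi> x = 0 \<and> H x = 0"
    using assms by (auto simp: C1c_fun_def)
  then have "\<forall>x. norm x \<ge> max R R' \<longrightarrow> \<phi> x + \<psi> x = 0 \<and> G x + H x = 0" by simp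
  moreover have "C1_fun (\<lambda>x. \<phi> x + \<psi> x) (\<lambda>x. G x + H x)"
    using assms unfolding C1c_fun_def C1_fun_def
    by (auto intro!: derivative_eq_intros continuous_intros simp: inner_add_left)
  ultimately show ?thesis unfolding C1c_fun_def by blast
qed

lemma C1c_fun_diff:
  "C1c_fun \<phi> G \<Longrightarrow> C1c_fun \<psi> H \<Longrightarrow> C1c_fun (\<lambda>x. \<phi> x - \<psi> x) (\<lambda>x. G x - H x)"
  using C1c_fun_add[of \<phi> G "\<lambda>x. -1 * \<psi> x" "\<lambda>x. -1 *\<^sub>R H x"] C1c_fun_cmul[of \<psi> H "-1"] by simp

lemma C1c_fun_zero: "C1c_fun (\<lambda>x. 0) (\<lambda>x. 0)"
proof -
  have "((\<bullet>) (0 :: real^3)) = (\<lambda>h. 0)" by auto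
  then show ?thesis unfolding C1c_fun_def C1_fun_def by simp
qed

definition hom_compact :: "hom_sobolev set" where
  "hom_compact = {abs_hom_sobolev \<phi> |\<phi> G. C1c_fun \<phi> G}"

lemma subspace_hom_compact: "subspace hom_compact"
  unfolding subspace_def
proof (intro conjI ballI allI)
  show "0 \<in> hom_compact" unfolding hom_compact_def zero_hom_sobolev_def using C1c_fun_zero by blast
  fix u assume "u \<in> hom_compact"
  then obtain \<phi> G where \<phi>: "u = abs_hom_sobolev \<phi>" "C1c_fun \<phi> G" by (auto simp: hom_compact_def)
  show "c *\<^sub>R u \<in> hom_compact" for c
    using C1c_fun_cmul[OF \<phi>(2), of c] \<phi> C1c_fun_sobolev(1)[OF \<phi>(2)]
    by (auto simp: hom_compact_def abs_hom_sobolev_scaleR)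
  fix v assume "v \<in> hom_compact"
  then obtain \<psi> H where \<psi>: "v = abs_hom_sobolev \<psi>" "C1c_fun \<psi> H" by (auto simp: hom_compact_def)
  show "u + v \<in> hom_compact"
    using C1c_fun_add[OF \<phi>(2) \<psi>(2)] \<phi> \<psi> C1c_fun_sobolev(1)[OF \<phi>(2)] C1c_fun_sobolev(1)[OF \<psi>(2)]
    by (auto simp: hom_compact_def abs_hom_sobolev_add)
qed

lemma power6_add_le:
  fixes a b :: real shows "\<bar>a + b\<bar> ^ 6 \<le> 64 * \<bar>a\<bar> ^ 6 + 64 * \<bar>b\<bar> ^ 6"
proof -
  have "\<bar>a + b\<bar> ^ 6 \<le> (2 * max \<bar>a\<bar> \<bar>b\<bar>) ^ 6" by (intro power_mono) auto
  also have "\<dots> = 64 * max \<bar>a\<bar> \<bar>b\<bar> ^ 6" by (simp only: power_mult_distrib) simp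
  also have "\<dots> \<le> 64 * \<bar>a\<bar> ^ 6 + 64 * \<bar>b\<bar> ^ 6"
    by (cases "\<bar>a\<bar> \<le> \<bar>b\<bar>") (simp_all add: max_def)
  finally show ?thesis .
qed

text \<open>Convergence of the gradients in L^2 alone would not produce a limit function. The
  Sobolev inequality, applied to differences of the sequence, makes the functions Cauchy in L^6 as
  well, and the weak gradient identity survives both limits.\<close>

lemma Cauchy_C1c_fun_limit:
  assumes \<phi>: "\<And>n. C1c_fun (\<phi> n) (G n)" and C: "Cauchy (\<lambda>n. abs_hom_sobolev (\<phi> n))"
  obtains v g where "has_grad v g" "(\<lambda>n. abs_hom_sobolev (\<phi> n)) \<longlonglongrightarrow> abs_hom_sobolev v"
    "(LINT x|lborel. \<bar>v x\<bar> ^ 6) \<le> 64 * 4096 * norm (abs_hom_sobolev v) ^ 6"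
proof -
  let ?G2 = "\<lambda>m n. LINT x|lborel. (norm (G m x - G n x))\<^sup>2"
  let ?F6 = "\<lambda>m n. LINT x|lborel. norm (\<phi> m x - \<phi> n x) ^ 6"
  let ?A = abs_hom_sobolev
  note s = C1c_fun_sobolev[OF \<phi>] and hg = C1c_fun_has_grad[OF \<phi>]
  note \<phi>d = C1c_fun_diff[OF \<phi> \<phi>]
  have meas [measurable]: "\<phi> n \<in> borel_measurable lborel" "G n \<in> borel_measurable lborel" for n
    using s[of n] by (simp_all add: L6_fun_def L2_field_def)
  have nd: "(norm (?A (\<phi> m) - ?A (\<phi> n)))\<^sup>2 = ?G2 m n" for m n
    using norm_abs_hom_sobolev[OF has_grad_diff[OF hg hg], of m n] s by (simp add: abs_hom_sobolev_diff)
  have small: "\<exists>N. \<forall>m\<ge>N. \<forall>n\<ge>N. ?G2 m n \<le> e" if "e > 0" for e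
  proof -
    have "sqrt e > 0" using that by simp
    then obtain N where N: "\<And>m n. m \<ge> N \<Longrightarrow> n \<ge> N \<Longrightarrow> norm (?A (\<phi> m) - ?A (\<phi> n)) < sqrt e"
      using C unfolding Cauchy_def dist_norm by metis
    have "?G2 m n \<le> e" if "m \<ge> N" "n \<ge> N" for m n
    proof -
      have "(norm (?A (\<phi> m) - ?A (\<phi> n)))\<^sup>2 \<le> (sqrt e)\<^sup>2"
        using N[OF that] by (intro power_mono) auto
      then show ?thesis using \<open>e > 0\<close> by (simp add: nd)
    qed
    then show ?thesis by blast
  qed
  have gint: "integrable lborel (\<lambda>x. (norm (G m x - G n x))\<^sup>2)" for m n
    using C1c_fun_sobolev(2)[OF \<phi>d] by (simp add: L2_field_def)
  obtain g N1 where g: "g \<in> borel_measurable lborel"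
    "\<And>n. n \<ge> N1 \<Longrightarrow> integrable lborel (\<lambda>x. (norm (G n x - g x))\<^sup>2)"
    "(\<lambda>n. LINT x|lborel. (norm (G n x - g x))\<^sup>2) \<longlonglongrightarrow> 0"
    using Riesz_Fischer_integrable[OF meas(2) zero_less_numeral gint small] by blast
  have small6: "\<exists>N. \<forall>m\<ge>N. \<forall>n\<ge>N. ?F6 m n \<le> e" if "e > 0" for e
  proof -
    \<comment> \<open>For \<open>d \<le> 1\<close> one has \<open>d ^ 3 \<le> d\<close>, which turns
      the cubic Sobolev bound into a linear one.\<close>
    define d where "d = min 1 (e / 4096)"
    have d: "d > 0" "d \<le> 1" "4096 * d \<le> e" using that by (auto simp: d_def)
    have "?F6 m n \<le> e"
      if "?G2 m n \<le> d" for m n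
    proof -
      have "?F6 m n \<le> 4096 * ?G2 m n ^ 3"
        using C1c_fun_Sobolev_inequality[OF \<phi>d[of m n]] by simp
      also have "\<dots> \<le> 4096 * d ^ 3" using that by (intro mult_left_mono power_mono) auto
      also have "\<dots> \<le> 4096 * d" using d power_decreasing[of 1 3 d] by simp
      finally show ?thesis using d by linarith
    qed
    then show ?thesis using small[OF d(1)] by blast
  qed
  have vint: "integrable lborel (\<lambda>x. norm (\<phi> m x - \<phi> n x) ^ 6)" for m n
    using C1c_fun_sobolev(3)[OF \<phi>d] by (simp add: L6_fun_def)
  obtain v N2 where v: "v \<in> borel_measurable lborel"
    "\<And>n. n \<ge> N2 \<Longrightarrow> integrable lborel (\<lambda>x. norm (\<phi> n x - v x) ^ 6)"
    "(\<lambda>n. LINT x|lborel. norm (\<phi> n x - v x) ^ 6) \<longlonglongrightarrow> 0"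
    using Riesz_Fischer_integrable[OF meas(1) zero_less_numeral vint small6] by blast
  have Lg: "L2_field g"
  proof -
    have "L2_field (\<lambda>x. G N1 x - g x)" using g(1) g(2)[of N1] by (simp add: L2_field_def)
    from L2_field_add[OF s(2)[of N1] L2_field_scaleR[OF this, of "-1"]] show ?thesis by simp
  qed
  have Lv: "L6_fun v"
  proof -
    have "L6_fun (\<lambda>x. \<phi> N2 x - v x)" using v(1) v(2)[of N2] by (simp add: L6_fun_def)
    from L6_fun_add[OF s(3)[of N2] L6_fun_cmul[OF this, of "-1"]] show ?thesis by simp
  qed
  have Lvd: "L6_fun (\<lambda>x. \<phi> n x - v x)" for n
    using L6_fun_add[OF s(3) L6_fun_cmul[OF Lv, of "-1"]] by simp
  have Lgd: "L2_field (\<lambda>x. G n x - g x)" for n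
    using L2_field_add[OF s(2) L2_field_scaleR[OF Lg, of "-1"]] by simp
  have wg: "weak_gradient v g" unfolding weak_gradient_def
  proof (intro allI impI)
    fix \<psi> :: "real^3 \<Rightarrow> real" and i assume t: "test_function \<psi>"
    have 1: "(\<lambda>n. LINT x|lborel. \<phi> n x * partial_deriv i \<psi> x) \<longlonglongrightarrow> (LINT x|lborel. v x * partial_deriv i \<psi> x)"
    proof (rule tendsto_integral_mult_test[where p = 6])
      show "integrable lborel (\<lambda>x. \<bar>\<phi> n x - v x\<bar> ^ 6)" for n using Lvd by (simp add: L6_fun_def)
    qed (use v(3) in \<open>simp_all add: L6_fun_loc_integrable s Lv test_function_partial_deriv t\<close>)
    have le: "\<bar>G n x $ i - g x $ i\<bar> ^ 2 \<le> (norm (G n x - g x))\<^sup>2" for n x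
      using component_le_norm_cart[of "G n x - g x" i] by (intro power_mono) auto
    have int: "integrable lborel (\<lambda>x. \<bar>G n x $ i - g x $ i\<bar> ^ 2)" for n
    proof (rule Bochner_Integration.integrable_bound)
      show "integrable lborel (\<lambda>x. (norm (G n x - g x))\<^sup>2)" using Lgd by (simp add: L2_field_def)
      have [measurable]: "(\<lambda>x. G n x $ i) \<in> borel_measurable lborel" "(\<lambda>x. g x $ i) \<in> borel_measurable lborel"
        by (intro borel_measurable_vec_nth meas g)+
      show "(\<lambda>x. \<bar>G n x $ i - g x $ i\<bar> ^ 2) \<in> borel_measurable lborel" by measurable
    qed (use le in auto)
    have 2: "(\<lambda>n. LINT x|lborel. G n x $ i * \<psi> x) \<longlonglongrightarrow> (LINT x|lborel. g x $ i * \<psi> x)"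
    proof (rule tendsto_integral_mult_test[where p = 2])
      show "(\<lambda>n. LINT x|lborel. \<bar>G n x $ i - g x $ i\<bar> ^ 2) \<longlonglongrightarrow> 0"
      proof (rule tendsto_sandwich[OF _ _ tendsto_const g(3)])
        show "\<forall>\<^sub>F n in sequentially. (LINT x|lborel. \<bar>G n x $ i - g x $ i\<bar> ^ 2) \<le> (LINT x|lborel. (norm (G n x - g x))\<^sup>2)"
          using int Lgd le by (intro always_eventually allI integral_mono) (simp_all add: L2_field_def)
      qed simp
    qed (use int in \<open>simp_all add: L2_field_loc_integrable s Lg t\<close>)
    have eq: "(LINT x|lborel. \<phi> n x * partial_deriv i \<psi> x) = - (LINT x|lborel. G n x $ i * \<psi> x)" for n
      using C1c_fun_weak_gradient[OF \<phi>] t by (simp add: weak_gradient_def)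
    have 3: "(\<lambda>n. LINT x|lborel. \<phi> n x * partial_deriv i \<psi> x) \<longlonglongrightarrow> - (LINT x|lborel. g x $ i * \<psi> x)"
      unfolding eq by (rule tendsto_minus[OF 2])
    show "(LINT x|lborel. v x * partial_deriv i \<psi> x) = - (LINT x|lborel. g x $ i * \<psi> x)"
      by (rule LIMSEQ_unique[OF 1 3])
  qed
  have vg: "has_grad v g" using Lg Lv wg by (simp add: has_grad_def)
  note vs = has_grad_sobolev[OF vg]
  have "(\<lambda>n. (norm (?A (\<phi> n) - ?A v))\<^sup>2) \<longlonglongrightarrow> 0"
    using g(3) norm_abs_hom_sobolev[OF has_grad_diff[OF hg vg]] by (simp add: abs_hom_sobolev_diff s vs)
  then have "(\<lambda>n. sqrt ((norm (?A (\<phi> n) - ?A v))\<^sup>2)) \<longlonglongrightarrow> sqrt 0" by (rule tendsto_real_sqrt)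
  then have lim: "(\<lambda>n. ?A (\<phi> n)) \<longlonglongrightarrow> ?A v" by (simp add: tendsto_norm_zero_iff LIM_zero_iff)
  \<comment> \<open>Splitting \<open>v\<close> into \<open>\<phi> n\<close> and an error costs the
    factor \<open>64 = 2 ^ 6\<close> of \<open>power6_add_le\<close>; the error term tends to
    zero.\<close>
  have "(LINT x|lborel. \<bar>v x\<bar> ^ 6) \<le> 64 * (4096 * ((norm (?A (\<phi> n)))\<^sup>2) ^ 3) + 64 * (LINT x|lborel. norm (\<phi> n x - v x) ^ 6)" for n
  proof -
    have i: "integrable lborel (\<lambda>x. \<bar>\<phi> n x\<bar> ^ 6)" "integrable lborel (\<lambda>x. \<bar>\<phi> n x - v x\<bar> ^ 6)"
      using s(3) Lvd by (simp_all add: L6_fun_def)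
    have "(LINT x|lborel. \<bar>v x\<bar> ^ 6) \<le> (LINT x|lborel. 64 * \<bar>\<phi> n x\<bar> ^ 6 + 64 * \<bar>\<phi> n x - v x\<bar> ^ 6)"
    proof (rule integral_mono)
      show "integrable lborel (\<lambda>x. \<bar>v x\<bar> ^ 6)" using Lv by (simp add: L6_fun_def)
      show "integrable lborel (\<lambda>x. 64 * \<bar>\<phi> n x\<bar> ^ 6 + 64 * \<bar>\<phi> n x - v x\<bar> ^ 6)"
        by (intro Bochner_Integration.integrable_add integrable_mult_right i)
      fix x
      have "\<phi> n x + (v x - \<phi> n x) = v x" by simp
      with power6_add_le[of "\<phi> n x" "v x - \<phi> n x"]
      show "\<bar>v x\<bar> ^ 6 \<le> 64 * \<bar>\<phi> n x\<bar> ^ 6 + 64 * \<bar>\<phi> n x - v x\<bar> ^ 6"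
        by (simp only: abs_minus_commute[of "\<phi> n x" "v x"])
    qed
    also have "\<dots> = 64 * (LINT x|lborel. \<bar>\<phi> n x\<bar> ^ 6) + 64 * (LINT x|lborel. \<bar>\<phi> n x - v x\<bar> ^ 6)"
      by (subst Bochner_Integration.integral_add) (intro integrable_mult_right i, intro integrable_mult_right i, simp)
    also have "(LINT x|lborel. \<bar>\<phi> n x\<bar> ^ 6) \<le> 4096 * ((norm (?A (\<phi> n)))\<^sup>2) ^ 3"
      using C1c_fun_Sobolev_inequality[OF \<phi>[of n]] by (simp add: norm_abs_hom_sobolev[OF hg])
    finally show ?thesis by simp
  qed
  moreover have "(\<lambda>n. 64 * (4096 * ((norm (?A (\<phi> n)))\<^sup>2) ^ 3) + 64 * (LINT x|lborel. norm (\<phi> n x - v x) ^ 6))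
      \<longlonglongrightarrow> 64 * (4096 * ((norm (?A v))\<^sup>2) ^ 3) + 64 * 0"
    by (intro tendsto_intros lim v)
  ultimately have "(LINT x|lborel. \<bar>v x\<bar> ^ 6) \<le> 64 * (4096 * ((norm (?A v))\<^sup>2) ^ 3) + 64 * 0"
    by (intro LIMSEQ_le_const) auto
  then have "(LINT x|lborel. \<bar>v x\<bar> ^ 6) \<le> 64 * 4096 * norm (?A v) ^ 6" by (simp flip: power_mult)
  with that vg lim show thesis by blast
qed

lemma closure_hom_compact_Sobolev:
  assumes "w \<in> closure hom_compact"
  obtains v g where "has_grad v g" "w = abs_hom_sobolev v"
    "(LINT x|lborel. \<bar>v x\<bar> ^ 6) \<le> 64 * 4096 * norm w ^ 6"
proof -
  obtain s where s: "\<And>n. s n \<in> hom_compact" "s \<longlonglongrightarrow> w"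
    using assms unfolding closure_sequential by blast
  then obtain \<phi> G where \<phi>: "\<And>n. s n = abs_hom_sobolev (\<phi> n)" "\<And>n. C1c_fun (\<phi> n) (G n)"
    unfolding hom_compact_def by (simp add: mem_Collect_eq) metis
  have "Cauchy (\<lambda>n. abs_hom_sobolev (\<phi> n))"
    using LIMSEQ_imp_Cauchy[OF s(2)] by (simp add: \<phi>(1)[symmetric])
  from Cauchy_C1c_fun_limit[OF \<phi>(2) this] obtain v g where
    v: "has_grad v g" "(\<lambda>n. abs_hom_sobolev (\<phi> n)) \<longlonglongrightarrow> abs_hom_sobolev v"
    "(LINT x|lborel. \<bar>v x\<bar> ^ 6) \<le> 64 * 4096 * norm (abs_hom_sobolev v) ^ 6" by metis
  have "w = abs_hom_sobolev v"
    using LIMSEQ_unique[OF s(2)] v(2) by (simp add: \<phi>(1)[symmetric])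
  with v that show thesis by blast
qed

text \<open>Cauchy sequences in \<open>D\<close> are only asked to converge in the ambient space;
  their limits then lie in the closure. A Cauchy sequence in the closure is shadowed by one in
  \<open>D\<close> at distance less than \<open>inverse (real (Suc n))\<close>.\<close>

lemma complete_closure:
  fixes D :: "'a::metric_space set"
  assumes D: "\<And>s. (\<And>n. s n \<in> D) \<Longrightarrow> Cauchy s \<Longrightarrow> convergent s"
  shows "complete (closure D)"
  unfolding complete_def
proof (intro allI impI)
  fix s assume s: "(\<forall>n. s n \<in> closure D) \<and> Cauchy s"
  have "\<exists>d\<in>D. dist d (s n) < inverse (real (Suc n))" for n
  proof -
    have "inverse (real (Suc n)) > 0" by simp
    with s show ?thesis unfolding closure_approachable by blast
  qed
  then obtain d where d: "\<And>n. d n \<in> D" "\<And>n. dist (d n) (s n) < inverse (real (Suc n))" by metis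
  have lim: "(\<lambda>n. dist (d n) (s n)) \<longlonglongrightarrow> 0"
  proof (rule tendsto_sandwich[OF _ _ tendsto_const LIMSEQ_inverse_real_of_nat])
    show "\<forall>\<^sub>F n in sequentially. dist (d n) (s n) \<le> inverse (real (Suc n))"
      by (intro always_eventually allI less_imp_le d(2))
  qed simp
  have "Cauchy d"
  proof (rule metric_CauchyI)
    fix e :: real assume "e > 0"
    then have "e / 3 > 0" by simp
    obtain N1 where N1: "\<And>m n. m \<ge> N1 \<Longrightarrow> n \<ge> N1 \<Longrightarrow> dist (s m) (s n) < e / 3"
      using s \<open>e / 3 > 0\<close> unfolding Cauchy_def by metis
    obtain N2 where N2: "\<And>n. n \<ge> N2 \<Longrightarrow> dist (d n) (s n) < e / 3"
      using order_tendstoD(2)[OF lim \<open>e / 3 > 0\<close>] unfolding eventually_sequentially by auto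
    have "dist (d m) (d n) < e" if "m \<ge> max N1 N2" "n \<ge> max N1 N2" for m n
    proof -
      have "dist (d m) (d n) \<le> dist (d m) (s m) + dist (s m) (s n) + dist (d n) (s n)"
        using dist_triangle[of "d m" "d n" "s m"] dist_triangle2[of "s m" "d n" "s n"] by simp
      then show ?thesis using N1[of m n] N2[of m] N2[of n] that by simp
    qed
    then show "\<exists>M. \<forall>m\<ge>M. \<forall>n\<ge>M. dist (d m) (d n) < e" by blast
  qed
  then obtain L where L: "d \<longlonglongrightarrow> L" using D[of d, OF d(1)] by (auto simp: convergent_def)
  have "s \<longlonglongrightarrow> L"
  proof (rule tendsto_dist_iff[THEN iffD2], rule tendsto_sandwich[OF _ _ tendsto_const])
    show "(\<lambda>n. dist (d n) (s n) + dist (d n) L) \<longlonglongrightarrow> 0"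
      using tendsto_add[OF lim tendsto_dist_iff[THEN iffD1, OF L]] by simp
    show "\<forall>\<^sub>F n in sequentially. dist (s n) L \<le> dist (d n) (s n) + dist (d n) L"
      by (intro always_eventually allI dist_triangle3)
  qed simp
  moreover have "L \<in> closure D" using L d(1) unfolding closure_sequential by blast
  ultimately show "\<exists>l\<in>closure D. s \<longlonglongrightarrow> l" by blast
qed

lemma complete_closure_hom_compact: "complete (closure hom_compact)"
proof (rule complete_closure)
  fix s :: "nat \<Rightarrow> hom_sobolev" assume s: "\<And>n. s n \<in> hom_compact" "Cauchy s"
  then obtain \<phi> G where \<phi>: "\<And>n. s n = abs_hom_sobolev (\<phi> n)" "\<And>n. C1c_fun (\<phi> n) (G n)"
    unfolding hom_compact_def by (simp add: mem_Collect_eq) metis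
  have "Cauchy (\<lambda>n. abs_hom_sobolev (\<phi> n))" using s(2) by (simp add: \<phi>(1)[symmetric])
  from Cauchy_C1c_fun_limit[OF \<phi>(2) this] have "convergent (\<lambda>n. abs_hom_sobolev (\<phi> n))"
    by (metis convergent_def)
  then show "convergent s" by (simp add: \<phi>(1)[symmetric])
qed

section \<open>Mollification\<close>

definition convolve :: "(real^3 \<Rightarrow> real) \<Rightarrow> (real^3 \<Rightarrow> real) \<Rightarrow> real^3 \<Rightarrow> real" where
  "convolve w k x = (LINT y|lborel. w y * k (x - y))"

lemma loc_integrable_abs:
  assumes "loc_integrable w" shows "loc_integrable (\<lambda>x. \<bar>w x\<bar>)"
  unfolding loc_integrable_def
proof (intro conjI allI)
  show "(\<lambda>x. \<bar>w x\<bar>) \<in> borel_measurable lborel"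
    using loc_integrable_measurable[OF assms] by simp
  fix l u
  have "integrable lborel (\<lambda>x. \<bar>indicator (cbox l u) x * w x\<bar>)"
    using assms by (intro integrable_abs) (simp add: loc_integrable_def)
  then show "integrable lborel (\<lambda>x. indicator (cbox l u) x * \<bar>w x\<bar>)" by (simp add: abs_mult)
qed

lemma loc_integrable_cball:
  assumes "loc_integrable w" shows "integrable lborel (\<lambda>y. indicator (cball c R) y * \<bar>w y\<bar>)"
proof -
  note [measurable] = loc_integrable_measurable[OF assms]
  have [measurable]: "cball c R \<in> sets borel" by simp
  obtain a where a: "cball c R \<subseteq> cbox (-a) a"
    using bounded_subset_cbox_symmetric[OF bounded_cball] by blast
  show ?thesis
  proof (rule Bochner_Integration.integrable_bound)
    show "integrable lborel (\<lambda>y. indicator (cbox (-a) a) y * w y)"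
      using assms by (simp add: loc_integrable_def)
    show "AE y in lborel. norm (indicator (cball c R) y * \<bar>w y\<bar>) \<le> norm (indicator (cbox (-a) a) y * w y)"
    proof (rule AE_I2)
      show "norm (indicator (cball c R) y * \<bar>w y\<bar>) \<le> norm (indicator (cbox (-a) a) y * w y)" for y
        using subsetD[OF a, of y] by (cases "y \<in> cball c R") (simp_all del: mem_cball)
    qed
  qed measurable
qed

lemma loc_integrable_mult_continuous:
  assumes w: "loc_integrable w" and k: "continuous_on UNIV k" "\<And>y. norm y \<ge> R \<Longrightarrow> k y = 0"
  shows "integrable lborel (\<lambda>y. w y * k y)"
proof -
  note [measurable] = loc_integrable_measurable[OF w] continuous_imp_borel[OF k(1)]
  obtain M where M: "M \<ge> 0" "\<And>y. norm (k y) \<le> M" using bounded_compact_support[OF k] by blast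
  show ?thesis
  proof (rule Bochner_Integration.integrable_bound)
    show "integrable lborel (\<lambda>y. M * (indicator (cball 0 R) y * \<bar>w y\<bar>))"
      by (intro integrable_mult_right loc_integrable_cball w)
    show "AE y in lborel. norm (w y * k y) \<le> norm (M * (indicator (cball 0 R) y * \<bar>w y\<bar>))"
    proof (rule AE_I2)
      fix y
      show "norm (w y * k y) \<le> norm (M * (indicator (cball 0 R) y * \<bar>w y\<bar>))"
      proof (cases "norm y \<le> R")
        case True
        then show ?thesis using M(1) mult_right_mono[OF M(2)[of y], of "\<bar>w y\<bar>"]
          by (simp add: abs_mult mult.commute)
      qed (use k(2)[of y] in simp)
    qed
  qed measurable
qed

lemma integrable_convolve:
  assumes w: "loc_integrable w" and k: "continuous_on UNIV k" "\<And>y. norm y \<ge> R \<Longrightarrow> k y = 0"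
  shows "integrable lborel (\<lambda>y. w y * k (x - y))"
proof (rule loc_integrable_mult_continuous[OF w, of _ "\<bar>R\<bar> + norm x"])
  show "continuous_on UNIV (\<lambda>y. k (x - y))"
    by (intro continuous_on_compose2[OF k(1)] continuous_intros) auto
  show "k (x - y) = 0" if "norm y \<ge> \<bar>R\<bar> + norm x" for y
    using that norm_triangle_ineq2[of y x] by (intro k(2)) (simp add: norm_minus_commute)
qed

lemma compact_support_uniformly_continuous:
  fixes f :: "'a::euclidean_space \<Rightarrow> 'b::real_normed_vector"
  assumes f: "continuous_on UNIV f" "\<And>x. norm x \<ge> R \<Longrightarrow> f x = 0" and "e > 0"
  obtains d where "d > 0" "\<And>x y. norm (x - y) < d \<Longrightarrow> norm (f x - f y) \<le> e"
proof -
  have "uniformly_continuous_on (cball 0 (R + 1)) f"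
    by (intro compact_uniformly_continuous continuous_on_subset[OF f(1)]) auto
  then obtain d where d: "d > 0" "\<And>x y. x \<in> cball 0 (R + 1) \<Longrightarrow> y \<in> cball 0 (R + 1) \<Longrightarrow> dist y x < d \<Longrightarrow> dist (f y) (f x) < e"
    unfolding uniformly_continuous_on_def using \<open>e > 0\<close> by metis
  have "norm (f x - f y) \<le> e" if "norm (x - y) < min d 1" for x y
  proof (cases "norm x \<le> R + 1 \<and> norm y \<le> R + 1")
    case True
    then show ?thesis using d(2)[of y x] that by (auto simp: dist_norm)
  next
    case False
    then have "norm x \<ge> R" "norm y \<ge> R"
      using that norm_triangle_ineq2[of x y] norm_triangle_ineq3[of x y] by auto
    then show ?thesis using f(2) \<open>e > 0\<close> by simp
  qed
  then show thesis using that[of "min d 1"] d(1) by simp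
qed

text \<open>Continuity and differentiability of a convolution both reduce to this bound: the kernel
  is then a difference or a Taylor remainder, uniformly small and supported in a fixed ball, and
  \<open>w\<close> enters only through a local integral.\<close>

lemma convolve_near:
  assumes w: "loc_integrable w" and k: "continuous_on UNIV k"
    and le: "\<And>y. \<bar>k y\<bar> \<le> c * indicator (cball 0 R) y"
  shows "\<bar>LINT y|lborel. w y * k (x - y)\<bar> \<le> c * (LINT y|lborel. indicator (cball x R) y * \<bar>w y\<bar>)"
proof -
  have k0: "k y = 0" if "norm y \<ge> R + 1" for y
    using le[of y] that by (auto simp: indicator_def split: if_splits)
  have int: "integrable lborel (\<lambda>y. w y * k (x - y))" by (rule integrable_convolve[OF w k k0])
  have "\<bar>LINT y|lborel. w y * k (x - y)\<bar> \<le> (LINT y|lborel. \<bar>w y * k (x - y)\<bar>)"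
    by (rule integral_abs_bound)
  also have "\<dots> \<le> (LINT y|lborel. c * (indicator (cball x R) y * \<bar>w y\<bar>))"
  proof (rule integral_mono)
    show "integrable lborel (\<lambda>y. \<bar>w y * k (x - y)\<bar>)" using int by simp
    show "integrable lborel (\<lambda>y. c * (indicator (cball x R) y * \<bar>w y\<bar>))"
      by (intro integrable_mult_right loc_integrable_cball w)
    fix y
    have "indicator (cball 0 R) (x - y) = (indicator (cball x R) y :: real)"
      by (simp add: indicator_def dist_norm norm_minus_commute)
    then show "\<bar>w y * k (x - y)\<bar> \<le> c * (indicator (cball x R) y * \<bar>w y\<bar>)"
      using mult_right_mono[OF le[of "x - y"], of "\<bar>w y\<bar>"] by (simp add: abs_mult mult_ac)
  qed
  finally show ?thesis by simp
qed

lemma continuous_convolve: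
  assumes w: "loc_integrable w" and k: "continuous_on UNIV k" "\<And>y. norm y \<ge> R \<Longrightarrow> k y = 0"
  shows "continuous_on UNIV (convolve w k)"
  unfolding continuous_on_iff
proof (intro ballI allI impI)
  fix x and e :: real assume "e > 0"
  define A where "A = (LINT y|lborel. indicator (cball x (\<bar>R\<bar> + 1)) y * \<bar>w y\<bar>)"
  have A: "A \<ge> 0" unfolding A_def by (intro integral_nonneg_AE) simp
  define \<epsilon> where "\<epsilon> = e / (A + 1)"
  have "\<epsilon> > 0" using A \<open>e > 0\<close> by (simp add: \<epsilon>_def)
  obtain d where d: "d > 0" "\<And>x y. norm (x - y) < d \<Longrightarrow> norm (k x - k y) \<le> \<epsilon>"
    using compact_support_uniformly_continuous[OF k \<open>\<epsilon> > 0\<close>] by blast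
  have "dist (convolve w k x') (convolve w k x) < e" if x': "dist x' x < min d 1" for x'
  proof -
    define h where "h = x' - x"
    have h: "norm h < d" "norm h < 1" using x' by (auto simp: h_def dist_norm)
    have ch: "continuous_on UNIV (\<lambda>z. k (z + h))"
      by (intro continuous_on_compose2[OF k(1)] continuous_intros) auto
    have "convolve w k x' - convolve w k x = (LINT y|lborel. w y * k (x' - y) - w y * k (x - y))"
      unfolding convolve_def
      by (rule Bochner_Integration.integral_diff[symmetric]) (rule integrable_convolve[OF w k], simp)+
    also have "\<dots> = (LINT y|lborel. w y * (k ((x - y) + h) - k (x - y)))"
      by (simp add: h_def algebra_simps)
    also have "\<bar>\<dots>\<bar> \<le> \<epsilon> * A"
      unfolding A_def
    proof (rule convolve_near[OF w])
      show "continuous_on UNIV (\<lambda>z. k (z + h) - k z)" by (intro continuous_intros ch k)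
      show "\<bar>k (z + h) - k z\<bar> \<le> \<epsilon> * indicator (cball 0 (\<bar>R\<bar> + 1)) z" for z
      proof (cases "norm z \<le> \<bar>R\<bar> + 1")
        case True
        then show ?thesis using d(2)[of "z + h" z] h by simp
      next
        case False
        moreover have "norm (z + h) \<ge> norm z - norm h" by (metis add_diff_cancel_right' norm_triangle_ineq4 diff_le_eq)
        ultimately show ?thesis using k(2)[of z] k(2)[of "z + h"] h by simp
      qed
    qed
    also have "\<dots> < \<epsilon> * (A + 1)" using \<open>\<epsilon> > 0\<close> by simp
    also have "\<dots> = e" using A by (simp add: \<epsilon>_def)
    finally show ?thesis by (simp add: dist_real_def)
  qed
  then show "\<exists>d>0. \<forall>x'\<in>UNIV. dist x' x < d \<longrightarrow> dist (convolve w k x') (convolve w k x) < e"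
    using d(1) by (intro exI[of _ "min d 1"]) simp
qed

text \<open>All derivatives fall on the kernel. Its Taylor remainder is at most \<epsilon> times
  \<open>norm h\<close> at every point at once, because a compactly supported continuous gradient is
  uniformly continuous.\<close>

lemma C1_fun_convolve:
  assumes w: "loc_integrable w" and k: "C1c_fun k K"
  shows "C1_fun (convolve w k) (\<lambda>x. \<chi> i. convolve w (\<lambda>z. K z $ i) x)"
proof -
  obtain R where R: "\<And>x. norm x \<ge> R \<Longrightarrow> k x = 0 \<and> K x = 0" using k by (auto simp: C1c_fun_def)
  note kc = C1c_fun_continuous[OF k]
  have kz: "\<And>y. norm y \<ge> R \<Longrightarrow> k y = 0" and Kz: "\<And>y. norm y \<ge> R \<Longrightarrow> K y = 0" using R by auto
  have Kc: "continuous_on UNIV (\<lambda>z. K z $ i)" for i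
    using bounded_linear.continuous_on[OF bounded_linear_vec_nth kc(2)] .
  have Kiz: "\<And>y. norm y \<ge> R \<Longrightarrow> K y $ i = 0" for i using R by auto
  define G where "G x = (\<chi> i. convolve w (\<lambda>z. K z $ i) x)" for x
  have Gh: "G x \<bullet> h = (LINT y|lborel. w y * (K (x - y) \<bullet> h))" for x h
  proof -
    have "G x \<bullet> h = (\<Sum>i\<in>UNIV. (LINT y|lborel. w y * K (x - y) $ i) * h $ i)"
      by (simp add: G_def inner_vec_def convolve_def)
    also have "\<dots> = (\<Sum>i\<in>UNIV. (LINT y|lborel. w y * K (x - y) $ i * h $ i))" by simp
    also have "\<dots> = (LINT y|lborel. (\<Sum>i\<in>UNIV. w y * K (x - y) $ i * h $ i))"
      by (intro Bochner_Integration.integral_sum[symmetric] integrable_mult_left integrable_convolve[OF w Kc Kiz])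
    also have "\<dots> = (LINT y|lborel. w y * (K (x - y) \<bullet> h))"
      by (simp add: inner_vec_def sum_distrib_left mult.assoc)
    finally show ?thesis .
  qed
  have "(convolve w k has_derivative (\<lambda>h. G x \<bullet> h)) (at x)" for x
    unfolding has_derivative_at_alt
  proof (intro conjI allI impI)
    show "bounded_linear (\<lambda>h. G x \<bullet> h)" by (rule bounded_linear_inner_right)
    fix e :: real assume "e > 0"
    \<comment> \<open>The radius leaves room for shifts of \<open>k\<close> by vectors shorter than
      1.\<close>
    define A where "A = (LINT y|lborel. indicator (cball x (\<bar>R\<bar> + 1)) y * \<bar>w y\<bar>)"
    have A: "A \<ge> 0" unfolding A_def by (intro integral_nonneg_AE) simp
    define \<epsilon> where "\<epsilon> = e / (A + 1)"
    have "\<epsilon> > 0" using A \<open>e > 0\<close> by (simp add: \<epsilon>_def)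
    obtain d where d: "d > 0" "\<And>x y. norm (x - y) < d \<Longrightarrow> norm (K x - K y) \<le> \<epsilon>"
      using compact_support_uniformly_continuous[OF kc(2) Kz \<open>\<epsilon> > 0\<close>] by blast
    have lin: "\<bar>k (z + h) - k z - K z \<bullet> h\<bar> \<le> \<epsilon> * norm h" if h: "norm h < d" for z h
    proof -
      have "norm (k (z + h) - k z - K z \<bullet> ((z + h) - z)) \<le> norm ((z + h) - z) * \<epsilon>"
      proof (rule differentiable_bound_linearization[where S = "ball z d" and f' = "\<lambda>x h. K x \<bullet> h"])
        show "z + t *\<^sub>R (z + h - z) \<in> ball z d" if "t \<in> {0..1}" for t
          using that h mult_left_le_one_le[of "norm h" t] by (auto simp: dist_norm)
        show "(k has_derivative (\<lambda>h. K y \<bullet> h)) (at y within ball z d)" for y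
          using k by (auto simp: C1c_fun_def C1_fun_def intro: has_derivative_at_withinI)
        show "z \<in> ball z d" using d by simp
        show "onorm ((\<lambda>h. K y \<bullet> h) - (\<lambda>h. K z \<bullet> h)) \<le> \<epsilon>" if "y \<in> ball z d" for y
        proof -
          have "norm (K y - K z) \<le> \<epsilon>" using d(2)[of y z] that by (simp add: dist_norm norm_minus_commute)
          moreover have "(\<lambda>h. K y \<bullet> h) - (\<lambda>h. K z \<bullet> h) = (\<lambda>h. (K y - K z) \<bullet> h)"
            by (auto simp: inner_diff_left)
          moreover have "onorm (\<lambda>h. (K y - K z) \<bullet> h) \<le> norm (K y - K z)"
            by (rule onorm_bound) (auto intro: Cauchy_Schwarz_ineq2)
          ultimately show ?thesis by simp
        qed
      qed
      then show ?thesis by (simp add: mult.commute)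
    qed
    have "norm (convolve w k x' - convolve w k x - G x \<bullet> (x' - x)) \<le> e * norm (x' - x)" if x': "norm (x' - x) < min d 1" for x'
    proof -
      define h where "h = x' - x"
      have h: "norm h < d" "norm h < 1" using x' by (auto simp: h_def)
      have ch: "continuous_on UNIV (\<lambda>z. k (z + h))"
        by (intro continuous_on_compose2[OF kc(1)] continuous_intros) auto
      have Ki: "integrable lborel (\<lambda>y. w y * (K (x - y) \<bullet> h))"
        by (rule integrable_convolve[OF w, of "\<lambda>z. K z \<bullet> h" R]) (auto intro!: continuous_intros kc simp: Kz)
      have "convolve w k x' - convolve w k x - G x \<bullet> h
          = (LINT y|lborel. w y * k (x' - y) - w y * k (x - y) - w y * (K (x - y) \<bullet> h))"
        unfolding convolve_def Gh
        by (simp add: Ki integrable_convolve[OF w kc(1) kz])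
      also have "\<dots> = (LINT y|lborel. w y * (k ((x - y) + h) - k (x - y) - K (x - y) \<bullet> h))"
        by (simp add: h_def algebra_simps)
      also have "\<bar>\<dots>\<bar> \<le> (\<epsilon> * norm h) * A"
        unfolding A_def
      proof (rule convolve_near[OF w])
        show "continuous_on UNIV (\<lambda>z. k (z + h) - k z - K z \<bullet> h)" by (intro continuous_intros ch kc)
        show "\<bar>k (z + h) - k z - K z \<bullet> h\<bar> \<le> \<epsilon> * norm h * indicator (cball 0 (\<bar>R\<bar> + 1)) z" for z
        proof (cases "norm z \<le> \<bar>R\<bar> + 1")
          case True
          then show ?thesis using lin[OF h(1), of z] by simp
        next
          case False
          moreover have "norm (z + h) \<ge> norm z - norm h" by (metis add_diff_cancel_right' norm_triangle_ineq4 diff_le_eq)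
          ultimately show ?thesis using R[of z] R[of "z + h"] h by simp
        qed
      qed
      also have "\<dots> \<le> (\<epsilon> * norm h) * (A + 1)" using \<open>\<epsilon> > 0\<close> by (intro mult_left_mono) auto
      also have "\<dots> = e * norm h" using A by (simp add: \<epsilon>_def)
      finally show ?thesis by (simp add: h_def)
    qed
    then show "\<exists>d>0. \<forall>y. norm (y - x) < d \<longrightarrow>
        norm (convolve w k y - convolve w k x - G x \<bullet> (y - x)) \<le> e * norm (y - x)"
      using d(1) by (intro exI[of _ "min d 1"]) simp
  qed
  moreover have "continuous_on UNIV G"
    unfolding G_def by (intro continuous_on_vec_lambda continuous_convolve[OF w Kc Kiz])
  ultimately show ?thesis by (simp add: C1_fun_def G_def)
qed

text \<open>Fubini's theorem in the form that moves a mollifier from one factor to the other; the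
  inner integral on the left is a convolution of \<open>b\<close> with the reflected kernel.\<close>

lemma integral_convolve_swap:
  assumes a: "loc_integrable a" and \<eta>: "continuous_on UNIV \<eta>" "\<And>y. norm y \<ge> R \<Longrightarrow> \<eta> y = 0"
    and b: "continuous_on UNIV b" "\<And>y. norm y \<ge> S \<Longrightarrow> b y = 0"
  shows "(LINT y|lborel. a y * (LINT x|lborel. \<eta> (x - y) * b x)) = (LINT x|lborel. convolve a \<eta> x * b x)"
proof -
  note [measurable] = loc_integrable_measurable[OF a]
  have [measurable]: "\<eta> \<in> borel_measurable borel" "b \<in> borel_measurable borel"
    using continuous_imp_borel \<eta>(1) b(1) by auto
  obtain M where M: "M \<ge> 0" "\<And>y. norm (\<eta> y) \<le> M" using bounded_compact_support[OF \<eta>] by blast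
  have bi: "integrable lborel b" by (rule integrable_compact_support[OF b])
  let ?f = "\<lambda>y x. a y * (\<eta> (x - y) * b x)"
  define C where "C = (LINT x|lborel. M * \<bar>b x\<bar>)"
  have \<eta>b: "integrable lborel (\<lambda>x. \<eta> (x - y) * b x)" for y
  proof (rule Bochner_Integration.integrable_bound)
    show "integrable lborel (\<lambda>x. M * \<bar>b x\<bar>)" using bi by simp
    show "AE x in lborel. norm (\<eta> (x - y) * b x) \<le> norm (M * \<bar>b x\<bar>)"
      using M mult_right_mono[OF M(2)] by (auto simp: abs_mult)
  qed measurable
  have "integrable (lborel \<Otimes>\<^sub>M lborel) (\<lambda>(y, x). ?f y x)"
  proof (rule lborel_pair.Fubini_integrable)
    show "(\<lambda>(y, x). ?f y x) \<in> borel_measurable (lborel \<Otimes>\<^sub>M lborel)" by measurable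
    show "integrable lborel (\<lambda>y. LINT x|lborel. norm (case (y, x) of (y, x) \<Rightarrow> ?f y x))"
    proof (rule Bochner_Integration.integrable_bound)
      \<comment> \<open>Beyond this radius in \<open>y\<close>, one of the factors
        \<open>\<eta> (x - y)\<close> and \<open>b x\<close> vanishes for every
        \<open>x\<close>.\<close>
      show "integrable lborel (\<lambda>y. C * (indicator (cball 0 (\<bar>R\<bar> + \<bar>S\<bar>)) y * \<bar>a y\<bar>))"
        by (intro integrable_mult_right loc_integrable_cball a)
      show "AE y in lborel. norm (LINT x|lborel. norm (case (y, x) of (y, x) \<Rightarrow> ?f y x))
          \<le> norm (C * (indicator (cball 0 (\<bar>R\<bar> + \<bar>S\<bar>)) y * \<bar>a y\<bar>))"
      proof (rule AE_I2)
        fix y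
        have C0: "C \<ge> 0" unfolding C_def using M by (intro integral_nonneg_AE) simp
        show "norm (LINT x|lborel. norm (case (y, x) of (y, x) \<Rightarrow> ?f y x))
          \<le> norm (C * (indicator (cball 0 (\<bar>R\<bar> + \<bar>S\<bar>)) y * \<bar>a y\<bar>))"
        proof (cases "norm y \<le> \<bar>R\<bar> + \<bar>S\<bar>")
          case True
          have "(LINT x|lborel. \<bar>\<eta> (x - y) * b x\<bar>) \<le> C"
            unfolding C_def
              proof (rule integral_mono)
            show "integrable lborel (\<lambda>x. \<bar>\<eta> (x - y) * b x\<bar>)" using \<eta>b by simp
            show "integrable lborel (\<lambda>x. M * \<bar>b x\<bar>)" using bi by simp
            show "\<bar>\<eta> (x - y) * b x\<bar> \<le> M * \<bar>b x\<bar>" for x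
              using M(2)[of "x - y"] by (simp add: abs_mult mult_right_mono)
          qed
          then have "\<bar>a y\<bar> * (LINT x|lborel. \<bar>\<eta> (x - y) * b x\<bar>) \<le> \<bar>a y\<bar> * C" by (intro mult_left_mono) auto
          then show ?thesis using True C0 by (simp add: abs_mult mult.commute)
        next
          case False
          have "\<eta> (x - y) * b x = 0" for x
          proof (cases "norm x \<ge> S")
            case False
            then have "norm (x - y) \<ge> R" using \<open>\<not> norm y \<le> \<bar>R\<bar> + \<bar>S\<bar>\<close> norm_triangle_ineq2[of y x]
              by (simp add: norm_minus_commute)
            then show ?thesis using \<eta>(2) by simp
          qed (use b(2) in simp)
          then have z: "a y * (\<eta> (x - y) * b x) = 0" for x by (simp only: mult_zero_right)
          show ?thesis unfolding prod.case z by simp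
        qed
      qed
    qed measurable
    show "AE y in lborel. integrable lborel (\<lambda>x. case (y, x) of (y, x) \<Rightarrow> ?f y x)"
      using \<eta>b by auto
  qed
  from lborel_pair.Fubini_integral[OF this]
  have "(LINT x|lborel. LINT y|lborel. ?f y x) = (LINT y|lborel. LINT x|lborel. ?f y x)" .
  moreover have "(LINT y|lborel. ?f y x) = convolve a \<eta> x * b x" for x
    unfolding convolve_def by (simp add: mult.assoc[symmetric])
  ultimately show ?thesis by simp
qed


text \<open>The graph of the sixth power lies above its tangent at \<open>t\<close>: the difference
  is \<open>(a - t)\<^sup>2\<close> times a polynomial with positive coefficients.\<close>

lemma power6_tangent:
  fixes a t :: real assumes "a \<ge> 0" "t \<ge> 0" shows "6 * t ^ 5 * a - 5 * t ^ 6 \<le> a ^ 6"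
proof -
  have "a ^ 6 - (6 * t ^ 5 * a - 5 * t ^ 6)
      = (a - t)\<^sup>2 * (a ^ 4 + 2 * a ^ 3 * t + 3 * a\<^sup>2 * t\<^sup>2 + 4 * a * t ^ 3 + 5 * t ^ 4)"
    by (simp add: eval_nat_numeral algebra_simps)
  moreover have "\<dots> \<ge> 0" using assms by simp
  ultimately show ?thesis by linarith
qed

text \<open>A Jensen inequality for the kernel \<eta>, obtained by integrating the tangent
  inequality at a suitable \<open>t\<close> against \<open>\<eta> (x - y)\<close>. Exchanging the
  order of integration then leaves the mass of \<eta> as a factor.\<close>

lemma L6_fun_convolve:
  assumes w: "L6_fun w" and \<eta>: "continuous_on UNIV \<eta>" "\<And>y. norm y \<ge> R \<Longrightarrow> \<eta> y = 0" "\<And>y. \<eta> y \<ge> 0"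
  shows "L6_fun (convolve w \<eta>)"
proof -
  let ?P = "\<lambda>x. LINT y|lborel. \<bar>w y\<bar> ^ 6 * \<eta> (x - y)"
  let ?f = "\<lambda>x y. ennreal (\<bar>w y\<bar> ^ 6 * \<eta> (x - y))"
  let ?W = "\<lambda>x. ennreal (\<bar>convolve w \<eta> x\<bar> ^ 6)"
  have lw: "loc_integrable w" by (rule L6_fun_loc_integrable[OF w])
  have [measurable]: "w \<in> borel_measurable borel" and wi: "integrable lborel (\<lambda>y. \<bar>w y\<bar> ^ 6)"
    using w by (simp_all add: L6_fun_def)
  have [measurable]: "\<eta> \<in> borel_measurable borel" using continuous_imp_borel[OF \<eta>(1)] by simp
  have law: "loc_integrable (\<lambda>y. \<bar>w y\<bar>)" by (rule loc_integrable_abs[OF lw])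
  have \<eta>i: "integrable lborel \<eta>" by (rule integrable_compact_support[OF \<eta>(1,2)])
  define m where "m = (LINT y|lborel. \<eta> y)"
  have m0: "m \<ge> 0" unfolding m_def using \<eta>(3) by simp
  \<comment> \<open>Takes the place of the mass when dividing; adding 1 keeps it positive for a
    kernel of mass zero.\<close>
  define M where "M = m + 1"
  have M: "M > 0" "m \<le> M" using m0 by (simp_all add: M_def)
  obtain B where B: "\<And>y. norm (\<eta> y) \<le> B" using bounded_compact_support[OF \<eta>(1,2)] by blast
  have c\<eta>: "continuous_on UNIV (\<lambda>y. \<eta> (x - y))" for x
    by (intro continuous_on_compose2[OF \<eta>(1)] continuous_intros) auto
  have nn\<eta>: "(\<integral>\<^sup>+x. ennreal (\<eta> (x - y)) \<partial>lborel) = ennreal m" for y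
  proof -
    have "(\<integral>\<^sup>+x. ennreal (\<eta> (x - y)) \<partial>lborel) = (\<integral>\<^sup>+x. ennreal (\<eta> x) \<partial>lborel)"
      by (subst nn_integral_lborel_affine[of "\<lambda>x. ennreal (\<eta> (x - y))" 1 y]) auto
    also have "\<dots> = ennreal m" unfolding m_def using \<eta>i \<eta>(3) by (intro nn_integral_eq_integral) auto
    finally show ?thesis .
  qed
  have \<eta>x: "integrable lborel (\<lambda>y. \<eta> (x - y))" "(LINT y|lborel. \<eta> (x - y)) = m" for x
  proof -
    have *: "(\<integral>\<^sup>+y. ennreal (\<eta> (x - y)) \<partial>lborel) = ennreal m"
    proof -
      have "(\<integral>\<^sup>+y. ennreal (\<eta> (x - y)) \<partial>lborel) = (\<integral>\<^sup>+y. ennreal (\<eta> y) \<partial>lborel)"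
        by (subst nn_integral_lborel_affine[of "\<lambda>y. ennreal (\<eta> (x - y))" "-1" x]) auto
      also have "\<dots> = ennreal m" unfolding m_def using \<eta>i \<eta>(3) by (intro nn_integral_eq_integral) auto
      finally show ?thesis .
    qed
    have "has_bochner_integral lborel (\<lambda>y. \<eta> (x - y)) m"
      by (rule has_bochner_integral_nn_integral[OF _ _ m0 *]) (use \<eta>(3) in auto)
    then show "integrable lborel (\<lambda>y. \<eta> (x - y))" "(LINT y|lborel. \<eta> (x - y)) = m"
      by (simp_all add: has_bochner_integral_iff)
  qed
  have w6i: "integrable lborel (\<lambda>y. \<bar>w y\<bar> ^ 6 * \<eta> (x - y))" for x
  proof (rule Bochner_Integration.integrable_bound)
    show "integrable lborel (\<lambda>y. \<bar>w y\<bar> ^ 6 * B)" using wi by simp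
    show "AE y in lborel. norm (\<bar>w y\<bar> ^ 6 * \<eta> (x - y)) \<le> norm (\<bar>w y\<bar> ^ 6 * B)"
    proof (rule AE_I2)
      fix y
      have "\<bar>\<eta> (x - y)\<bar> \<le> \<bar>B\<bar>" using B[of "x - y"] by simp
      then show "norm (\<bar>w y\<bar> ^ 6 * \<eta> (x - y)) \<le> norm (\<bar>w y\<bar> ^ 6 * B)"
        unfolding real_norm_def abs_mult by (rule mult_left_mono) simp
    qed
  qed measurable
  have pw: "\<bar>convolve w \<eta> x\<bar> ^ 6 \<le> M ^ 5 * ?P x" for x
  proof -
    define K where "K = (LINT y|lborel. \<bar>w y\<bar> * \<eta> (x - y))"
    have K0: "K \<ge> 0" unfolding K_def using \<eta>(3) by simp
    have "\<bar>convolve w \<eta> x\<bar> \<le> (LINT y|lborel. \<bar>w y * \<eta> (x - y)\<bar>)"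
      unfolding convolve_def by (rule integral_abs_bound)
    also have "\<dots> = K" unfolding K_def using \<eta>(3) by (simp add: abs_mult)
    finally have WK: "\<bar>convolve w \<eta> x\<bar> \<le> K" .
    \<comment> \<open>With this point of tangency, \<open>6 * t ^ 5 * K - 5 * t ^ 6 * M\<close>
      equals \<open>t ^ 6 * M\<close>.\<close>
    define t where "t = K / M"
    have t: "t \<ge> 0" "K = t * M" using K0 M by (simp_all add: t_def)
    have Ki: "integrable lborel (\<lambda>y. \<bar>w y\<bar> * \<eta> (x - y))"
      by (rule integrable_convolve[OF law \<eta>(1,2)])
    have "6 * t ^ 5 * K - 5 * t ^ 6 * m
        = (LINT y|lborel. 6 * t ^ 5 * (\<bar>w y\<bar> * \<eta> (x - y)) - 5 * t ^ 6 * \<eta> (x - y))"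
      unfolding K_def using Ki \<eta>x[of x] by simp
    also have "\<dots> \<le> ?P x"
    proof (rule integral_mono)
      show "integrable lborel (\<lambda>y. 6 * t ^ 5 * (\<bar>w y\<bar> * \<eta> (x - y)) - 5 * t ^ 6 * \<eta> (x - y))"
        using Ki \<eta>x[of x] by simp
      show "6 * t ^ 5 * (\<bar>w y\<bar> * \<eta> (x - y)) - 5 * t ^ 6 * \<eta> (x - y) \<le> \<bar>w y\<bar> ^ 6 * \<eta> (x - y)" for y
        using mult_right_mono[OF power6_tangent[of "\<bar>w y\<bar>" t] \<eta>(3)[of "x - y"]] t
        by (simp add: left_diff_distrib mult.assoc)
    qed (rule w6i)
    finally have 1: "6 * t ^ 5 * K - 5 * t ^ 6 * m \<le> ?P x" .
    have "t ^ 6 * M = 6 * t ^ 5 * K - 5 * t ^ 6 * M" by (simp add: t(2) eval_nat_numeral algebra_simps)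
    also have "\<dots> \<le> 6 * t ^ 5 * K - 5 * t ^ 6 * m" using M t by (simp add: mult_left_mono)
    finally have "t ^ 6 * M \<le> ?P x" using 1 by linarith
    then have "M ^ 5 * (t ^ 6 * M) \<le> M ^ 5 * ?P x"
      using M by (intro mult_left_mono) auto
    also have "M ^ 5 * (t ^ 6 * M) = K ^ 6" unfolding t(2) by (simp add: eval_nat_numeral mult_ac)
    finally show ?thesis using power_mono[OF WK, of 6] by simp
  qed
  have Wm: "convolve w \<eta> \<in> borel_measurable lborel"
    by (rule continuous_imp_borel[OF continuous_convolve[OF lw \<eta>(1,2)]])
  have "(\<integral>\<^sup>+x. ?W x \<partial>lborel)
      \<le> (\<integral>\<^sup>+x. ennreal (M ^ 5) * (\<integral>\<^sup>+y. ?f x y \<partial>lborel) \<partial>lborel)"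
  proof (intro nn_integral_mono)
    fix x
    have "?W x \<le> ennreal (M ^ 5 * ?P x)"
      by (rule ennreal_leI[OF pw])
    also have "\<dots> = ennreal (M ^ 5) * (\<integral>\<^sup>+y. ?f x y \<partial>lborel)"
      using M \<eta>(3) by (subst nn_integral_eq_integral[OF w6i]) (auto simp: ennreal_mult)
    finally show "?W x \<le> ennreal (M ^ 5) * (\<integral>\<^sup>+y. ?f x y \<partial>lborel)" .
  qed
  also have "\<dots> = ennreal (M ^ 5) * (\<integral>\<^sup>+x. \<integral>\<^sup>+y. ?f x y \<partial>lborel \<partial>lborel)"
    by (rule nn_integral_cmult) measurable
  also have "(\<integral>\<^sup>+x. \<integral>\<^sup>+y. ?f x y \<partial>lborel \<partial>lborel)
      = (\<integral>\<^sup>+y. \<integral>\<^sup>+x. ?f x y \<partial>lborel \<partial>lborel)"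
    by (rule lborel_pair.Fubini'[symmetric]) measurable
  also have "\<dots> = (\<integral>\<^sup>+y. ennreal (\<bar>w y\<bar> ^ 6) * ennreal m \<partial>lborel)"
  proof (rule nn_integral_cong)
    fix y
    have "(\<integral>\<^sup>+x. ?f x y \<partial>lborel) = (\<integral>\<^sup>+x. ennreal (\<bar>w y\<bar> ^ 6) * ennreal (\<eta> (x - y)) \<partial>lborel)"
      using \<eta>(3) by (intro nn_integral_cong ennreal_mult) auto
    also have "\<dots> = ennreal (\<bar>w y\<bar> ^ 6) * (\<integral>\<^sup>+x. ennreal (\<eta> (x - y)) \<partial>lborel)"
      by (rule nn_integral_cmult) measurable
    finally show "(\<integral>\<^sup>+x. ?f x y \<partial>lborel) = ennreal (\<bar>w y\<bar> ^ 6) * ennreal m"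
      by (simp only: nn\<eta>)
  qed
  also have "\<dots> = (\<integral>\<^sup>+y. ennreal (\<bar>w y\<bar> ^ 6) \<partial>lborel) * ennreal m"
    by (rule nn_integral_multc) measurable
  also have "(\<integral>\<^sup>+y. ennreal (\<bar>w y\<bar> ^ 6) \<partial>lborel) = ennreal (LINT y|lborel. \<bar>w y\<bar> ^ 6)"
    by (rule nn_integral_eq_integral[OF wi]) simp
  finally have "(\<integral>\<^sup>+x. ?W x \<partial>lborel) < \<infinity>"
    by (rule order_le_less_trans) (simp add: ennreal_mult_less_top)
  then have "integrable lborel (\<lambda>x. \<bar>convolve w \<eta> x\<bar> ^ 6)"
    using Wm by (intro integrableI_bounded) auto
  then show ?thesis using Wm by (simp add: L6_fun_def)
qed

section \<open>Cutoff functions and Caccioppoli's inequality\<close>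

lemma DERIV_max_0_power2: "((\<lambda>y::real. (max 0 y)\<^sup>2) has_real_derivative 2 * max 0 y) (at y)"
proof -
  consider "y > 0" | "y < 0" | "y = 0" by linarith
  then show ?thesis
  proof cases
    case 1
    have "((\<lambda>y. y\<^sup>2) has_real_derivative 2 * max 0 y) (at y)"
      using 1 by (auto intro!: derivative_eq_intros)
    then show ?thesis
      by (rule has_field_derivative_transform_within_open[where S = "{0<..}"]) (use 1 in auto)
  next
    case 2
    have "((\<lambda>y. 0) has_real_derivative 2 * max 0 y) (at y)" using 2 by simp
    then show ?thesis
      by (rule has_field_derivative_transform_within_open[where S = "{..<0}"]) (use 2 in auto)
  next
    case 3
    have "((\<lambda>h. ((max 0 (0 + h))\<^sup>2 - (max 0 0)\<^sup>2) / h) \<longlongrightarrow> (0::real)) (at 0)"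
    proof (rule tendsto_rabs_zero_cancel, rule tendsto_sandwich[of "\<lambda>_. 0" _ _ "\<lambda>h. \<bar>h\<bar>"])
      show "\<forall>\<^sub>F h::real in at 0. \<bar>((max 0 (0 + h))\<^sup>2 - (max 0 0)\<^sup>2) / h\<bar> \<le> \<bar>h\<bar>"
        by (intro always_eventually allI) (auto simp: max_def power2_eq_square)
      show "((\<lambda>h::real. \<bar>h\<bar>) \<longlongrightarrow> 0) (at 0)" by (rule tendsto_rabs_zero) (rule tendsto_ident_at)
    qed auto
    then show ?thesis using 3 by (simp add: DERIV_def)
  qed
qed

text \<open>The profile is clipped twice, once at each radius, by the square of
  \<open>max 0\<close>. This square has a continuous derivative at 0, so both junctions are
  continuously differentiable and the gradient bound is explicit in \<kappa> and
  \<open>r\<close>.\<close>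

lemma cutoff_function:
  fixes a :: "real^3" and r \<kappa> :: real
  assumes "r > 0" "\<kappa> > 1"
  obtains \<theta> H where "C1c_fun \<theta> H" "\<And>x. 0 \<le> \<theta> x" "\<And>x. \<theta> x \<le> 1"
    "\<And>x. norm (x - a) \<le> r \<Longrightarrow> \<theta> x = 1 \<and> H x = 0"
    "\<And>x. norm (x - a) \<ge> \<kappa> * r \<Longrightarrow> \<theta> x = 0 \<and> H x = 0"
    "\<And>x. norm (H x) \<le> 8 * \<kappa> / ((\<kappa>\<^sup>2 - 1) * r)"
proof -
  define D where "D = (\<kappa>\<^sup>2 - 1) * r\<^sup>2"
  have k1: "\<kappa>\<^sup>2 > 1" using assms(2) by (simp add: one_less_power)
  have D: "D > 0" using assms k1 by (simp add: D_def)
  \<comment> \<open>Affine in the squared distance from \<open>a\<close>, with value 1 at radius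
    \<open>r\<close> and 0 at radius \<open>\<kappa> * r\<close>.\<close>
  define Y where "Y x = (\<kappa>\<^sup>2 * r\<^sup>2 - (x - a) \<bullet> (x - a)) / D" for x :: "real^3"
  define u where "u x = (max 0 (Y x))\<^sup>2" for x
  define \<theta> where "\<theta> x = 1 - (max 0 (1 - u x))\<^sup>2" for x
  define H where "H x = (2 * max 0 (1 - u x) * (2 * max 0 (Y x)) * (- 2 / D)) *\<^sub>R (x - a)" for x
  have dY: "(Y has_derivative (\<lambda>h. - 2 / D * ((x - a) \<bullet> h))) (at x)" for x
    unfolding Y_def[abs_def] using D by (auto intro!: derivative_eq_intros simp: inner_commute)
  have du: "(u has_derivative (\<lambda>h. - 2 / D * ((x - a) \<bullet> h) * (2 * max 0 (Y x)))) (at x)" for x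
    unfolding u_def[abs_def]
    using has_derivative_compose[OF dY DERIV_max_0_power2[unfolded has_field_derivative_def], of x]
    by (simp add: mult_ac)
  have "((\<lambda>x. 1 - u x) has_derivative (\<lambda>h. 0 - - 2 / D * ((x - a) \<bullet> h) * (2 * max 0 (Y x)))) (at x)" for x
    by (intro has_derivative_diff has_derivative_const du)
  from has_derivative_compose[OF this DERIV_max_0_power2[unfolded has_field_derivative_def]]
  have "((\<lambda>x. 1 - (max 0 (1 - u x))\<^sup>2) has_derivative
     (\<lambda>h. 0 - 2 * max 0 (1 - u x) * (0 - - 2 / D * ((x - a) \<bullet> h) * (2 * max 0 (Y x))))) (at x)" for x
    by (intro has_derivative_diff has_derivative_const)
  then have d\<theta>: "(\<theta> has_derivative (\<lambda>h. H x \<bullet> h)) (at x)" for x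
    by (simp add: \<theta>_def[abs_def] H_def mult_ac)
  have cY: "continuous_on UNIV Y" unfolding Y_def[abs_def] using D by (intro continuous_intros) auto
  have "continuous_on UNIV H" unfolding H_def[abs_def] u_def[abs_def]
    using D by (intro continuous_intros cY) auto
  with d\<theta> have C1: "C1_fun \<theta> H" by (simp add: C1_fun_def)
  have u0: "u x \<ge> 0" for x by (simp add: u_def)
  have inside: "\<theta> x = 1 \<and> H x = 0" if "norm (x - a) \<le> r" for x
  proof -
    have "(norm (x - a))\<^sup>2 \<le> r\<^sup>2" using that by (intro power_mono) auto
    then have "Y x \<ge> 1" using D by (simp add: Y_def D_def power2_norm_eq_inner left_diff_distrib)
    then have "u x \<ge> 1" by (simp add: u_def)
    then show ?thesis by (simp add: \<theta>_def H_def)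
  qed
  have outside: "\<theta> x = 0 \<and> H x = 0" if "norm (x - a) \<ge> \<kappa> * r" for x
  proof -
    have "(\<kappa> * r)\<^sup>2 \<le> (norm (x - a))\<^sup>2" using that assms by (intro power_mono) auto
    then have "Y x \<le> 0"
      using D by (simp add: Y_def power2_norm_eq_inner power_mult_distrib divide_le_0_iff)
    then show ?thesis by (simp add: \<theta>_def H_def u_def)
  qed
  have "C1c_fun \<theta> H" unfolding C1c_fun_def
  proof (intro conjI C1 exI allI impI)
    fix x :: "real^3" assume "norm a + \<kappa> * r \<le> norm x"
    then have "norm (x - a) \<ge> \<kappa> * r" using norm_triangle_ineq2[of x a] by linarith
    then show "\<theta> x = 0" "H x = 0" using outside by auto
  qed
  moreover have "0 \<le> \<theta> x" "\<theta> x \<le> 1" for x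
  proof -
    have "max 0 (1 - u x) \<le> 1" using u0[of x] by simp
    then have "(max 0 (1 - u x))\<^sup>2 \<le> 1\<^sup>2" by (intro power_mono) auto
    then show "0 \<le> \<theta> x" "\<theta> x \<le> 1" by (auto simp: \<theta>_def)
  qed
  moreover have "norm (H x) \<le> 8 * \<kappa> / ((\<kappa>\<^sup>2 - 1) * r)" for x
  proof (cases "norm (x - a) \<le> \<kappa> * r")
    case True
    \<comment> \<open>If \<open>Y x\<close> exceeds 1, then \<open>u x\<close> is at least 1 and the
      first factor is zero.\<close>
    have le1: "max 0 (1 - u x) * max 0 (Y x) \<le> 1"
    proof (cases "Y x \<le> 1")
      case True
      then show ?thesis using u0[of x] by (intro mult_le_one) auto
    next
      case False
      then have "u x \<ge> 1" by (simp add: u_def)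
      then show ?thesis by simp
    qed
    have "norm (H x) = (max 0 (1 - u x) * max 0 (Y x)) * (8 / D * norm (x - a))"
      using D by (simp add: H_def abs_mult)
    also have "\<dots> \<le> 1 * (8 / D * (\<kappa> * r))"
      using D True assms by (intro mult_mono le1) (auto intro: mult_left_mono divide_right_mono)
    also have "\<dots> = 8 * \<kappa> / ((\<kappa>\<^sup>2 - 1) * r)"
      using assms k1 by (simp add: D_def power2_eq_square)
    finally show ?thesis .
  next
    case False
    then show ?thesis using outside[of x] assms k1 by simp
  qed
  ultimately show thesis using that[of \<theta> H] inside outside by blast
qed


lemma continuous_integral_0_imp_0:
  fixes f :: "real^3 \<Rightarrow> real"
  assumes f: "continuous_on UNIV f" "\<And>x. f x \<ge> 0"
    and 0: "\<And>\<rho>. (LINT x|lborel. indicator (cball 0 \<rho>) x * f x) = 0"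
  shows "f x = 0"
proof -
  define \<rho> where "\<rho> = norm x + 1"
  have [measurable]: "f \<in> borel_measurable borel" using continuous_imp_borel[OF f(1)] by simp
  have int: "integrable lborel (\<lambda>x. indicator (cball 0 \<rho>) x * f x)"
    using borel_integrable_compact[of "cball 0 \<rho>" f] continuous_on_subset[OF f(1)] by simp
  have "AE x in lborel. indicator (cball 0 \<rho>) x * f x = 0"
    using integral_nonneg_eq_0_iff_AE[OF int] 0[of \<rho>] f(2) by simp
  then have AE: "AE x in lborel. x \<in> cball 0 \<rho> \<longrightarrow> f x = 0"
    by (rule eventually_mono) (auto simp: indicator_def split: if_splits)
  define U where "U = ball 0 \<rho> \<inter> {x. f x \<noteq> 0}"
  have "open U" unfolding U_def by (intro open_Int open_ball open_Collect_neq f continuous_intros)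
  have "AE x in lborel. x \<notin> U" using AE by (rule eventually_mono) (auto simp: U_def)
  then have "U \<in> null_sets lborel"
    using \<open>open U\<close> by (subst (asm) AE_iff_null_sets[symmetric]) auto
  then have "negligible U" by (simp add: negligible_iff_null_sets null_sets_completionI)
  then have "U = {}" using open_not_negligible[OF \<open>open U\<close>] by blast
  then have "x \<notin> U" by simp
  then show ?thesis by (simp add: U_def \<rho>_def)
qed

text \<open>Caccioppoli's inequality: testing the equation with \<open>\<theta>\<^sup>2 W\<close> bounds \<open>\<integral>\<theta>\<^sup>2\<bar>\<nabla>W\<bar>\<^sup>2\<close> by
  \<open>4\<integral>W\<^sup>2\<bar>\<nabla>\<theta>\<bar>\<^sup>2\<close>, and for cutoffs at scale \<open>R\<close> this vanishes as \<open>R \<rightarrow> \<infinity>\<close> because \<open>W\<close> is in \<open>L\<^sup>6\<close>.\<close>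

lemma weakly_harmonic_L6_gradient_0:
  assumes W: "C1_fun W G" "L6_fun W"
    and orth: "\<And>\<phi> K. C1c_fun \<phi> K \<Longrightarrow> (LINT x|lborel. G x \<bullet> K x) = 0"
  shows "G x = 0"
proof -
  let ?T = "\<lambda>R x. indicator {x. norm x \<ge> R} x * \<bar>W x\<bar> ^ 6"
  let ?I = "\<lambda>\<rho>. LINT x|lborel. indicator (cball 0 \<rho>) x * (norm (G x))\<^sup>2"
  note Wc = C1_fun_continuous[OF W(1)]
  have [measurable]: "W \<in> borel_measurable borel" and W6: "integrable lborel (\<lambda>x. \<bar>W x\<bar> ^ 6)"
    using W(2) by (simp_all add: L6_fun_def)
  define T where "T R = (LINT x|lborel. ?T R x)" for R
  have meas [measurable]: "{x :: real^3. norm x \<ge> R} \<in> sets borel" for R by measurable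
  have Ti: "integrable lborel (\<lambda>x. ?T R x)" for R
    by (rule Bochner_Integration.integrable_bound[OF W6]) (auto simp: indicator_def)
  have Tlim: "(\<lambda>n. T (real n)) \<longlonglongrightarrow> 0"
  proof -
    have "(\<lambda>n. T (real n)) \<longlonglongrightarrow> (LINT x|(lborel :: (real^3) measure). 0)"
      unfolding T_def
    proof (rule integral_dominated_convergence[OF _ _ W6])
      show "AE x in lborel. (\<lambda>n. indicator {x. norm x \<ge> real n} x * \<bar>W x\<bar> ^ 6) \<longlonglongrightarrow> 0"
      proof (rule AE_I2)
        fix x :: "real^3"
        obtain n0 where "norm x < real n0" using reals_Archimedean2 by blast
        then show "(\<lambda>n. indicator {x. norm x \<ge> real n} x * \<bar>W x\<bar> ^ 6) \<longlonglongrightarrow> 0"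
          by (intro tendsto_eventually eventually_sequentiallyI[of n0]) (auto simp: indicator_def)
      qed
      show "AE x in lborel. norm (indicator {x. norm x \<ge> real n} x * \<bar>W x\<bar> ^ 6) \<le> \<bar>W x\<bar> ^ 6" for n
        by (auto simp: indicator_def)
    qed measurable
    then show ?thesis by simp
  qed
  \<comment> \<open>The factor 8 is the cube of 2: the ball of radius \<open>2 * R\<close> has
    volume \<open>\<omega> * R ^ 3\<close>.\<close>
  define \<omega> where "\<omega> = unit_ball_vol (real DIM(real^3)) * 8"
  have Cacc: "?I \<rho> \<le> 144 * (\<epsilon> * \<omega> + T R / \<epsilon>\<^sup>2)"
    if R: "R > 0" "R \<ge> \<rho>" and "\<epsilon> > 0" for R \<rho> \<epsilon>
  proof -
    obtain \<theta> H where \<theta>: "C1c_fun \<theta> H" "\<And>x. 0 \<le> \<theta> x" "\<And>x. \<theta> x \<le> 1"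
      "\<And>x. norm (x - 0) \<le> R \<Longrightarrow> \<theta> x = 1 \<and> H x = 0"
      "\<And>x. norm (x - 0) \<ge> 2 * R \<Longrightarrow> \<theta> x = 0 \<and> H x = 0"
      "\<And>x. norm (H x) \<le> 8 * 2 / ((2\<^sup>2 - 1) * R)"
      using cutoff_function[of R 2 0] R by auto
    note \<theta>c = C1c_fun_continuous[OF \<theta>(1)]
    have H6: "norm (H x) \<le> 6 / R" for x
    proof -
      have "8 * 2 / ((2\<^sup>2 - 1) * R) \<le> 6 / R" using R by (simp add: field_simps)
      then show ?thesis using \<theta>(6)[of x] by linarith
    qed
    \<comment> \<open>The pairing of \<open>G\<close> with the gradient of \<theta> times
      (\<open>W\<close> times \<theta>), in the shape that two applications of
      \<open>C1c_fun_mult\<close> produce.\<close>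
    define F where "F x = G x \<bullet> (\<theta> x *\<^sub>R (W x *\<^sub>R H x + \<theta> x *\<^sub>R G x) + (W x * \<theta> x) *\<^sub>R H x)" for x
    have F0: "(LINT x|lborel. F x) = 0"
      unfolding F_def by (rule orth[OF C1c_fun_mult[OF C1c_fun_C1[OF \<theta>(1)] C1c_fun_mult[OF W(1) \<theta>(1)]]])
    have Fi: "integrable lborel F"
      unfolding F_def[abs_def]
      by (rule integrable_compact_support[of _ "2 * R"]) (auto intro!: continuous_intros Wc \<theta>c simp: \<theta>(5))
    let ?b = "\<lambda>x. 2 * F x + 144 * (\<epsilon> / R ^ 3 * indicator (cball 0 (2 * R)) x + ?T R x / \<epsilon>\<^sup>2)"
    have ball_i: "integrable lborel (indicator (cball 0 (2 * R)) :: real^3 \<Rightarrow> real)"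
      using emeasure_lborel_cball_finite by (simp add: integrable_indicator_iff)
    have bi: "integrable lborel ?b" using Fi Ti ball_i by auto
    have pw: "indicator (cball 0 \<rho>) x * (norm (G x))\<^sup>2 \<le> ?b x" for x
    proof -
      \<comment> \<open>The coefficient 2 is chosen so that the mixed term of this square is the one
        contained in \<open>2 * F x\<close>; only the term with the gradient of the cutoff is left
        over.\<close>
      have "0 \<le> (norm (\<theta> x *\<^sub>R G x + (2 * W x) *\<^sub>R H x))\<^sup>2" by simp
      also have "\<dots> = (\<theta> x)\<^sup>2 * (norm (G x))\<^sup>2 + 4 * \<theta> x * W x * (G x \<bullet> H x) + 4 * (W x)\<^sup>2 * (norm (H x))\<^sup>2"
        unfolding power2_norm_eq_inner by (simp add: inner_add inner_commute power2_eq_square algebra_simps)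
      also have "\<dots> = 2 * F x - (\<theta> x)\<^sup>2 * (norm (G x))\<^sup>2 + 4 * (W x)\<^sup>2 * (norm (H x))\<^sup>2"
        unfolding F_def power2_norm_eq_inner inner_add_right inner_scaleR_right by algebra
      finally have 1: "(\<theta> x)\<^sup>2 * (norm (G x))\<^sup>2 \<le> 2 * F x + 4 * (W x)\<^sup>2 * (norm (H x))\<^sup>2" by simp
      have 2: "indicator (cball 0 \<rho>) x * (norm (G x))\<^sup>2 \<le> (\<theta> x)\<^sup>2 * (norm (G x))\<^sup>2"
        using R \<theta>(4)[of x] by (auto simp: indicator_def)
      have 3: "(W x)\<^sup>2 * (norm (H x))\<^sup>2 \<le> 36 * (\<epsilon> / R ^ 3 * indicator (cball 0 (2 * R)) x + ?T R x / \<epsilon>\<^sup>2)"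
      proof (cases "norm x \<ge> R \<and> norm x \<le> 2 * R")
        case True
        \<comment> \<open>The scaling by \<open>R\<close> spreads \<epsilon> over the annulus with
          density \<open>\<epsilon> / R ^ 3\<close>, whose integral over the ball of radius
          \<open>2 * R\<close> does not depend on \<open>R\<close>.\<close>
        have "(W x)\<^sup>2 * R \<le> \<epsilon> + ((W x)\<^sup>2 * R) ^ 3 / \<epsilon> ^ (3 - 1)"
          by (rule Young_power) (use R \<open>\<epsilon> > 0\<close> in auto)
        then have "(W x)\<^sup>2 * R / R ^ 3 \<le> (\<epsilon> + ((W x)\<^sup>2 * R) ^ 3 / \<epsilon>\<^sup>2) / R ^ 3"
          using R by (intro divide_right_mono) auto
        also have "\<dots> = \<epsilon> / R ^ 3 + \<bar>W x\<bar> ^ 6 / \<epsilon>\<^sup>2"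
          using R \<open>\<epsilon> > 0\<close> by (simp add: field_simps power_mult_distrib flip: power_mult)
        finally have "(W x)\<^sup>2 * R / R ^ 3 \<le> \<epsilon> / R ^ 3 + \<bar>W x\<bar> ^ 6 / \<epsilon>\<^sup>2" .
        moreover have "(W x)\<^sup>2 * R / R ^ 3 = (W x)\<^sup>2 / R\<^sup>2" using R by (simp add: field_simps eval_nat_numeral)
        ultimately have "36 * ((W x)\<^sup>2 / R\<^sup>2) \<le> 36 * (\<epsilon> / R ^ 3 + \<bar>W x\<bar> ^ 6 / \<epsilon>\<^sup>2)"
          by (intro mult_left_mono) simp_all
        moreover have "(W x)\<^sup>2 * (norm (H x))\<^sup>2 \<le> (W x)\<^sup>2 * (6 / R)\<^sup>2"
          by (intro mult_left_mono power_mono H6) auto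
        moreover have "(W x)\<^sup>2 * (6 / R)\<^sup>2 = 36 * ((W x)\<^sup>2 / R\<^sup>2)" by (simp add: power_divide)
        ultimately have "(W x)\<^sup>2 * (norm (H x))\<^sup>2 \<le> 36 * (\<epsilon> / R ^ 3 + \<bar>W x\<bar> ^ 6 / \<epsilon>\<^sup>2)"
          by (simp only: order_trans)
        then show ?thesis using True by simp
      next
        case False
        then have "H x = 0" using \<theta>(4)[of x] \<theta>(5)[of x] by auto
        moreover have "0 \<le> \<epsilon> / R ^ 3 * indicator (cball 0 (2 * R)) x + ?T R x / \<epsilon>\<^sup>2"
          using R \<open>\<epsilon> > 0\<close> by (intro add_nonneg_nonneg) auto
        ultimately show ?thesis by simp
      qed
      show ?thesis using 1 2 3 by (simp only: mult.assoc)
    qed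
    have "?I \<rho> \<le> (LINT x|lborel. ?b x)"
    proof (rule integral_mono[OF _ bi pw])
      show "integrable lborel (\<lambda>x. indicator (cball 0 \<rho>) x * (norm (G x))\<^sup>2)"
      proof -
        have "continuous_on (cball 0 \<rho>) (\<lambda>x. (norm (G x))\<^sup>2)"
          by (intro continuous_intros continuous_on_subset[OF Wc(2)]) auto
        from borel_integrable_compact[OF compact_cball this] show ?thesis by simp
      qed
    qed
    also have "\<dots> = 144 * (\<epsilon> / R ^ 3 * measure lborel (cball 0 (2 * R) :: (real^3) set) + T R / \<epsilon>\<^sup>2)"
      using Fi Ti ball_i F0 by (simp add: T_def)
    also have "measure lborel (cball 0 (2 * R) :: (real^3) set) = \<omega> * R ^ 3"
      using content_cball[of "2 * R" "0 :: real^3"] R by (simp add: \<omega>_def power_mult_distrib)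
    also have "\<epsilon> / R ^ 3 * (\<omega> * R ^ 3) = \<epsilon> * \<omega>" using R by simp
    finally show ?thesis .
  qed
  have "?I \<rho> = 0" for \<rho>
  proof (rule antisym)
    let ?I = "LINT x|lborel. indicator (cball 0 \<rho>) x * (norm (G x))\<^sup>2"
    \<comment> \<open>The order of the limits matters: \<open>R\<close> tends to infinity for fixed
      \<epsilon>, and only afterwards \<epsilon> tends to zero.\<close>
    have "?I \<le> 144 * (\<epsilon> * \<omega>)" if "\<epsilon> > 0" for \<epsilon>
    proof -
      have "(\<lambda>n. 144 * (\<epsilon> * \<omega> + T (real n) / \<epsilon>\<^sup>2)) \<longlonglongrightarrow> 144 * (\<epsilon> * \<omega> + 0 / \<epsilon>\<^sup>2)"
        using that by (intro tendsto_intros Tlim) auto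
      moreover obtain n0 :: nat where "real n0 > \<bar>\<rho>\<bar>" using reals_Archimedean2 by blast
      then have "?I \<le> 144 * (\<epsilon> * \<omega> + T (real n) / \<epsilon>\<^sup>2)" if "n \<ge> n0" for n
        using that \<open>\<epsilon> > 0\<close> by (intro Cacc) auto
      ultimately have "?I \<le> 144 * (\<epsilon> * \<omega> + 0 / \<epsilon>\<^sup>2)" by (intro LIMSEQ_le_const) auto
      then show ?thesis by simp
    qed
    moreover have "((\<lambda>\<epsilon>. 144 * (\<epsilon> * \<omega>)) \<longlongrightarrow> 144 * (0 * \<omega>)) (at_right 0)" by (intro tendsto_intros)
    ultimately have "?I \<le> 144 * (0 * \<omega>)"
      by (intro tendsto_lowerbound) (auto simp: eventually_at_right_field intro!: exI[of _ 1])
    then show "?I \<le> 0" by simp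
    show "0 \<le> ?I" by simp
  qed
  moreover have "continuous_on UNIV (\<lambda>x. (norm (G x))\<^sup>2)" by (intro continuous_intros Wc)
  ultimately have "(norm (G x))\<^sup>2 = 0"
    by (intro continuous_integral_0_imp_0[of "\<lambda>x. (norm (G x))\<^sup>2"]) simp_all
  then show ?thesis by simp
qed


section \<open>Weakly harmonic functions, density and completeness\<close>

lemma test_function_eventually_0:
  assumes "test_function \<psi>" obtains R where "\<And>x. norm x \<ge> R \<Longrightarrow> \<psi> x = 0"
proof -
  have "bounded (closure {x. \<psi> x \<noteq> 0})"
    using assms by (simp add: test_function_def compact_imp_bounded)
  then obtain R where "\<forall>x\<in>closure {x. \<psi> x \<noteq> 0}. norm x \<le> R" unfolding bounded_iff ..
  then have R: "\<psi> x \<noteq> 0 \<Longrightarrow> norm x \<le> R" for x using closure_subset[of "{x. \<psi> x \<noteq> 0}"] by blast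
  show thesis
  proof (rule that[of "R + 1"])
    show "\<psi> x = 0" if "norm x \<ge> R + 1" for x using R[of x] that by force
  qed
qed

lemma test_function_C1c:
  assumes "test_function \<psi>" shows "C1c_fun \<psi> (\<lambda>x. \<chi> i. partial_deriv i \<psi> x)"
proof -
  obtain R where R: "\<And>x. norm x \<ge> R \<Longrightarrow> \<psi> x = 0" using test_function_eventually_0[OF assms] by blast
  have "\<exists>S. \<forall>x. norm x \<ge> S \<longrightarrow> partial_deriv i \<psi> x = 0" for i
    using test_function_eventually_0[OF test_function_partial_deriv[OF assms]] by metis
  then obtain S where S: "\<And>i x. norm x \<ge> S i \<Longrightarrow> partial_deriv i \<psi> x = 0" by metis
  define B where "B = max R (Max (range S))"
  have "\<forall>x. norm x \<ge> B \<longrightarrow> \<psi> x = 0 \<and> (\<chi> i. partial_deriv i \<psi> x) = 0"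
  proof (intro allI impI conjI)
    fix x :: "real^3" assume x: "norm x \<ge> B"
    then show "\<psi> x = 0" using R by (simp add: B_def)
    have "S i \<le> B" for i unfolding B_def by (intro max.coboundedI2 Max_ge) auto
    then show "(\<chi> i. partial_deriv i \<psi> x) = 0"
      using S x order_trans by (simp add: vec_eq_iff) blast
  qed
  with smooth_C1[of \<psi>] assms show ?thesis unfolding C1c_fun_def test_function_def by blast
qed

lemma LINT_reflect:
  fixes f :: "real^3 \<Rightarrow> real"
  assumes [measurable]: "f \<in> borel_measurable borel"
  shows "(LINT x|lborel. f (c - x)) = (LINT x|lborel. f x)"
proof -
  have "(lborel :: (real^3) measure) = distr lborel borel (\<lambda>x. c - x)"
    using lborel_affine[of "-1" c] by (simp add: density_1)
  then have "(LINT x|lborel. f x) = (LINT x|distr lborel borel (\<lambda>x. c - x). f x)" by simp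
  also have "\<dots> = (LINT x|lborel. f (c - x))" by (rule integral_distr) measurable
  finally show ?thesis by simp
qed

text \<open>As a function of \<open>y\<close> the reflected and translated kernel is again a box
  bump, hence an admissible test function for the weak gradient.\<close>

lemma box_bump_reflect: "box_bump n l u (x - y) = box_bump n (x - u) (x - l) y"
proof -
  have "bump n (l $ i) (u $ i) (x $ i - y $ i) = bump n (x $ i - u $ i) (x $ i - l $ i) (y $ i)" for i
  proof -
    have e: "x $ i - y $ i - l $ i = x $ i - l $ i - y $ i"
      "u $ i - (x $ i - y $ i) = y $ i - (x $ i - u $ i)"
      by simp_all
    show ?thesis unfolding bump_alt e by (rule mult.commute)
  qed
  then show ?thesis by (simp add: box_bump_def tensor_def)
qed

lemma partial_deriv_reflect:
  assumes "C1_fun \<eta> H" "\<And>y. \<psi> y = \<eta> (x - y)"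
  shows "partial_deriv i \<psi> y = - H (x - y) $ i"
proof -
  have "((\<lambda>y. x - y) has_derivative (\<lambda>h. - h)) (at y)" by (auto intro!: derivative_eq_intros)
  moreover have "(\<eta> has_derivative (\<lambda>h. H (x - y) \<bullet> h)) (at (x - y))" using assms(1) by (simp add: C1_fun_def)
  ultimately have "((\<lambda>y. \<eta> (x - y)) has_derivative (\<lambda>h. H (x - y) \<bullet> (- h))) (at y)"
    by (rule has_derivative_compose)
  then have "(\<psi> has_derivative (\<lambda>h. (- H (x - y)) \<bullet> h)) (at y)"
    using assms(2) by (simp add: assms(2)[abs_def])
  from partial_deriv_eq[OF this] show ?thesis by simp
qed

text \<open>Mollifications of a weakly harmonic function in the energy space are again weakly harmonic,
  so their gradients vanish.\<close>

lemma weakly_harmonic_gradient_0: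
  assumes w: "has_grad w g"
    and orth: "\<And>\<phi> K. C1c_fun \<phi> K \<Longrightarrow> (LINT x|lborel. g x \<bullet> K x) = 0"
  shows "AE x in lborel. g x = 0"
proof -
  have w6: "L6_fun w" and g2: "L2_field g" and wg: "weak_gradient w g" using w by (simp_all add: has_grad_def)
  note lw = L6_fun_loc_integrable[OF w6] and lg = L2_field_loc_integrable[OF g2]
  \<comment> \<open>The integral is the mollified gradient evaluated at the origin. As
    \<open>l\<close> and \<open>u\<close> vary, the reflected kernels run through all box bumps, so
    this is what \<open>du_Bois_Reymond\<close> asks for.\<close>
  have key: "(LINT y|lborel. g y $ i * box_bump n l u (0 - y)) = 0" for n l u i
  proof -
    define \<eta> where "\<eta> = box_bump n l u"
    have t: "test_function \<eta>" unfolding \<eta>_def by (rule test_function_box_bump)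
    define H where "H = (\<lambda>x. \<chi> i. partial_deriv i \<eta> x)"
    have \<eta>: "C1c_fun \<eta> H" unfolding H_def by (rule test_function_C1c[OF t])
    obtain R where R: "\<And>x. norm x \<ge> R \<Longrightarrow> \<eta> x = 0 \<and> H x = 0" using \<eta> by (auto simp: C1c_fun_def)
    have \<eta>z: "\<And>x. norm x \<ge> R \<Longrightarrow> \<eta> x = 0" using R by blast
    note \<eta>c = C1c_fun_continuous[OF \<eta>]
    have \<eta>0: "\<eta> x \<ge> 0" for x
      unfolding \<eta>_def box_bump_def tensor_def by (intro prod_nonneg ballI bump_bounds)
    have grad: "convolve w (\<lambda>z. H z $ i) x = convolve (\<lambda>y. g y $ i) \<eta> x" for i x
    proof -
      let ?\<psi> = "box_bump n (x - u) (x - l)"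
      have \<psi>: "?\<psi> y = \<eta> (x - y)" for y by (simp add: \<eta>_def box_bump_reflect)
      have "partial_deriv i ?\<psi> y = - H (x - y) $ i" for y
        by (rule partial_deriv_reflect[OF C1c_fun_C1[OF \<eta>] \<psi>])
      then show ?thesis
        using wg[unfolded weak_gradient_def, rule_format, OF test_function_box_bump[of n "x - u" "x - l"], of i]
        by (simp add: \<psi> convolve_def)
    qed
    define W where "W = convolve w \<eta>"
    define G where "G x = (\<chi> i. convolve (\<lambda>y. g y $ i) \<eta> x)" for x
    have W: "C1_fun W G" unfolding W_def G_def grad[symmetric] by (rule C1_fun_convolve[OF lw \<eta>])
    have W6: "L6_fun W" unfolding W_def by (rule L6_fun_convolve[OF w6 \<eta>c(1) \<eta>z \<eta>0])
    \<comment> \<open>Orthogonality passes to the mollification because the mollifier can be moved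
      onto the other factor: \<open>\<Phi>\<close> below is \<phi> convolved with the reflected
      kernel, and it is again compactly supported.\<close>
    have Wo: "(LINT x|lborel. G x \<bullet> K x) = 0" if \<phi>: "C1c_fun \<phi> K" for \<phi> K
    proof -
      obtain S where S: "\<And>x. norm x \<ge> S \<Longrightarrow> \<phi> x = 0 \<and> K x = 0" using \<phi> by (auto simp: C1c_fun_def)
      note \<phi>c = C1c_fun_continuous[OF \<phi>]
      have Kc: "continuous_on UNIV (\<lambda>x. K x $ i)" for i
        by (rule bounded_linear.continuous_on[OF bounded_linear_vec_nth \<phi>c(2)])
      have Kz: "norm x \<ge> S \<Longrightarrow> K x $ i = 0" for x i using S by simp
      have Gc: "continuous_on UNIV (\<lambda>x. convolve (\<lambda>y. g y $ i) \<eta> x)" for i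
        by (rule continuous_convolve[OF lg \<eta>c(1) \<eta>z])
      define \<eta>' where "\<eta>' z = \<eta> (- z)" for z
      have \<eta>'c: "continuous_on UNIV \<eta>'" unfolding \<eta>'_def[abs_def]
        by (intro continuous_on_compose2[OF \<eta>c(1)] continuous_intros) auto
      have \<eta>'z: "\<eta>' z = 0" if "norm z \<ge> R" for z using \<eta>z[of "- z"] that by (simp add: \<eta>'_def)
      have l\<eta>': "loc_integrable \<eta>'"
        unfolding loc_integrable_def
      proof (intro conjI allI)
        show "\<eta>' \<in> borel_measurable lborel" by (rule continuous_imp_borel[OF \<eta>'c])
        show "integrable lborel (\<lambda>x. indicator (cbox l u) x * \<eta>' x)" for l u
          using integrable_mult_indicator[OF _ integrable_compact_support[OF \<eta>'c \<eta>'z], of "cbox l u"] by simp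
      qed
      have conv: "convolve \<eta>' k y = (LINT x|lborel. \<eta> (x - y) * k x)" if "continuous_on UNIV k" for k y
      proof -
        have [measurable]: "k \<in> borel_measurable borel" "\<eta> \<in> borel_measurable borel"
          using continuous_imp_borel that \<eta>c(1) by auto
        have "(LINT x|lborel. \<eta> (x - y) * k x) = (LINT z|lborel. \<eta> (y - z - y) * k (y - z))"
          by (rule LINT_reflect[symmetric]) measurable
        then show ?thesis by (simp add: convolve_def \<eta>'_def)
      qed
      have zero: "convolve \<eta>' k y = 0" if "\<And>x. norm x \<ge> S \<Longrightarrow> k x = 0" "norm y \<ge> R + S" for k y
      proof -
        have "\<eta>' z * k (y - z) = 0" for z
        proof (cases "norm z \<ge> R")
          case False
          then have "norm (y - z) \<ge> S" using that(2) norm_triangle_ineq2[of y z] by linarith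
          then show ?thesis using that(1) by simp
        qed (simp add: \<eta>'z)
        then show ?thesis unfolding convolve_def by (simp only: integral_zero)
      qed
      define \<Phi> where "\<Phi> = convolve \<eta>' \<phi>"
      define K' where "K' y = (\<chi> i. convolve \<eta>' (\<lambda>x. K x $ i) y)" for y
      have "C1_fun \<Phi> K'" unfolding \<Phi>_def K'_def by (rule C1_fun_convolve[OF l\<eta>' \<phi>])
      moreover have "\<forall>y. norm y \<ge> R + S \<longrightarrow> \<Phi> y = 0 \<and> K' y = 0"
        using zero S by (simp add: \<Phi>_def K'_def vec_eq_iff)
      ultimately have \<Phi>: "C1c_fun \<Phi> K'" unfolding C1c_fun_def by blast
      note K'c = C1c_fun_continuous(2)[OF \<Phi>]
      have K'ic: "continuous_on UNIV (\<lambda>x. K' x $ i)" for i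
        by (rule bounded_linear.continuous_on[OF bounded_linear_vec_nth K'c])
      have "0 = (LINT y|lborel. g y \<bullet> K' y)" using orth[OF \<Phi>] by simp
      also have "\<dots> = (LINT y|lborel. (\<Sum>i\<in>UNIV. g y $ i * K' y $ i))" by (simp add: inner_vec_def)
      also have "\<dots> = (\<Sum>i\<in>UNIV. LINT y|lborel. g y $ i * K' y $ i)"
        by (intro Bochner_Integration.integral_sum loc_integrable_mult_continuous[OF lg K'ic])
           (use \<open>\<forall>y. norm y \<ge> R + S \<longrightarrow> \<Phi> y = 0 \<and> K' y = 0\<close> in auto)
      also have "\<dots> = (\<Sum>i\<in>UNIV. LINT x|lborel. convolve (\<lambda>y. g y $ i) \<eta> x * K x $ i)"
      proof (rule sum.cong[OF refl])
        fix i
        show "(LINT y|lborel. g y $ i * K' y $ i) = (LINT x|lborel. convolve (\<lambda>y. g y $ i) \<eta> x * K x $ i)"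
          unfolding K'_def vec_lambda_beta conv[OF Kc]
          by (rule integral_convolve_swap[OF lg \<eta>c(1) \<eta>z Kc Kz])
      qed
      also have "\<dots> = (LINT x|lborel. (\<Sum>i\<in>UNIV. convolve (\<lambda>y. g y $ i) \<eta> x * K x $ i))"
        by (intro Bochner_Integration.integral_sum[symmetric] integrable_compact_support[of _ S] continuous_intros Gc Kc)
           (use S in auto)
      also have "\<dots> = (LINT x|lborel. G x \<bullet> K x)" by (simp add: inner_vec_def G_def)
      finally show ?thesis by simp
    qed
    have "G 0 = 0" by (rule weakly_harmonic_L6_gradient_0[OF W W6 Wo])
    then have "G 0 $ i = 0" by simp
    then show ?thesis by (simp add: G_def convolve_def \<eta>_def)
  qed
  have "AE x in lborel. g x $ i = 0" for i
  proof (rule du_Bois_Reymond[OF lg])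
    show "(LINT x|lborel. g x $ i * box_bump n l u x) = 0" for n l u
      using key[where n = n and l = "- u" and u = "- l" and i = i] unfolding box_bump_reflect by simp
  qed
  then have "AE x in lborel. \<forall>i. g x $ i = 0" by (simp add: AE_all_countable)
  then show ?thesis by (rule eventually_mono) (simp add: vec_eq_iff)
qed

text \<open>The residual of the projection onto the closure is orthogonal to every compactly
  supported function, so its weak gradient vanishes, and the norm sees only the gradient.\<close>

lemma closure_hom_compact: "closure hom_compact = UNIV"
proof -
  have M: "subspace (closure hom_compact)" "complete (closure hom_compact)"
    by (intro subspace_closure subspace_hom_compact complete_closure_hom_compact)+
  have "w \<in> closure hom_compact" for w
  proof -
    obtain p where p: "p \<in> closure hom_compact" "w - p \<in> orthogonal_comp (closure hom_compact)"
      using projection_exists[OF M, of w] by blast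
    obtain v g where v: "has_grad v g" "w - p = abs_hom_sobolev v" by (rule hom_sobolev_cases)
    have "(LINT x|lborel. g x \<bullet> K x) = 0" if "C1c_fun \<phi> K" for \<phi> K
    proof -
      have "abs_hom_sobolev \<phi> \<in> closure hom_compact"
        using that closure_subset[of hom_compact] by (auto simp: hom_compact_def)
      then have "(w - p) \<bullet> abs_hom_sobolev \<phi> = 0" using p(2) by (simp add: mem_orthogonal_comp)
      then show ?thesis using inner_abs_hom_sobolev[OF v(1) C1c_fun_has_grad[OF that]] v(2) by simp
    qed
    then have "AE x in lborel. g x = 0" by (rule weakly_harmonic_gradient_0[OF v(1)])
    then have "AE x in lborel. (norm (g x))\<^sup>2 = 0" by (rule eventually_mono) simp
    then have "(LINT x|lborel. (norm (g x))\<^sup>2) = 0"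
      by (rule integral_eq_zero_AE)
    then have "w - p = 0" using norm_abs_hom_sobolev[OF v(1)] v(2) by simp
    then show ?thesis using p(1) by simp
  qed
  then show ?thesis by auto
qed

instance hom_sobolev :: complete_space
proof
  fix X :: "nat \<Rightarrow> hom_sobolev" assume "Cauchy X"
  then show "convergent X"
    using complete_closure_hom_compact unfolding closure_hom_compact complete_def convergent_def by blast
qed

text \<open>By density every class has a representative that is a limit of compactly supported
  functions and inherits their bound; any other representative agrees with it almost
  everywhere.\<close>

lemma Sobolev_inequality:
  assumes "has_grad v g"
  shows "(LINT x|lborel. \<bar>v x\<bar> ^ 6) \<le> 64 * 4096 * norm (abs_hom_sobolev v) ^ 6"
proof -
  obtain v' g' where v': "has_grad v' g'" "abs_hom_sobolev v = abs_hom_sobolev v'"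
    "(LINT x|lborel. \<bar>v' x\<bar> ^ 6) \<le> 64 * 4096 * norm (abs_hom_sobolev v) ^ 6"
    using closure_hom_compact_Sobolev[of "abs_hom_sobolev v"] unfolding closure_hom_compact by blast
  have [measurable]: "v \<in> borel_measurable lborel" "v' \<in> borel_measurable lborel"
    using assms v'(1) by (simp_all add: has_grad_def L6_fun_def)
  have "AE x in lborel. v x = v' x"
    by (rule abs_hom_sobolev_eqD[OF has_grad_sobolev[OF assms] has_grad_sobolev[OF v'(1)] v'(2)])
  then have "(LINT x|lborel. \<bar>v x\<bar> ^ 6) = (LINT x|lborel. \<bar>v' x\<bar> ^ 6)"
    by (intro integral_cong_AE) (auto elim: eventually_mono)
  with v'(3) show ?thesis by simp
qed

section \<open>Functions vanishing on a set\<close>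

lemma vanishes_on_abs:
  "sobolev_fun v \<Longrightarrow> vanishes_on (abs_hom_sobolev v) A \<longleftrightarrow> (AE x in lborel. x \<in> A \<longrightarrow> v x = 0)"
  by (simp add: vanishes_on.abs_eq)

lemma subspace_vanishes_on: "subspace {v. vanishes_on v A}"
  unfolding subspace_def mem_Collect_eq
proof (intro conjI allI ballI)
  show "vanishes_on 0 A" unfolding zero_hom_sobolev_def by (simp add: vanishes_on_abs sobolev_fun_zero)
  fix u assume u: "u \<in> {v. vanishes_on v A}"
  obtain f g where f: "has_grad f g" "u = abs_hom_sobolev f" by (rule hom_sobolev_cases)
  note sf = has_grad_sobolev[OF f(1)]
  have fA: "AE x in lborel. x \<in> A \<longrightarrow> f x = 0" using u by (simp add: f vanishes_on_abs sf)
  show "vanishes_on (c *\<^sub>R u) A" for c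
    using fA by (simp add: f abs_hom_sobolev_scaleR sf vanishes_on_abs sobolev_fun_cmul)
      (auto elim: eventually_mono)
  fix v assume v: "v \<in> {v. vanishes_on v A}"
  obtain f' g' where f': "has_grad f' g'" "v = abs_hom_sobolev f'" by (rule hom_sobolev_cases)
  note sf' = has_grad_sobolev[OF f'(1)]
  have fA': "AE x in lborel. x \<in> A \<longrightarrow> f' x = 0" using v by (simp add: f' vanishes_on_abs sf')
  have "AE x in lborel. x \<in> A \<longrightarrow> f x + f' x = 0" using fA fA' by eventually_elim simp
  then show "vanishes_on (u + v) A"
    by (simp add: f f' abs_hom_sobolev_add sf sf' vanishes_on_abs sobolev_fun_add)
qed

text \<open>Almost everywhere on \<open>A\<close> the limit \<open>f\<close> equals its difference
  from \<open>h n\<close>, so the Sobolev inequality bounds the integral of the sixth power over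
  \<open>A\<close> by the distance of the classes.\<close>

lemma closed_vanishes_on:
  assumes [measurable]: "A \<in> sets borel" shows "closed {v. vanishes_on v A}"
  unfolding closed_sequential_limits
proof (intro allI impI, elim conjE)
  fix u :: "nat \<Rightarrow> hom_sobolev" and v
  assume u: "\<forall>n. u n \<in> {v. vanishes_on v A}" and lim: "u \<longlonglongrightarrow> v"
  obtain f g where f: "has_grad f g" "v = abs_hom_sobolev f" by (rule hom_sobolev_cases)
  have "\<exists>h k. has_grad h k \<and> u n = abs_hom_sobolev h" for n using hom_sobolev_cases by blast
  then obtain h k where h: "\<And>n. has_grad (h n) (k n)" "\<And>n. u n = abs_hom_sobolev (h n)" by metis
  have [measurable]: "f \<in> borel_measurable lborel" and fi: "integrable lborel (\<lambda>x. \<bar>f x\<bar> ^ 6)"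
    using f(1) by (simp_all add: has_grad_def L6_fun_def)
  let ?I = "LINT x|lborel. indicator A x * \<bar>f x\<bar> ^ 6"
  have Ii: "integrable lborel (\<lambda>x. indicator A x * \<bar>f x\<bar> ^ 6)"
    by (rule Bochner_Integration.integrable_bound[OF fi]) (auto simp: indicator_def)
  have "?I \<le> 64 * 4096 * norm (v - u n) ^ 6" for n
  proof -
    note d = has_grad_diff[OF f(1) h(1)[of n]]
    have di: "integrable lborel (\<lambda>x. \<bar>f x - h n x\<bar> ^ 6)" using d by (simp add: has_grad_def L6_fun_def)
    have [measurable]: "h n \<in> borel_measurable lborel" using h(1)[of n] by (simp add: has_grad_def L6_fun_def)
    have "AE x in lborel. x \<in> A \<longrightarrow> h n x = 0"
      using u vanishes_on_abs[OF has_grad_sobolev[OF h(1)]] by (simp add: h(2))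
    then have "AE x in lborel. indicator A x * \<bar>f x\<bar> ^ 6 \<le> \<bar>f x - h n x\<bar> ^ 6"
      by eventually_elim (auto simp: indicator_def)
    then have "?I \<le> (LINT x|lborel. \<bar>f x - h n x\<bar> ^ 6)" by (rule integral_mono_AE[OF Ii di])
    also have "\<dots> \<le> 64 * 4096 * norm (abs_hom_sobolev (\<lambda>x. f x - h n x)) ^ 6"
      by (rule Sobolev_inequality[OF d])
    also have "abs_hom_sobolev (\<lambda>x. f x - h n x) = v - u n"
      by (simp add: f(2) h(2) abs_hom_sobolev_diff has_grad_sobolev[OF f(1)] has_grad_sobolev[OF h(1)])
    finally show ?thesis .
  qed
  moreover have "(\<lambda>n. 64 * 4096 * norm (v - u n) ^ 6) \<longlonglongrightarrow> 64 * 4096 * norm (v - v) ^ 6"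
    by (intro tendsto_intros lim)
  ultimately have "?I \<le> 64 * 4096 * norm (v - v) ^ 6" by (intro LIMSEQ_le_const) blast+
  then have "?I \<le> 0" by simp
  moreover have "?I \<ge> 0" by simp
  ultimately have "?I = 0" by linarith
  then have "AE x in lborel. indicator A x * \<bar>f x\<bar> ^ 6 = 0"
    using integral_nonneg_eq_0_iff_AE[OF Ii] by simp
  then have "AE x in lborel. x \<in> A \<longrightarrow> f x = 0" by (rule eventually_mono) (auto simp: indicator_def split: if_splits)
  then show "v \<in> {v. vanishes_on v A}" by (simp add: f(2) vanishes_on_abs has_grad_sobolev[OF f(1)])
qed

section \<open>Hardy and capacity estimates by dilation\<close>

text \<open>The antiderivative is \<open>- 2 / sqrt t\<close>. Uniformity in \<sigma> is what
  permits \<sigma> to tend to infinity in Hardy's inequality.\<close>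

lemma nn_integral_dilation_weight:
  assumes "\<sigma> \<ge> (1::real)"
  shows "(\<integral>\<^sup>+t. ennreal (1 / (t * sqrt t)) * indicator {1..\<sigma>} t \<partial>lborel) \<le> 2"
proof -
  have "(\<integral>\<^sup>+t. ennreal (1 / (t * sqrt t)) * indicator {1..\<sigma>} t \<partial>lborel) = ennreal (- 2 / sqrt \<sigma> - (- 2 / sqrt 1))"
  proof (rule nn_integral_FTC_Icc)
    show "((\<lambda>t. - 2 / sqrt t) has_real_derivative 1 / (t * sqrt t)) (at t)" if "t \<in> {1..\<sigma>}" for t
      using that by (auto intro!: derivative_eq_intros simp: field_simps)
  qed (use assms in auto)
  also have "\<dots> \<le> ennreal 2" using assms by (intro ennreal_leI) simp
  finally show ?thesis by simp
qed

text \<open>Writing \<open>w(\<sigma>x) - w(x)\<close> as an integral of \<open>x \<bullet> \<nabla>w(tx)\<close> over \<open>1 \<le> t \<le> \<sigma>\<close> and applying the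
  Cauchy--Schwarz inequality with the weight \<open>t\<^bsup>3/2\<^esup>\<close>, which is the scaling of \<open>L\<^sup>2\<close> norms in
  dimension three, gives a constant independent of \<open>\<sigma>\<close>.\<close>

lemma dilation_estimate:
  assumes w: "C1_fun w G" and "\<sigma> \<ge> 1" and [measurable]: "B \<in> sets borel" "U \<in> sets borel"
    and BU: "\<And>x t. x \<in> B \<Longrightarrow> 1 \<le> t \<Longrightarrow> t \<le> \<sigma> \<Longrightarrow> t *\<^sub>R x \<in> U"
  shows "(\<integral>\<^sup>+x. indicator B x * ennreal ((w (\<sigma> *\<^sub>R x) - w x)\<^sup>2 / (norm x)\<^sup>2) \<partial>lborel)
    \<le> 4 * (\<integral>\<^sup>+x. indicator U x * ennreal ((norm (G x))\<^sup>2) \<partial>lborel)"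
proof -
  let ?D = "\<lambda>x. ennreal ((w (\<sigma> *\<^sub>R x) - w x)\<^sup>2 / (norm x)\<^sup>2)"
  let ?g = "\<lambda>x t. ennreal (t * sqrt t) * indicator {1..\<sigma>} t * ennreal ((norm (G (t *\<^sub>R x)))\<^sup>2)"
  let ?p = "\<lambda>t. ennreal (1 / (t * sqrt t)) * indicator {1..\<sigma>} t"
  note wc = C1_fun_continuous[OF w]
  have [measurable]: "w \<in> borel_measurable borel" "G \<in> borel_measurable borel"
    using continuous_imp_borel wc by auto
  let ?N = "\<integral>\<^sup>+x. indicator U x * ennreal ((norm (G x))\<^sup>2) \<partial>lborel"
  have pw: "?D x
      \<le> 2 * (\<integral>\<^sup>+t. ?g x t \<partial>lborel)" for x
  proof (cases "x = 0")
    case False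
    have c: "continuous_on UNIV (\<lambda>t. G (t *\<^sub>R x) \<bullet> x)"
      by (intro continuous_intros continuous_on_compose2[OF wc(2)]) auto
    have FTC: "has_bochner_integral lborel (\<lambda>t. (G (t *\<^sub>R x) \<bullet> x) * indicator {1..\<sigma>} t) (w (\<sigma> *\<^sub>R x) - w (1 *\<^sub>R x))"
    proof (rule has_bochner_integral_FTC_Icc_real[OF \<open>\<sigma> \<ge> 1\<close>])
      show "((\<lambda>t. w (t *\<^sub>R x)) has_real_derivative G (t *\<^sub>R x) \<bullet> x) (at t)" for t
        using C1_fun_line[OF w, of 0 x t] by simp
      show "isCont (\<lambda>t. G (t *\<^sub>R x) \<bullet> x) t" for t using c by (simp add: continuous_on_eq_continuous_at)
    qed
    have "ennreal (\<bar>w (\<sigma> *\<^sub>R x) - w x\<bar>) \<le> (\<integral>\<^sup>+t. ennreal (norm ((G (t *\<^sub>R x) \<bullet> x) * indicator {1..\<sigma>} t)) \<partial>lborel)"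
      using integral_norm_bound_ennreal[of lborel "\<lambda>t. (G (t *\<^sub>R x) \<bullet> x) * indicator {1..\<sigma>} t"] FTC
      by (simp add: has_bochner_integral_iff)
    also have "\<dots> \<le> (\<integral>\<^sup>+t. ennreal (norm x) * (ennreal (norm (G (t *\<^sub>R x))) * indicator {1..\<sigma>} t) \<partial>lborel)"
    proof (intro nn_integral_mono)
      fix t
      have "\<bar>G (t *\<^sub>R x) \<bullet> x\<bar> \<le> norm x * norm (G (t *\<^sub>R x))"
        using Cauchy_Schwarz_ineq2[of "G (t *\<^sub>R x)" x] by (simp add: mult.commute)
      then show "ennreal (norm ((G (t *\<^sub>R x) \<bullet> x) * indicator {1..\<sigma>} t)) \<le> ennreal (norm x) * (ennreal (norm (G (t *\<^sub>R x))) * indicator {1..\<sigma>} t)"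
        by (auto simp: indicator_def ennreal_mult[symmetric] intro: ennreal_leI)
    qed
    also have "\<dots> = ennreal (norm x) * (\<integral>\<^sup>+t. ennreal (norm (G (t *\<^sub>R x))) * indicator {1..\<sigma>} t \<partial>lborel)" (is "_ = _ * ?H")
      by (rule nn_integral_cmult) measurable
    finally have 1: "ennreal (\<bar>w (\<sigma> *\<^sub>R x) - w x\<bar>) \<le> ennreal (norm x) * ?H" .
    have "?D x = (ennreal (1 / norm x) * ennreal (\<bar>w (\<sigma> *\<^sub>R x) - w x\<bar>))\<^sup>2"
      by (simp add: ennreal_mult[symmetric] ennreal_power power_divide)
    also have "\<dots> \<le> (ennreal (1 / norm x) * (ennreal (norm x) * ?H))\<^sup>2"
      by (intro power_mono mult_left_mono 1) auto
    also have "ennreal (1 / norm x) * (ennreal (norm x) * ?H) = ?H"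
      using False by (simp add: mult.assoc[symmetric] ennreal_mult[symmetric])
    also have "?H\<^sup>2 \<le> (\<integral>\<^sup>+t. ?p t \<partial>lborel)
        * (\<integral>\<^sup>+t. ?g x t \<partial>lborel)"
    proof (rule nn_integral_Cauchy_Schwarz)
      fix t
      show "(ennreal (norm (G (t *\<^sub>R x))) * indicator {1..\<sigma>} t)\<^sup>2
          \<le> ?p t * (?g x t)"
      proof (cases "t \<in> {1..\<sigma>}")
        case True
        then have "ennreal (1 / (t * sqrt t)) * ennreal (t * sqrt t) = 1"
          by (simp add: ennreal_mult[symmetric] del: ennreal_1 flip: ennreal_1)
        then have "ennreal (1 / (t * sqrt t)) * (ennreal (t * sqrt t) * ennreal ((norm (G (t *\<^sub>R x)))\<^sup>2)) = ennreal ((norm (G (t *\<^sub>R x)))\<^sup>2)"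
          by (simp add: mult.assoc[symmetric])
        then show ?thesis using True by (simp add: ennreal_power)
      qed simp
    qed measurable
    also have "\<dots> \<le> 2 * (\<integral>\<^sup>+t. ?g x t \<partial>lborel)"
      by (intro mult_right_mono nn_integral_dilation_weight \<open>\<sigma> \<ge> 1\<close>) simp
    finally show ?thesis .
  qed simp
  have "(\<integral>\<^sup>+x. indicator B x * ?D x \<partial>lborel)
      \<le> (\<integral>\<^sup>+x. \<integral>\<^sup>+t. 2 * (indicator B x * (?g x t)) \<partial>lborel \<partial>lborel)"
  proof (intro nn_integral_mono)
    fix x
    have "indicator B x * ?D x
      \<le> indicator B x * (2 * (\<integral>\<^sup>+t. ?g x t \<partial>lborel))"
      by (intro mult_left_mono pw) simp
    also have "\<dots> = (2 * indicator B x) * (\<integral>\<^sup>+t. ?g x t \<partial>lborel)"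
      by (simp add: mult_ac)
    also have "\<dots> = (\<integral>\<^sup>+t. (2 * indicator B x) * (?g x t) \<partial>lborel)"
      by (rule nn_integral_cmult[symmetric]) measurable
    finally show "indicator B x * ?D x
      \<le> (\<integral>\<^sup>+t. 2 * (indicator B x * (?g x t)) \<partial>lborel)"
      by (simp add: mult.assoc)
  qed
  also have "\<dots> = (\<integral>\<^sup>+t. \<integral>\<^sup>+x. 2 * (indicator B x * (?g x t)) \<partial>lborel \<partial>lborel)"
    by (rule lborel_pair.Fubini'[symmetric]) measurable
  also have "\<dots> \<le> (\<integral>\<^sup>+t. (2 * ?N) * (?p t) \<partial>lborel)"
  proof (intro nn_integral_mono)
    fix t :: real
    show "(\<integral>\<^sup>+x. 2 * (indicator B x * (?g x t)) \<partial>lborel)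
        \<le> (2 * ?N) * (?p t)"
    proof (cases "t \<in> {1..\<sigma>}")
      case True
      then have t: "t > 0" "1 \<le> t" "t \<le> \<sigma>" by auto
      \<comment> \<open>The change of variables divides by \<open>t ^ 3\<close> and so replaces the
        growing weight \<open>t * sqrt t\<close> by \<open>1 / (t * sqrt t)\<close>. Integrating
        that weight once more gives the second factor 2.\<close>
      have N: "?N = ennreal (t ^ 3) * (\<integral>\<^sup>+x. indicator U (t *\<^sub>R x) * ennreal ((norm (G (t *\<^sub>R x)))\<^sup>2) \<partial>lborel)"
        using nn_integral_lborel_affine[of "\<lambda>x. indicator U x * ennreal ((norm (G x))\<^sup>2)" t 0] t by simp
      have "(\<integral>\<^sup>+x. 2 * (indicator B x * (?g x t)) \<partial>lborel)
        \<le> (\<integral>\<^sup>+x. (2 * ennreal (t * sqrt t)) * (indicator U (t *\<^sub>R x) * ennreal ((norm (G (t *\<^sub>R x)))\<^sup>2)) \<partial>lborel)"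
        using True BU[OF _ t(2,3)] by (intro nn_integral_mono) (auto simp: indicator_def mult_ac)
      also have "\<dots> = (2 * ennreal (t * sqrt t)) * (\<integral>\<^sup>+x. indicator U (t *\<^sub>R x) * ennreal ((norm (G (t *\<^sub>R x)))\<^sup>2) \<partial>lborel)"
        by (rule nn_integral_cmult) measurable
      also have "\<dots> = (2 * ?N) * ennreal (1 / (t * sqrt t))"
      proof -
        have "t * sqrt t * (t * sqrt t) = t ^ 3" using t by (simp add: power3_eq_cube)
        then have "t * sqrt t = 1 / (t * sqrt t) * t ^ 3" using t by (simp add: field_simps)
        then have "ennreal (t * sqrt t) = ennreal (1 / (t * sqrt t) * t ^ 3)" by (rule arg_cong)
        also have "\<dots> = ennreal (1 / (t * sqrt t)) * ennreal (t ^ 3)" using t by (intro ennreal_mult) auto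
        finally have e: "ennreal (t * sqrt t) = ennreal (1 / (t * sqrt t)) * ennreal (t ^ 3)" .
        show ?thesis unfolding e N by (simp only: mult_ac)
      qed
      finally show ?thesis using True by simp
    qed simp
  qed
  also have "\<dots> = (2 * ?N) * (\<integral>\<^sup>+t. ?p t \<partial>lborel)"
    by (rule nn_integral_cmult) measurable
  also have "\<dots> \<le> (2 * ?N) * 2" by (intro mult_left_mono nn_integral_dilation_weight \<open>\<sigma> \<ge> 1\<close>) simp
  finally show ?thesis by (simp add: mult_ac)
qed

text \<open>For large \<sigma> the dilated term \<open>w (\<sigma> *\<^sub>R x)\<close> vanishes at
  each nonzero \<open>x\<close>, while the dilation estimate is uniform in \<sigma>; Fatou's lemma
  concludes.\<close>

lemma Hardy_inequality:
  assumes w: "C1c_fun w G"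
  shows "(\<integral>\<^sup>+x. ennreal ((w x)\<^sup>2 / (norm x)\<^sup>2) \<partial>lborel) \<le> 4 * (\<integral>\<^sup>+x. ennreal ((norm (G x))\<^sup>2) \<partial>lborel)"
proof (rule Fatou_bound)
  note wc = C1c_fun_continuous[OF w]
  have [measurable]: "w \<in> borel_measurable borel" using continuous_imp_borel wc by auto
  obtain R where R: "\<And>x. norm x \<ge> R \<Longrightarrow> w x = 0" using w by (auto simp: C1c_fun_def)
  show "(\<lambda>x. ennreal ((w (real (Suc n) *\<^sub>R x) - w x)\<^sup>2 / (norm x)\<^sup>2)) \<in> borel_measurable lborel" for n
    by measurable
  show "AE x in lborel. (\<lambda>n. ennreal ((w (real (Suc n) *\<^sub>R x) - w x)\<^sup>2 / (norm x)\<^sup>2)) \<longlonglongrightarrow> ennreal ((w x)\<^sup>2 / (norm x)\<^sup>2)"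
  proof (rule AE_I2)
    fix x :: "real^3"
    show "(\<lambda>n. ennreal ((w (real (Suc n) *\<^sub>R x) - w x)\<^sup>2 / (norm x)\<^sup>2)) \<longlonglongrightarrow> ennreal ((w x)\<^sup>2 / (norm x)\<^sup>2)"
    \<comment> \<open>At the origin both quotients are 0 by the convention for division by
      zero.\<close>
    proof (cases "x = 0")
      case False
      obtain n0 where n0: "real n0 > R / norm x" using reals_Archimedean2 by blast
      have "w (real (Suc n) *\<^sub>R x) = 0" if "n \<ge> n0" for n
      proof (rule R)
        have "R / norm x \<le> real (Suc n)" using n0 that by simp
        then show "norm (real (Suc n) *\<^sub>R x) \<ge> R" using False by (simp add: divide_le_eq)
      qed
      then show ?thesis by (intro tendsto_eventually eventually_sequentiallyI[of n0]) simp
    qed simp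
  qed
  show "\<forall>\<^sub>F n in sequentially. (\<integral>\<^sup>+x. ennreal ((w (real (Suc n) *\<^sub>R x) - w x)\<^sup>2 / (norm x)\<^sup>2) \<partial>lborel)
      \<le> 4 * (\<integral>\<^sup>+x. ennreal ((norm (G x))\<^sup>2) \<partial>lborel)"
    using dilation_estimate[OF C1c_fun_C1[OF w], of "real (Suc _)" UNIV UNIV] by (intro always_eventually allI) simp
qed

lemma C1_fun_shift:
  assumes "C1_fun w G" shows "C1_fun (\<lambda>x. w (a + x)) (\<lambda>x. G (a + x))"
  unfolding C1_fun_def
proof (intro conjI allI)
  fix x
  have "((\<lambda>x. a + x) has_derivative (\<lambda>h. h)) (at x)" by (auto intro!: derivative_eq_intros)
  moreover have "(w has_derivative (\<lambda>h. G (a + x) \<bullet> h)) (at (a + x))" using assms by (simp add: C1_fun_def)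
  ultimately show "((\<lambda>x. w (a + x)) has_derivative (\<lambda>h. G (a + x) \<bullet> h)) (at x)"
    by (rule has_derivative_compose)
  show "continuous_on UNIV (\<lambda>x. G (a + x))"
    by (intro continuous_on_compose2[OF C1_fun_continuous(2)[OF assms]] continuous_intros) auto
qed

lemma nn_integral_ball_shift:
  fixes f :: "real^3 \<Rightarrow> ennreal"
  assumes [measurable]: "f \<in> borel_measurable borel"
  shows "(\<integral>\<^sup>+x. indicator (ball a s) x * f x \<partial>lborel) = (\<integral>\<^sup>+x. indicator (ball 0 s) x * f (a + x) \<partial>lborel)"
  by (subst nn_integral_lborel_affine[of "\<lambda>x. indicator (ball a s) x * f x" 1 a])
     (auto simp: indicator_def dist_norm intro!: nn_integral_cong)

lemma nn_integral_linear_combination: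
  assumes [measurable]: "f \<in> borel_measurable M" "g \<in> borel_measurable M"
  shows "(\<integral>\<^sup>+x. a * f x + b * g x \<partial>M) = a * (\<integral>\<^sup>+x. f x \<partial>M) + b * (\<integral>\<^sup>+x. g x \<partial>M)"
  by (simp add: nn_integral_add nn_integral_cmult)

text \<open>The gradient term gains the factor \<open>s\<^sup>2\<close>, the mass term the volume
  ratio \<open>(s / \<rho>) ^ 3\<close>. Multiplied by a squared cutoff gradient of order
  \<open>1 / s\<^sup>2\<close>, the latter becomes a multiple of \<open>s / \<rho> ^ 3\<close>, the
  quantity that the capacity density controls.\<close>

lemma L2_ball_estimate:
  assumes w: "C1_fun w G" and s: "0 < s" "s \<le> \<rho>"
  shows "(\<integral>\<^sup>+x. indicator (ball a s) x * ennreal ((w x)\<^sup>2) \<partial>lborel)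
    \<le> (\<integral>\<^sup>+x. indicator (ball a \<rho>) x * ennreal (8 * s\<^sup>2 * (norm (G x))\<^sup>2 + 2 * (s / \<rho>) ^ 3 * (w x)\<^sup>2) \<partial>lborel)"
proof -
  let ?D = "\<lambda>f \<sigma> x. ennreal ((f (\<sigma> *\<^sub>R x) - f x)\<^sup>2 / (norm x)\<^sup>2)"
  let ?B = "\<lambda>K v x. 8 * s\<^sup>2 * (norm (K x))\<^sup>2 + 2 * (s / \<rho>) ^ 3 * (v x)\<^sup>2"
  note wc = C1_fun_continuous[OF w]
  have [measurable]: "w \<in> borel_measurable borel" "G \<in> borel_measurable borel"
    using continuous_imp_borel wc by auto
  have [measurable]: "ball c t \<in> sets borel" for c :: "real^3" and t by simp
  define v where "v x = w (a + x)" for x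
  define K where "K x = G (a + x)" for x
  have [measurable]: "v \<in> borel_measurable borel" "K \<in> borel_measurable borel"
    unfolding v_def[abs_def] K_def[abs_def] by measurable
  have v: "C1_fun v K" unfolding v_def[abs_def] K_def[abs_def] by (rule C1_fun_shift[OF w])
  define \<sigma> where "\<sigma> = \<rho> / s"
  have \<sigma>: "\<sigma> \<ge> 1" "\<sigma> > 0" using s by (simp_all add: \<sigma>_def)
  have "(\<integral>\<^sup>+x. indicator (ball 0 s) x * ennreal ((v x)\<^sup>2) \<partial>lborel)
     \<le> (\<integral>\<^sup>+x. ennreal (2 * s\<^sup>2) * (indicator (ball 0 s) x * ?D v \<sigma> x)
          + 2 * (indicator (ball 0 \<rho>) (\<sigma> *\<^sub>R x) * ennreal ((v (\<sigma> *\<^sub>R x))\<^sup>2)) \<partial>lborel)"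
  proof (intro nn_integral_mono)
    fix x :: "real^3"
    show "indicator (ball 0 s) x * ennreal ((v x)\<^sup>2)
      \<le> ennreal (2 * s\<^sup>2) * (indicator (ball 0 s) x * ?D v \<sigma> x)
          + 2 * (indicator (ball 0 \<rho>) (\<sigma> *\<^sub>R x) * ennreal ((v (\<sigma> *\<^sub>R x))\<^sup>2))"
    proof (cases "norm x < s")
      case True
      let ?d = "v (\<sigma> *\<^sub>R x) - v x"
      have "\<sigma> * norm x < \<rho>" using True \<sigma> s by (simp add: \<sigma>_def field_simps)
      then have in\<rho>: "\<sigma> *\<^sub>R x \<in> ball 0 \<rho>" using \<sigma> by simp
      have "(v x)\<^sup>2 \<le> 2 * ?d\<^sup>2 + 2 * (v (\<sigma> *\<^sub>R x))\<^sup>2"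
        using zero_le_power2[of "?d + v (\<sigma> *\<^sub>R x)"] by (simp add: power2_eq_square algebra_simps)
      moreover have "?d\<^sup>2 \<le> s\<^sup>2 * (?d\<^sup>2 / (norm x)\<^sup>2)"
      proof (cases "x = 0")
        case False
        then have "(norm x)\<^sup>2 \<le> s\<^sup>2" using True by (intro power_mono) auto
        then have "?d\<^sup>2 * (norm x)\<^sup>2 \<le> ?d\<^sup>2 * s\<^sup>2" by (intro mult_left_mono) auto
        then show ?thesis using False by (simp add: field_simps)
      qed simp
      ultimately have "(v x)\<^sup>2 \<le> 2 * s\<^sup>2 * (?d\<^sup>2 / (norm x)\<^sup>2) + 2 * (v (\<sigma> *\<^sub>R x))\<^sup>2" by linarith
      then have "ennreal ((v x)\<^sup>2) \<le> ennreal (2 * s\<^sup>2 * (?d\<^sup>2 / (norm x)\<^sup>2) + 2 * (v (\<sigma> *\<^sub>R x))\<^sup>2)"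
        by (rule ennreal_leI)
      also have "\<dots> = ennreal (2 * s\<^sup>2) * ennreal (?d\<^sup>2 / (norm x)\<^sup>2) + 2 * ennreal ((v (\<sigma> *\<^sub>R x))\<^sup>2)"
      proof -
        have "ennreal (2 * s\<^sup>2 * (?d\<^sup>2 / (norm x)\<^sup>2) + 2 * (v (\<sigma> *\<^sub>R x))\<^sup>2)
          = ennreal (2 * s\<^sup>2 * (?d\<^sup>2 / (norm x)\<^sup>2)) + ennreal (2 * (v (\<sigma> *\<^sub>R x))\<^sup>2)"
          by (rule ennreal_plus) auto
        moreover have "ennreal (2 * s\<^sup>2 * (?d\<^sup>2 / (norm x)\<^sup>2)) = ennreal (2 * s\<^sup>2) * ennreal (?d\<^sup>2 / (norm x)\<^sup>2)"
          by (rule ennreal_mult) auto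
        moreover have "ennreal (2 * (v (\<sigma> *\<^sub>R x))\<^sup>2) = 2 * ennreal ((v (\<sigma> *\<^sub>R x))\<^sup>2)"
          by (simp add: ennreal_mult)
        ultimately show ?thesis by (simp only:)
      qed
      finally show ?thesis using True in\<rho> by simp
    qed simp
  qed
  also have "\<dots> = ennreal (2 * s\<^sup>2) * (\<integral>\<^sup>+x. indicator (ball 0 s) x * ?D v \<sigma> x \<partial>lborel)
          + 2 * (\<integral>\<^sup>+x. indicator (ball 0 \<rho>) (\<sigma> *\<^sub>R x) * ennreal ((v (\<sigma> *\<^sub>R x))\<^sup>2) \<partial>lborel)"
    by (rule nn_integral_linear_combination) measurable
  also have "\<dots> \<le> ennreal (2 * s\<^sup>2) * (4 * (\<integral>\<^sup>+x. indicator (ball 0 \<rho>) x * ennreal ((norm (K x))\<^sup>2) \<partial>lborel))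
          + 2 * (ennreal ((s / \<rho>) ^ 3) * (\<integral>\<^sup>+x. indicator (ball 0 \<rho>) x * ennreal ((v x)\<^sup>2) \<partial>lborel))"
  proof (intro add_mono mult_left_mono)
    show "(\<integral>\<^sup>+x. indicator (ball 0 s) x * ?D v \<sigma> x \<partial>lborel)
        \<le> 4 * (\<integral>\<^sup>+x. indicator (ball 0 \<rho>) x * ennreal ((norm (K x))\<^sup>2) \<partial>lborel)"
    proof (rule dilation_estimate[OF v \<sigma>(1)])
      fix x :: "real^3" and t :: real assume x: "x \<in> ball 0 s" "1 \<le> t" "t \<le> \<sigma>"
      have "t * norm x \<le> \<sigma> * norm x" using x by (intro mult_right_mono) auto
      also have "\<dots> < \<rho>" using x \<sigma> s by (simp add: \<sigma>_def field_simps)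
      finally show "t *\<^sub>R x \<in> ball 0 \<rho>" using x by simp
    qed simp_all
    have "ennreal ((s / \<rho>) ^ 3) * ennreal (\<sigma> ^ 3) = 1"
      using s by (simp add: \<sigma>_def ennreal_mult[symmetric] power_mult_distrib[symmetric])
    then show "(\<integral>\<^sup>+x. indicator (ball 0 \<rho>) (\<sigma> *\<^sub>R x) * ennreal ((v (\<sigma> *\<^sub>R x))\<^sup>2) \<partial>lborel)
        \<le> ennreal ((s / \<rho>) ^ 3) * (\<integral>\<^sup>+x. indicator (ball 0 \<rho>) x * ennreal ((v x)\<^sup>2) \<partial>lborel)"
      using nn_integral_lborel_affine[of "\<lambda>x. indicator (ball 0 \<rho>) x * ennreal ((v x)\<^sup>2)" \<sigma> 0] \<sigma>
      by (simp add: mult.assoc[symmetric])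
  qed simp_all
  also have "\<dots> = (\<integral>\<^sup>+x. ennreal (8 * s\<^sup>2) * (indicator (ball 0 \<rho>) x * ennreal ((norm (K x))\<^sup>2))
      + ennreal (2 * (s / \<rho>) ^ 3) * (indicator (ball 0 \<rho>) x * ennreal ((v x)\<^sup>2)) \<partial>lborel)"
  proof -
    have "ennreal (2 * s\<^sup>2) * 4 = ennreal (8 * s\<^sup>2)" "2 * ennreal ((s / \<rho>) ^ 3) = ennreal (2 * (s / \<rho>) ^ 3)"
    proof -
      have "ennreal (8 * s\<^sup>2) = ennreal (2 * s\<^sup>2 * 4)" by (simp add: mult.commute)
      also have "\<dots> = ennreal (2 * s\<^sup>2) * 4" by (subst ennreal_mult) auto
      finally show "ennreal (2 * s\<^sup>2) * 4 = ennreal (8 * s\<^sup>2)" ..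
      show "2 * ennreal ((s / \<rho>) ^ 3) = ennreal (2 * (s / \<rho>) ^ 3)"
        using s by (subst ennreal_mult) auto
    qed
    then show ?thesis
      by (subst nn_integral_linear_combination) (measurable, simp only: mult.assoc[symmetric])
  qed
  also have "\<dots> = (\<integral>\<^sup>+x. indicator (ball 0 \<rho>) x * ennreal (?B K v x) \<partial>lborel)"
  proof (rule nn_integral_cong)
    fix x :: "real^3"
    have "ennreal (?B K v x)
      = ennreal (8 * s\<^sup>2) * ennreal ((norm (K x))\<^sup>2) + ennreal (2 * (s / \<rho>) ^ 3) * ennreal ((v x)\<^sup>2)"
      using s by (subst ennreal_plus) (auto simp: ennreal_mult)
    then show "ennreal (8 * s\<^sup>2) * (indicator (ball 0 \<rho>) x * ennreal ((norm (K x))\<^sup>2))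
      + ennreal (2 * (s / \<rho>) ^ 3) * (indicator (ball 0 \<rho>) x * ennreal ((v x)\<^sup>2))
      = indicator (ball 0 \<rho>) x * ennreal (?B K v x)"
      by (simp add: indicator_def)
  qed
  finally show ?thesis unfolding v_def K_def
    by (subst (1 2) nn_integral_ball_shift) simp_all
qed

section \<open>The form bound and the theorem\<close>

text \<open>Adding to \<open>w\<close> an element that vanishes on the ball does not change
  \<open>Q_proj a r w\<close>, because the projection annihilates such elements. Hence its norm is
  at most that of every extension of \<open>w\<close> from the ball.\<close>

lemma Q_proj_props:
  shows norm_Q_proj_le: "norm (Q_proj a r w) \<le> norm w"
    and bounded_linear_Q_proj: "bounded_linear (Q_proj a r)"
    and norm_Q_proj_le_extension: "vanishes_on (w' - w) (cball a r) \<Longrightarrow> norm (Q_proj a r w) \<le> norm w'"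
proof -
  let ?W = "{v. vanishes_on v (cball a r)}"
  have P: "subspace (orthogonal_comp ?W)" "complete (orthogonal_comp ?W)"
    by (auto simp: subspace_orthogonal_comp closed_orthogonal_comp complete_eq_closed)
  show "norm (Q_proj a r w) \<le> norm w" unfolding Q_proj_def by (rule norm_orth_proj_le[OF P])
  show "bounded_linear (Q_proj a r)" unfolding Q_proj_def by (rule bounded_linear_orth_proj[OF P])
  assume "vanishes_on (w' - w) (cball a r)"
  then have "w' - w \<in> ?W" by simp
  then have "y \<bullet> (w' - w) = 0" if "y \<in> orthogonal_comp ?W" for y
    using that by (simp only: mem_orthogonal_comp)
  then have "w' - w \<in> orthogonal_comp (orthogonal_comp ?W)"
    by (simp only: mem_orthogonal_comp[of "w' - w"] inner_commute[of "w' - w"]) blast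
  then have "(w' - w) - 0 \<in> orthogonal_comp (orthogonal_comp ?W)" by (simp only: diff_zero)
  then have "orth_proj (orthogonal_comp ?W) (w' - w) = 0"
    by (rule orth_proj_eqI[OF P(1) subspace_0[OF P(1)]])
  then have "orth_proj (orthogonal_comp ?W) w' = orth_proj (orthogonal_comp ?W) w"
    using orth_proj_add[OF P, of "w' - w" w] by simp
  then show "norm (Q_proj a r w) \<le> norm w'"
    unfolding Q_proj_def using norm_orth_proj_le[OF P, of w'] by simp
qed

text \<open>The square of the product of the cutoff's gradient bound
  \<open>8 * \<kappa> / ((\<kappa>\<^sup>2 - 1) * r)\<close> and its outer radius
  \<open>\<kappa> * r\<close>; the radius \<open>r\<close> cancels.\<close>

definition cutoff_const :: "real \<Rightarrow> real" where
  "cutoff_const \<kappa> = 64 * \<kappa> ^ 4 / (\<kappa>\<^sup>2 - 1)\<^sup>2"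

lemma Q_proj_local_bound:
  assumes w: "C1c_fun w G" and r: "r > 0" and \<kappa>: "\<kappa> > 1" and \<rho>: "\<kappa> * r \<le> \<rho>"
  shows "ennreal ((norm (Q_proj a r (abs_hom_sobolev w)))\<^sup>2)
    \<le> (\<integral>\<^sup>+x. indicator (ball a \<rho>) x * ennreal ((2 + 16 * cutoff_const \<kappa>) * (norm (G x))\<^sup>2
          + 4 * cutoff_const \<kappa> * \<kappa> * (r / \<rho> ^ 3) * (w x)\<^sup>2) \<partial>lborel)"
proof -
  note wc = C1c_fun_continuous[OF w]
  have [measurable]: "w \<in> borel_measurable borel" "G \<in> borel_measurable borel"
    using continuous_imp_borel wc by auto
  have [measurable]: "ball c t \<in> sets borel" for c :: "real^3" and t by simp
  define s where "s = \<kappa> * r"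
  have s: "0 < s" "s \<le> \<rho>" using r \<kappa> \<rho> by (simp_all add: s_def)
  have k1: "\<kappa>\<^sup>2 - 1 > 0" using \<kappa> by (simp add: one_less_power)
  define L where "L = 8 * \<kappa> / ((\<kappa>\<^sup>2 - 1) * r)"
  define \<Lambda> where "\<Lambda> = cutoff_const \<kappa>"
  have \<Lambda>0: "\<Lambda> \<ge> 0" by (simp add: \<Lambda>_def cutoff_const_def)
  have L\<Lambda>: "L\<^sup>2 * s\<^sup>2 = \<Lambda>"
    using r k1 by (simp add: L_def s_def \<Lambda>_def cutoff_const_def power_divide power_mult_distrib eval_nat_numeral)
  obtain \<theta> H where \<theta>: "C1c_fun \<theta> H" "\<And>x. 0 \<le> \<theta> x" "\<And>x. \<theta> x \<le> 1"
    "\<And>x. norm (x - a) \<le> r \<Longrightarrow> \<theta> x = 1 \<and> H x = 0"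
    "\<And>x. norm (x - a) \<ge> \<kappa> * r \<Longrightarrow> \<theta> x = 0 \<and> H x = 0" "\<And>x. norm (H x) \<le> L"
    unfolding L_def using cutoff_function[OF r \<kappa>, of a] by blast
  let ?w = "\<lambda>x. \<theta> x * w x" and ?G = "\<lambda>x. \<theta> x *\<^sub>R G x + w x *\<^sub>R H x"
  have C: "C1c_fun ?w ?G" by (rule C1c_fun_mult[OF C1c_fun_C1[OF \<theta>(1)] w])
  note hw = C1c_fun_has_grad[OF w] and hC = C1c_fun_has_grad[OF C]
  have "vanishes_on (abs_hom_sobolev ?w - abs_hom_sobolev w) (cball a r)"
  proof -
    have "AE x in lborel. x \<in> cball a r \<longrightarrow> ?w x - w x = 0"
      using \<theta>(4) by (intro AE_I2) (simp add: dist_norm norm_minus_commute)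
    then show ?thesis
      by (simp add: abs_hom_sobolev_diff has_grad_sobolev[OF hC] has_grad_sobolev[OF hw]
          vanishes_on_abs has_grad_sobolev[OF has_grad_diff[OF hC hw]])
  qed
  then have "norm (Q_proj a r (abs_hom_sobolev w)) \<le> norm (abs_hom_sobolev ?w)"
    by (rule norm_Q_proj_le_extension)
  then have "(norm (Q_proj a r (abs_hom_sobolev w)))\<^sup>2 \<le> (norm (abs_hom_sobolev ?w))\<^sup>2"
    by (intro power_mono) auto
  also have "\<dots> = (LINT x|lborel. (norm (?G x))\<^sup>2)" by (rule norm_abs_hom_sobolev[OF hC])
  finally have "ennreal ((norm (Q_proj a r (abs_hom_sobolev w)))\<^sup>2) \<le> ennreal (LINT x|lborel. (norm (?G x))\<^sup>2)"
    by (rule ennreal_leI)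
  also have "\<dots> = (\<integral>\<^sup>+x. ennreal ((norm (?G x))\<^sup>2) \<partial>lborel)"
    using C1c_fun_sobolev(2)[OF C] by (subst nn_integral_eq_integral) (auto simp: L2_field_def)
  also have "\<dots> \<le> (\<integral>\<^sup>+x. 2 * (indicator (ball a \<rho>) x * ennreal ((norm (G x))\<^sup>2))
      + ennreal (2 * L\<^sup>2) * (indicator (ball a s) x * ennreal ((w x)\<^sup>2)) \<partial>lborel)"
  proof (intro nn_integral_mono)
    fix x
    show "ennreal ((norm (?G x))\<^sup>2) \<le> 2 * (indicator (ball a \<rho>) x * ennreal ((norm (G x))\<^sup>2))
      + ennreal (2 * L\<^sup>2) * (indicator (ball a s) x * ennreal ((w x)\<^sup>2))"
    proof (cases "x \<in> ball a s")
      case True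
      then have "x \<in> ball a \<rho>" using s by simp
      have "(norm (?G x))\<^sup>2 \<le> (norm (\<theta> x *\<^sub>R G x) + norm (w x *\<^sub>R H x))\<^sup>2"
        by (intro power_mono norm_triangle_ineq) simp
      also have "\<dots> \<le> 2 * (norm (\<theta> x *\<^sub>R G x))\<^sup>2 + 2 * (norm (w x *\<^sub>R H x))\<^sup>2"
        using zero_le_power2[of "norm (\<theta> x *\<^sub>R G x) - norm (w x *\<^sub>R H x)"]
        by (simp add: power2_sum power2_diff)
      also have "(norm (\<theta> x *\<^sub>R G x))\<^sup>2 \<le> (norm (G x))\<^sup>2"
        using \<theta>(2,3)[of x] by (intro power_mono) (auto intro: mult_left_le_one_le)
      also have "(norm (w x *\<^sub>R H x))\<^sup>2 \<le> (\<bar>w x\<bar> * L)\<^sup>2"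
        using \<theta>(6)[of x] by (intro power_mono) (auto intro: mult_left_mono)
      finally have "(norm (?G x))\<^sup>2 \<le> 2 * (norm (G x))\<^sup>2 + 2 * L\<^sup>2 * (w x)\<^sup>2"
        by (simp add: power_mult_distrib mult_ac)
      then have "ennreal ((norm (?G x))\<^sup>2) \<le> ennreal (2 * (norm (G x))\<^sup>2 + 2 * L\<^sup>2 * (w x)\<^sup>2)"
        by (rule ennreal_leI)
      also have "\<dots> = ennreal (2 * (norm (G x))\<^sup>2) + ennreal (2 * L\<^sup>2 * (w x)\<^sup>2)"
        by (rule ennreal_plus) auto
      also have "ennreal (2 * (norm (G x))\<^sup>2) = 2 * ennreal ((norm (G x))\<^sup>2)" by (simp add: ennreal_mult)
      also have "ennreal (2 * L\<^sup>2 * (w x)\<^sup>2) = ennreal (2 * L\<^sup>2) * ennreal ((w x)\<^sup>2)" by (rule ennreal_mult) auto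
      finally show ?thesis using True \<open>x \<in> ball a \<rho>\<close> by simp
    next
      case False
      then have "?G x = 0" using \<theta>(5)[of x] by (simp add: s_def dist_norm norm_minus_commute)
      then show ?thesis by simp
    qed
  qed
  also have "\<dots> = 2 * (\<integral>\<^sup>+x. indicator (ball a \<rho>) x * ennreal ((norm (G x))\<^sup>2) \<partial>lborel)
      + ennreal (2 * L\<^sup>2) * (\<integral>\<^sup>+x. indicator (ball a s) x * ennreal ((w x)\<^sup>2) \<partial>lborel)"
    by (rule nn_integral_linear_combination) measurable
  also have "\<dots> \<le> 2 * (\<integral>\<^sup>+x. indicator (ball a \<rho>) x * ennreal ((norm (G x))\<^sup>2) \<partial>lborel)
      + ennreal (2 * L\<^sup>2) * (\<integral>\<^sup>+x. indicator (ball a \<rho>) x * ennreal (8 * s\<^sup>2 * (norm (G x))\<^sup>2 + 2 * (s / \<rho>) ^ 3 * (w x)\<^sup>2) \<partial>lborel)"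
    by (intro add_left_mono mult_left_mono L2_ball_estimate[OF C1c_fun_C1[OF w] s]) simp
  also have "\<dots> = (\<integral>\<^sup>+x. 2 * (indicator (ball a \<rho>) x * ennreal ((norm (G x))\<^sup>2))
      + ennreal (2 * L\<^sup>2) * (indicator (ball a \<rho>) x * ennreal (8 * s\<^sup>2 * (norm (G x))\<^sup>2 + 2 * (s / \<rho>) ^ 3 * (w x)\<^sup>2)) \<partial>lborel)"
    by (rule nn_integral_linear_combination[symmetric]) measurable
  also have "\<dots> = (\<integral>\<^sup>+x. indicator (ball a \<rho>) x * ennreal ((2 + 16 * \<Lambda>) * (norm (G x))\<^sup>2
          + 4 * \<Lambda> * \<kappa> * (r / \<rho> ^ 3) * (w x)\<^sup>2) \<partial>lborel)"
  proof (rule nn_integral_cong)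
    fix x
    let ?A = "(norm (G x))\<^sup>2" and ?B = "8 * s\<^sup>2 * (norm (G x))\<^sup>2 + 2 * (s / \<rho>) ^ 3 * (w x)\<^sup>2"
    have B: "?B \<ge> 0" using s by simp
    \<comment> \<open>Both terms contain \<open>L\<^sup>2 * s\<^sup>2\<close>, which is \<Lambda>;
      the mass term keeps one power of \<open>s = \<kappa> * r\<close> over
      \<open>\<rho> ^ 3\<close>.\<close>
    have "2 * L\<^sup>2 * ?B = 16 * (L\<^sup>2 * s\<^sup>2) * ?A + 4 * (L\<^sup>2 * s\<^sup>2) * (s / \<rho> ^ 3) * (w x)\<^sup>2"
      by (simp add: power_divide field_simps eval_nat_numeral)
    also have "\<dots> = 16 * \<Lambda> * ?A + 4 * \<Lambda> * \<kappa> * (r / \<rho> ^ 3) * (w x)\<^sup>2"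
      unfolding L\<Lambda> by (simp add: s_def)
    finally have e: "(2 + 16 * \<Lambda>) * ?A + 4 * \<Lambda> * \<kappa> * (r / \<rho> ^ 3) * (w x)\<^sup>2 = 2 * ?A + 2 * L\<^sup>2 * ?B"
      by (simp add: distrib_right)
    have "ennreal (2 * ?A + 2 * L\<^sup>2 * ?B) = ennreal (2 * ?A) + ennreal (2 * L\<^sup>2 * ?B)"
      using B by (intro ennreal_plus) auto
    also have "ennreal (2 * ?A) = 2 * ennreal ?A" by (simp add: ennreal_mult)
    also have "ennreal (2 * L\<^sup>2 * ?B) = ennreal (2 * L\<^sup>2) * ennreal ?B" using B by (intro ennreal_mult) auto
    finally show "2 * (indicator (ball a \<rho>) x * ennreal ?A) + ennreal (2 * L\<^sup>2) * (indicator (ball a \<rho>) x * ennreal ?B)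
      = indicator (ball a \<rho>) x * ennreal ((2 + 16 * \<Lambda>) * ?A + 4 * \<Lambda> * \<kappa> * (r / \<rho> ^ 3) * (w x)\<^sup>2)"
      unfolding e by (simp add: indicator_def)
  qed
  finally show ?thesis unfolding \<Lambda>_def .
qed

lemma exp_minus_mult_power2_le:
  fixes t :: real assumes "t \<ge> 0" shows "exp (- t) * t\<^sup>2 \<le> 2"
proof -
  have "1 + t + t\<^sup>2 / 2 \<le> exp t" by (rule exp_lower_Taylor_quadratic[OF assms])
  then have "t\<^sup>2 \<le> 2 * exp t" using assms by simp
  then have "exp (- t) * t\<^sup>2 \<le> exp (- t) * (2 * exp t)" by (rule mult_left_mono) simp
  also have "\<dots> = 2" by (simp add: exp_minus)
  finally show ?thesis .
qed

text \<open>The bracket is the gradient part of the local bound. In the last summand, 16 is the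
  local constant 4 times Hardy's constant 4, and \<open>32 * \<mu> + 2\<close> bounds the weight.
  For \<kappa> above 1 and nonnegative \<mu> the value is at least 1, so it also covers
  configurations with at most one particle.\<close>

definition form_const :: "real \<Rightarrow> real \<Rightarrow> real" where
  "form_const \<kappa> \<mu> = 1 + (2 + 16 * cutoff_const \<kappa>) + 16 * cutoff_const \<kappa> * \<kappa> * (32 * \<mu> + 2)"

text \<open>On the ball of radius \<open>\<rho>\<^sub>j = d\<^sub>j/2\<close> around \<open>x\<^sub>j\<close> the factor \<open>e\<^bsup>-|x\<^sub>j|\<^esup> r\<^sub>j \<rho>\<^sub>j\<^bsup>-3\<^esup>\<close> is at most a
  constant times \<open>|x|\<^bsup>-2\<^esup>\<close>, the weight in Hardy's inequality; these balls are disjoint.\<close>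

lemma weighted_Q_form_bound_C1c:
  fixes x :: "nat \<Rightarrow> real^3" and r d :: "nat \<Rightarrow> real"
  assumes w: "C1c_fun w G" and \<kappa>: "\<kappa> > 1" and \<mu>: "\<mu> \<ge> 0" and F: "finite F"
    and r: "\<And>j. j \<in> F \<Longrightarrow> r j > 0" and rd: "\<And>j. j \<in> F \<Longrightarrow> \<kappa> * r j \<le> d j / 2"
    and \<mu>d: "\<And>j. j \<in> F \<Longrightarrow> r j \<le> \<mu> * d j ^ 3"
    and dist: "\<And>j k. j \<in> F \<Longrightarrow> k \<in> F \<Longrightarrow> j \<noteq> k \<Longrightarrow> d j \<le> norm (x j - x k)"
  shows "(\<Sum>j\<in>F. exp (- norm (x j)) * (norm (Q_proj (x j) (r j) (abs_hom_sobolev w)))\<^sup>2)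
    \<le> form_const \<kappa> \<mu> * (norm (abs_hom_sobolev w))\<^sup>2"
proof -
  let ?q = "\<lambda>j. (norm (Q_proj (x j) (r j) (abs_hom_sobolev w)))\<^sup>2"
  note wc = C1c_fun_continuous[OF w]
  have [measurable]: "w \<in> borel_measurable borel" "G \<in> borel_measurable borel"
    using continuous_imp_borel wc by auto
  have [measurable]: "ball c t \<in> sets borel" for c :: "real^3" and t by simp
  define \<Lambda> where "\<Lambda> = cutoff_const \<kappa>"
  have \<Lambda>0: "\<Lambda> \<ge> 0" by (simp add: \<Lambda>_def cutoff_const_def)
  define \<rho> where "\<rho> j = d j / 2" for j
  have \<rho>: "\<rho> j > 0" "r j \<le> \<rho> j" "r j / \<rho> j ^ 3 \<le> 8 * \<mu>" if "j \<in> F" for j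
  proof -
    have "r j \<le> \<kappa> * r j" using r[OF that] \<kappa> by simp
    then show 1: "r j \<le> \<rho> j" using rd[OF that] by (simp add: \<rho>_def)
    then show 2: "\<rho> j > 0" using r[OF that] by simp
    \<comment> \<open>The factor 8 comes from halving \<open>d j\<close>.\<close>
    show "r j / \<rho> j ^ 3 \<le> 8 * \<mu>"
      using \<mu>d[OF that] 2 by (simp add: \<rho>_def field_simps power_divide)
  qed
  let ?e = "\<lambda>j. exp (- norm (x j))"
  define h where "h y = ennreal ((2 + 16 * \<Lambda>) * (norm (G y))\<^sup>2) + ennreal (4 * \<Lambda> * \<kappa> * (32 * \<mu> + 2)) * ennreal ((w y)\<^sup>2 / (norm y)\<^sup>2)" for y
  have [measurable]: "h \<in> borel_measurable borel" unfolding h_def[abs_def] by measurable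
  \<comment> \<open>\<open>norm y\<close> is split into \<open>norm (x j)\<close> and
    \<open>\<rho> j\<close>. The first part is tamed by the exponential together with the density
    bound, where \<open>32 = 2 * 8 * 2\<close>; for the second, \<open>r j \<le> \<rho> j\<close> is
    enough.\<close>
  have weight: "?e j * (r j / \<rho> j ^ 3) * (norm y)\<^sup>2 \<le> 32 * \<mu> + 2" if j: "j \<in> F" and y: "y \<in> ball (x j) (\<rho> j)" for j y
  proof -
    have "norm y \<le> norm (x j) + \<rho> j"
      using y norm_triangle_sub[of y "x j"] by (simp add: dist_norm norm_minus_commute)
    then have "(norm y)\<^sup>2 \<le> (norm (x j) + \<rho> j)\<^sup>2" by (intro power_mono) auto
    also have "\<dots> \<le> 2 * (norm (x j))\<^sup>2 + 2 * (\<rho> j)\<^sup>2"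
      using zero_le_power2[of "norm (x j) - \<rho> j"] by (simp add: power2_sum power2_diff)
    finally have "?e j * (r j / \<rho> j ^ 3) * (norm y)\<^sup>2 \<le> ?e j * (r j / \<rho> j ^ 3) * (2 * (norm (x j))\<^sup>2 + 2 * (\<rho> j)\<^sup>2)"
      using r[OF j] \<rho>[OF j] by (intro mult_left_mono) auto
    also have "\<dots> = 2 * (r j / \<rho> j ^ 3) * (?e j * (norm (x j))\<^sup>2) + 2 * ?e j * (r j / \<rho> j)"
      using \<rho>(1)[OF j] by (simp add: field_simps eval_nat_numeral)
    also have "\<dots> \<le> 2 * (8 * \<mu>) * 2 + 2 * 1 * 1"
    proof (intro add_mono mult_mono)
      show "?e j * (norm (x j))\<^sup>2 \<le> 2" by (rule exp_minus_mult_power2_le) simp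
      show "r j / \<rho> j \<le> 1" using \<rho>[OF j] by simp
    qed (use r[OF j] \<rho>[OF j] \<mu> in auto)
    finally show ?thesis by simp
  qed
  have single: "ennreal (?e j * ?q j)
      \<le> (\<integral>\<^sup>+y. indicator (ball (x j) (\<rho> j)) y * h y \<partial>lborel)" if j: "j \<in> F" for j
  proof -
    have "ennreal (?e j * ?q j)
      = ennreal (?e j) * ennreal (?q j)"
      by (rule ennreal_mult) auto
    also have "\<dots> \<le> ennreal (?e j) * (\<integral>\<^sup>+y. indicator (ball (x j) (\<rho> j)) y * ennreal ((2 + 16 * \<Lambda>) * (norm (G y))\<^sup>2
          + 4 * \<Lambda> * \<kappa> * (r j / \<rho> j ^ 3) * (w y)\<^sup>2) \<partial>lborel)"
      unfolding \<Lambda>_def using rd[OF j]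
      by (intro mult_left_mono Q_proj_local_bound w r[OF j] \<kappa>) (auto simp: \<rho>_def)
    also have "\<dots> = (\<integral>\<^sup>+y. ennreal (?e j) * (indicator (ball (x j) (\<rho> j)) y * ennreal ((2 + 16 * \<Lambda>) * (norm (G y))\<^sup>2
          + 4 * \<Lambda> * \<kappa> * (r j / \<rho> j ^ 3) * (w y)\<^sup>2)) \<partial>lborel)"
      by (rule nn_integral_cmult[symmetric]) measurable
    also have "\<dots> \<le> (\<integral>\<^sup>+y. indicator (ball (x j) (\<rho> j)) y * h y \<partial>lborel)"
    proof (rule nn_integral_mono_AE)
      \<comment> \<open>The origin is excluded because Hardy's weight is inserted by multiplying and
        dividing by \<open>(norm y)\<^sup>2\<close>.\<close>
      have "AE y in lborel. y \<noteq> (0 :: real^3)" by (rule AE_lborel_singleton)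
      then show "AE y in lborel. ennreal (?e j) * (indicator (ball (x j) (\<rho> j)) y * ennreal ((2 + 16 * \<Lambda>) * (norm (G y))\<^sup>2
          + 4 * \<Lambda> * \<kappa> * (r j / \<rho> j ^ 3) * (w y)\<^sup>2)) \<le> indicator (ball (x j) (\<rho> j)) y * h y"
      proof eventually_elim
        fix y :: "real^3" assume "y \<noteq> 0"
        show "ennreal (?e j) * (indicator (ball (x j) (\<rho> j)) y * ennreal ((2 + 16 * \<Lambda>) * (norm (G y))\<^sup>2
          + 4 * \<Lambda> * \<kappa> * (r j / \<rho> j ^ 3) * (w y)\<^sup>2)) \<le> indicator (ball (x j) (\<rho> j)) y * h y"
        proof (cases "y \<in> ball (x j) (\<rho> j)")
          case True
          let ?a = "(2 + 16 * \<Lambda>) * (norm (G y))\<^sup>2" and ?q = "(w y)\<^sup>2 / (norm y)\<^sup>2"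
          have "?e j * (?a + 4 * \<Lambda> * \<kappa> * (r j / \<rho> j ^ 3) * (w y)\<^sup>2)
            = ?e j * ?a + 4 * \<Lambda> * \<kappa> * (?e j * (r j / \<rho> j ^ 3) * (norm y)\<^sup>2) * ?q"
            using \<open>y \<noteq> 0\<close> by (simp add: field_simps)
          also have "\<dots> \<le> 1 * ?a + 4 * \<Lambda> * \<kappa> * (32 * \<mu> + 2) * ?q"
            using \<Lambda>0 \<kappa> weight[OF j True] by (intro add_mono mult_right_mono mult_left_mono) auto
          finally have "ennreal (?e j * (?a + 4 * \<Lambda> * \<kappa> * (r j / \<rho> j ^ 3) * (w y)\<^sup>2))
              \<le> ennreal (?a + 4 * \<Lambda> * \<kappa> * (32 * \<mu> + 2) * ?q)" by (intro ennreal_leI) simp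
          also have "\<dots> = ennreal ?a + ennreal (4 * \<Lambda> * \<kappa> * (32 * \<mu> + 2) * ?q)"
            using \<Lambda>0 \<kappa> \<mu> by (intro ennreal_plus) auto
          also have "ennreal (4 * \<Lambda> * \<kappa> * (32 * \<mu> + 2) * ?q) = ennreal (4 * \<Lambda> * \<kappa> * (32 * \<mu> + 2)) * ennreal ?q"
            using \<Lambda>0 \<kappa> \<mu> by (intro ennreal_mult) auto
          finally have "ennreal (?e j * (?a + 4 * \<Lambda> * \<kappa> * (r j / \<rho> j ^ 3) * (w y)\<^sup>2)) \<le> h y"
            by (simp add: h_def)
          moreover have "ennreal (?e j * (?a + 4 * \<Lambda> * \<kappa> * (r j / \<rho> j ^ 3) * (w y)\<^sup>2))
              = ennreal (?e j) * ennreal (?a + 4 * \<Lambda> * \<kappa> * (r j / \<rho> j ^ 3) * (w y)\<^sup>2)"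
            using \<Lambda>0 \<kappa> r[OF j] \<rho>(1)[OF j] by (intro ennreal_mult) auto
          ultimately show ?thesis using True by simp
        qed simp
      qed
    qed
    finally show ?thesis .
  qed
  have disj: "(\<Sum>j\<in>F. indicator (ball (x j) (\<rho> j)) y :: ennreal) \<le> 1" for y
  proof (cases "\<exists>j\<in>F. y \<in> ball (x j) (\<rho> j)")
    case True
    then obtain j where j: "j \<in> F" "y \<in> ball (x j) (\<rho> j)" by blast
    have "y \<notin> ball (x k) (\<rho> k)" if "k \<in> F - {j}" for k
    proof
      assume "y \<in> ball (x k) (\<rho> k)"
      then have "norm (x j - x k) < \<rho> j + \<rho> k"
        using j norm_triangle_ineq4[of "x j - y" "x k - y"] by (simp add: dist_norm)
      \<comment> \<open>Both \<open>d j\<close> and \<open>d k\<close> are bounded by the distance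
        of the two centres, so the half radii add up to at most that distance.\<close>
      moreover have "d j \<le> norm (x j - x k)" "d k \<le> norm (x j - x k)"
        using dist[of j k] dist[of k j] j that by (auto simp: norm_minus_commute)
      ultimately show False by (simp add: \<rho>_def)
    qed
    then have "(\<Sum>k\<in>F - {j}. indicator (ball (x k) (\<rho> k)) y :: ennreal) = 0" by (intro sum.neutral) simp
    then show ?thesis using j F by (subst sum.remove[of F j]) auto
  next
    case False
    then have "(\<Sum>j\<in>F. indicator (ball (x j) (\<rho> j)) y :: ennreal) = 0" by (intro sum.neutral) simp
    then show ?thesis by simp
  qed
  define N where "N = (LINT y|lborel. (norm (G y))\<^sup>2)"
  have Gi: "integrable lborel (\<lambda>y. (norm (G y))\<^sup>2)" using C1c_fun_sobolev(2)[OF w] by (simp add: L2_field_def)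
  have N: "(\<integral>\<^sup>+y. ennreal ((norm (G y))\<^sup>2) \<partial>lborel) = ennreal N" "N \<ge> 0"
    unfolding N_def by (auto intro!: nn_integral_eq_integral Gi)
  have "ennreal (\<Sum>j\<in>F. ?e j * ?q j)
      = (\<Sum>j\<in>F. ennreal (?e j * ?q j))"
    by (rule sum_ennreal[symmetric]) simp
  also have "\<dots> \<le> (\<Sum>j\<in>F. \<integral>\<^sup>+y. indicator (ball (x j) (\<rho> j)) y * h y \<partial>lborel)"
    by (intro sum_mono single)
  also have "\<dots> = (\<integral>\<^sup>+y. (\<Sum>j\<in>F. indicator (ball (x j) (\<rho> j)) y * h y) \<partial>lborel)"
    by (rule nn_integral_sum[symmetric]) measurable
  also have "\<dots> \<le> (\<integral>\<^sup>+y. h y \<partial>lborel)"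
  proof (intro nn_integral_mono)
    show "(\<Sum>j\<in>F. indicator (ball (x j) (\<rho> j)) y * h y) \<le> h y" for y
      using mult_right_mono[OF disj[of y], of "h y"] by (simp add: sum_distrib_right)
  qed
  also have "\<dots> = (\<integral>\<^sup>+y. ennreal (2 + 16 * \<Lambda>) * ennreal ((norm (G y))\<^sup>2) + ennreal (4 * \<Lambda> * \<kappa> * (32 * \<mu> + 2)) * ennreal ((w y)\<^sup>2 / (norm y)\<^sup>2) \<partial>lborel)"
    unfolding h_def using \<Lambda>0 by (intro nn_integral_cong arg_cong2[of _ _ _ _ "(+)"] ennreal_mult) auto
  also have "\<dots> = ennreal (2 + 16 * \<Lambda>) * (\<integral>\<^sup>+y. ennreal ((norm (G y))\<^sup>2) \<partial>lborel)
      + ennreal (4 * \<Lambda> * \<kappa> * (32 * \<mu> + 2)) * (\<integral>\<^sup>+y. ennreal ((w y)\<^sup>2 / (norm y)\<^sup>2) \<partial>lborel)"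
    by (rule nn_integral_linear_combination) measurable
  also have "\<dots> \<le> ennreal (2 + 16 * \<Lambda>) * ennreal N + ennreal (4 * \<Lambda> * \<kappa> * (32 * \<mu> + 2)) * (4 * ennreal N)"
    unfolding N(1)[symmetric] by (intro add_left_mono mult_left_mono Hardy_inequality[OF w]) simp
  also have "\<dots> = ennreal ((2 + 16 * \<Lambda>) * N) + ennreal (4 * \<Lambda> * \<kappa> * (32 * \<mu> + 2) * (4 * N))"
  proof -
    have "4 * ennreal N = ennreal (4 * N)" using N(2) by (simp add: ennreal_mult)
    moreover have "ennreal ((2 + 16 * \<Lambda>) * N) = ennreal (2 + 16 * \<Lambda>) * ennreal N"
      using \<Lambda>0 N(2) by (intro ennreal_mult) auto
    moreover have "ennreal (4 * \<Lambda> * \<kappa> * (32 * \<mu> + 2) * (4 * N)) = ennreal (4 * \<Lambda> * \<kappa> * (32 * \<mu> + 2)) * ennreal (4 * N)"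
      using \<Lambda>0 \<kappa> \<mu> N(2) by (intro ennreal_mult) auto
    ultimately show ?thesis by (simp only:)
  qed
  also have "\<dots> = ennreal ((2 + 16 * \<Lambda>) * N + 4 * \<Lambda> * \<kappa> * (32 * \<mu> + 2) * (4 * N))"
    using \<Lambda>0 \<kappa> \<mu> N(2) by (intro ennreal_plus[symmetric]) auto
  finally have "(\<Sum>j\<in>F. ?e j * ?q j)
      \<le> (2 + 16 * \<Lambda>) * N + 4 * \<Lambda> * \<kappa> * (32 * \<mu> + 2) * (4 * N)"
    using \<Lambda>0 \<kappa> \<mu> N(2) by (subst (asm) ennreal_le_iff) auto
  also have "\<dots> \<le> form_const \<kappa> \<mu> * N"
    using N(2) by (simp add: form_const_def \<Lambda>_def algebra_simps)
  also have "N = (norm (abs_hom_sobolev w))\<^sup>2"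
    unfolding N_def by (rule norm_abs_hom_sobolev[OF C1c_fun_has_grad[OF w], symmetric])
  finally show ?thesis .
qed


lemma closed_form_bound:
  fixes T :: "'i \<Rightarrow> 'a::real_normed_vector \<Rightarrow> 'a"
  assumes "\<And>j. bounded_linear (T j)"
    and dense: "closure D = UNIV" and D: "\<And>w. w \<in> D \<Longrightarrow> (\<Sum>j\<in>F. c j * (norm (T j w))\<^sup>2) \<le> C * (norm w)\<^sup>2"
  shows "(\<Sum>j\<in>F. c j * (norm (T j w))\<^sup>2) \<le> C * (norm w)\<^sup>2"
proof -
  have "closed {w. (\<Sum>j\<in>F. c j * (norm (T j w))\<^sup>2) \<le> C * (norm w)\<^sup>2}"
    by (intro closed_Collect_le continuous_intros bounded_linear.continuous_on[OF assms(1)])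
  then have "closure D \<subseteq> {w. (\<Sum>j\<in>F. c j * (norm (T j w))\<^sup>2) \<le> C * (norm w)\<^sup>2}"
    by (rule closure_minimal[rotated]) (use D in auto)
  then show ?thesis using dense by auto
qed

text \<open>With at least two particles all nearest distances are finite, and the hypotheses turn
  into real inequalities. Otherwise a nearest distance can be infinite, and the norm bound for a
  single projection is used instead.\<close>

lemma weighted_Q_form_bound:
  assumes \<kappa>: "\<kappa> > 1" and \<mu>: "\<mu>\<^sub>0 < \<infinity>" and r: "\<forall>j\<in>I. r j > 0"
    and cap: "capacity_density I x r = \<mu>\<^sub>0"
    and sep: "\<forall>j\<in>I. nearest_dist I x j / 2 > ennreal (\<kappa> * r j)"
    and F: "finite F" "F \<subseteq> I"
  shows "(\<Sum>j\<in>F. exp (- norm (x j)) * (norm (Q_proj (x j) (r j) w))\<^sup>2)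
    \<le> form_const \<kappa> (enn2real \<mu>\<^sub>0) * (norm w)\<^sup>2"
proof -
  define \<mu> where "\<mu> = enn2real \<mu>\<^sub>0"
  have \<mu>: "\<mu>\<^sub>0 = ennreal \<mu>" "\<mu> \<ge> 0" using \<mu> by (auto simp: \<mu>_def)
  have \<Lambda>0: "cutoff_const \<kappa> \<ge> 0" by (simp add: cutoff_const_def)
  show ?thesis unfolding \<mu>_def[symmetric]
  proof (cases "\<exists>i. I \<subseteq> {i}")
    case True
    then obtain i where "F \<subseteq> {i}" using F by blast
    then have "(\<Sum>j\<in>F. exp (- norm (x j)) * (norm (Q_proj (x j) (r j) w))\<^sup>2)
        \<le> (\<Sum>j\<in>{i}. exp (- norm (x j)) * (norm (Q_proj (x j) (r j) w))\<^sup>2)"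
      by (intro sum_mono2) auto
    also have "\<dots> \<le> 1 * (norm w)\<^sup>2"
    proof -
      have "exp (- norm (x i)) * (norm (Q_proj (x i) (r i) w))\<^sup>2 \<le> 1 * (norm w)\<^sup>2"
        by (intro mult_mono power_mono norm_Q_proj_le) auto
      then show ?thesis by simp
    qed
    also have "\<dots> \<le> form_const \<kappa> \<mu> * (norm w)\<^sup>2"
    proof (rule mult_right_mono)
      have "16 * cutoff_const \<kappa> * \<kappa> * (32 * \<mu> + 2) \<ge> 0" using \<Lambda>0 \<kappa> \<mu>(2) by simp
      then show "1 \<le> form_const \<kappa> \<mu>" unfolding form_const_def using \<Lambda>0 by linarith
    qed simp
    finally show "(\<Sum>j\<in>F. exp (- norm (x j)) * (norm (Q_proj (x j) (r j) w))\<^sup>2) \<le> form_const \<kappa> \<mu> * (norm w)\<^sup>2" .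
  next
    case False
    define d where "d j = enn2real (nearest_dist I x j)" for j
    have le: "nearest_dist I x j \<le> ennreal (norm (x j - x k))" if "k \<in> I" "k \<noteq> j" for j k
      unfolding nearest_dist_def using that by (intro INF_lower) auto
    have d: "nearest_dist I x j = ennreal (d j)" "d j \<ge> 0" for j
    proof -
      obtain k where "k \<in> I" "k \<noteq> j" using False by blast
      from le[OF this] have "nearest_dist I x j < top" by (rule order_le_less_trans) simp
      then show "nearest_dist I x j = ennreal (d j)" "d j \<ge> 0" by (auto simp: d_def)
    qed
    have rd: "\<kappa> * r j < d j / 2" if "j \<in> I" for j
    proof -
      have "ennreal (\<kappa> * r j) < ennreal (d j) / ennreal 2" using sep that d by simp
      also have "\<dots> = ennreal (d j / 2)" using d(2) by (intro divide_ennreal) auto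
      finally show ?thesis using \<kappa> r that by (subst (asm) ennreal_less_iff) (auto intro: mult_nonneg_nonneg less_imp_le)
    qed
    have dpos: "d j > 0" if "j \<in> I" for j
    proof -
      have "\<kappa> * r j > 0" using \<kappa> r that by simp
      then show ?thesis using rd[OF that] by simp
    qed
    have \<mu>d: "r j \<le> \<mu> * d j ^ 3" if "j \<in> I" for j
    proof -
      have "ennreal (r j) * inverse (nearest_dist I x j ^ 3) \<le> \<mu>\<^sub>0"
        unfolding cap[symmetric] capacity_density_def using that by (rule SUP_upper)
      also have "ennreal (r j) * inverse (nearest_dist I x j ^ 3) = ennreal (r j * inverse (d j ^ 3))"
      proof -
        have "inverse (ennreal (d j) ^ 3) = ennreal (inverse (d j ^ 3))"
          using dpos[OF that] by (simp add: ennreal_power inverse_ennreal)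
        moreover have "ennreal (r j * inverse (d j ^ 3)) = ennreal (r j) * ennreal (inverse (d j ^ 3))"
          using dpos[OF that] r that by (intro ennreal_mult) auto
        ultimately show ?thesis unfolding d(1)[of j] by (simp only:)
      qed
      finally have "r j * inverse (d j ^ 3) \<le> \<mu>" using \<mu> by simp
      then show ?thesis using dpos[OF that] by (simp add: field_simps)
    qed
    have dist: "d j \<le> norm (x j - x k)" if "j \<in> I" "k \<in> I" "j \<noteq> k" for j k
      using le[of k j] that d by simp
    show "(\<Sum>j\<in>F. exp (- norm (x j)) * (norm (Q_proj (x j) (r j) w))\<^sup>2) \<le> form_const \<kappa> \<mu> * (norm w)\<^sup>2"
    \<comment> \<open>For fixed \<open>F\<close> both sides are continuous in \<open>w\<close>, so
      the dense subspace suffices.\<close>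
    proof (rule closed_form_bound[OF bounded_linear_Q_proj closure_hom_compact])
      fix w assume "w \<in> hom_compact"
      then obtain \<phi> G where \<phi>: "w = abs_hom_sobolev \<phi>" "C1c_fun \<phi> G" by (auto simp: hom_compact_def)
      show "(\<Sum>j\<in>F. exp (- norm (x j)) * (norm (Q_proj (x j) (r j) w))\<^sup>2) \<le> form_const \<kappa> \<mu> * (norm w)\<^sup>2"
        unfolding \<phi>(1)
      proof (rule weighted_Q_form_bound_C1c[OF \<phi>(2) \<kappa> \<mu>(2) F(1), of r d])
        show "r j > 0" if "j \<in> F" for j using r F that by auto
        show "\<kappa> * r j \<le> d j / 2" if "j \<in> F" for j using rd[of j] F that by auto
        show "r j \<le> \<mu> * d j ^ 3" if "j \<in> F" for j using \<mu>d[of j] F that by auto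
        show "d j \<le> norm (x j - x k)" if "j \<in> F" "k \<in> F" "j \<noteq> k" for j k using dist[of j k] F that by auto
      qed
    qed
  qed
qed

text \<open>Positive radii identify the closure of an open ball with the closed ball, and countably
  many exceptional null sets form a null set.\<close>

lemma vanishes_on_particle_union:
  assumes "\<forall>j\<in>I. r j > 0"
  shows "{v. vanishes_on v (particle_union I x r)} = (\<Inter>j\<in>I. {v. vanishes_on v (cball (x j) (r j))})"
proof (rule set_eqI)
  fix v
  obtain f g where f: "has_grad f g" "v = abs_hom_sobolev f" by (rule hom_sobolev_cases)
  note V = vanishes_on_abs[OF has_grad_sobolev[OF f(1)]]
  have "(AE y in lborel. y \<in> particle_union I x r \<longrightarrow> f y = 0)
      \<longleftrightarrow> (AE y in lborel. \<forall>j\<in>I. y \<in> cball (x j) (r j) \<longrightarrow> f y = 0)"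
  proof -
    have "(y \<in> particle_union I x r \<longrightarrow> f y = 0) \<longleftrightarrow> (\<forall>j\<in>I. y \<in> cball (x j) (r j) \<longrightarrow> f y = 0)" for y
      using assms by (auto simp: particle_union_def)
    then show ?thesis by (simp only:)
  qed
  also have "\<dots> \<longleftrightarrow> (\<forall>j\<in>I. AE y in lborel. y \<in> cball (x j) (r j) \<longrightarrow> f y = 0)"
    by (rule AE_ball_countable) simp
  finally show "v \<in> {v. vanishes_on v (particle_union I x r)} \<longleftrightarrow> v \<in> (\<Inter>j\<in>I. {v. vanishes_on v (cball (x j) (r j))})"
    by (simp add: f(2) V)
qed

text \<open>\<open>inv\<close> yields a genuine preimage only on the range of
  \<open>neg_laplacian\<close>; the Riesz representation shows that every functional lies in
  it.\<close>

lemma neg_laplacian_inv: "inv neg_laplacian f \<bullet> v = blinfun_apply f v"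
proof -
  obtain u where u: "\<forall>v. u \<bullet> v = blinfun_apply f v" using Riesz_representation[of f] by blast
  have "neg_laplacian u = f"
    by (rule blinfun_eqI) (simp add: neg_laplacian_def u)
  then have "neg_laplacian (inv neg_laplacian f) = f" by (intro f_inv_into_f) auto
  then have "blinfun_apply (neg_laplacian (inv neg_laplacian f)) v = blinfun_apply f v" by simp
  then show ?thesis by (simp add: neg_laplacian_def)
qed

theorem theorem1p3:
  fixes \<kappa> :: real and \<mu>\<^sub>0 :: ennreal
  assumes "\<kappa> > 1" and "\<mu>\<^sub>0 < \<infinity>"
  shows "\<exists>\<gamma>\<^sub>0::real. \<gamma>\<^sub>0 > 0 \<and>
    (\<forall>(I :: nat set) (x :: nat \<Rightarrow> real^3) (r :: nat \<Rightarrow> real).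
       (\<forall>j\<in>I. r j > 0) \<longrightarrow>
       capacity_density I x r = \<mu>\<^sub>0 \<longrightarrow>
       (\<forall>j\<in>I. nearest_dist I x j / 2 > ennreal (\<kappa> * r j)) \<longrightarrow>
       (\<forall>(f :: hom_sobolev \<Rightarrow>\<^sub>L real) (\<gamma> :: real). 0 < \<gamma> \<longrightarrow> \<gamma> < \<gamma>\<^sub>0 \<longrightarrow>
          (\<forall>w. (\<lambda>j. weighted_Q x r j w) summable_on I) \<and>
          (\<exists>!u. is_solution (particle_union I x r) f u) \<and>
          (\<forall>u. is_solution (particle_union I x r) f u \<longrightarrow>
             (\<lambda>N. ((\<lambda>w. w - \<gamma> *\<^sub>R (\<Sum>\<^sub>\<infinity>j\<in>I. weighted_Q x r j w)) ^^ N) (inv neg_laplacian f))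
               \<longlonglongrightarrow> u)))"
proof -
  define C where "C = form_const \<kappa> (enn2real \<mu>\<^sub>0)"
  have "cutoff_const \<kappa> \<ge> 0" by (simp add: cutoff_const_def)
  then have "16 * cutoff_const \<kappa> * \<kappa> * (32 * enn2real \<mu>\<^sub>0 + 2) \<ge> 0" using \<open>\<kappa> > 1\<close> by simp
  with \<open>cutoff_const \<kappa> \<ge> 0\<close> have C: "C > 0" unfolding C_def form_const_def by linarith
  show ?thesis
  \<comment> \<open>Below this value \<gamma> times the operator has quadratic form at most
    \<open>(norm w)\<^sup>2\<close>. The constant is fixed from \<kappa> and
    \<open>\<mu>\<^sub>0\<close> before any configuration is introduced.\<close>
  proof (intro exI[of _ "1 / C"] conjI allI impI)
    show "1 / C > 0" using C by simp
    fix I :: "nat set" and x :: "nat \<Rightarrow> real^3" and r :: "nat \<Rightarrow> real" and f :: "hom_sobolev \<Rightarrow>\<^sub>L real" and \<gamma> :: real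
    assume r: "\<forall>j\<in>I. r j > 0" and cap: "capacity_density I x r = \<mu>\<^sub>0"
      and sep: "\<forall>j\<in>I. nearest_dist I x j / 2 > ennreal (\<kappa> * r j)"
      and \<gamma>: "0 < \<gamma>" "\<gamma> < 1 / C"
    define W where "W j = {v. vanishes_on v (cball (x j) (r j))}" for j
    have W: "subspace (W j)" "closed (W j)" for j
      unfolding W_def by (auto intro: subspace_vanishes_on closed_vanishes_on)
    have Q: "Q_proj (x j) (r j) = orth_proj (orthogonal_comp (W j))" for j
      by (simp add: Q_proj_def W_def)
    have bound: "(\<Sum>j\<in>F. exp (- norm (x j)) * (norm (orth_proj (orthogonal_comp (W j)) w))\<^sup>2) \<le> C * (norm w)\<^sup>2"
      if "finite F" "F \<subseteq> I" for F w
      using weighted_Q_form_bound[OF assms r cap sep that, of w] by (simp add: C_def Q)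
    have \<gamma>C: "\<gamma> * C \<le> 1" using \<gamma> C by (simp add: field_simps)
    note iter = projection_series_iteration[of I W "\<lambda>j. exp (- norm (x j))" C \<gamma>, OF W exp_gt_zero bound C \<gamma>(1) \<gamma>C]
    show "(\<lambda>j. weighted_Q x r j w) summable_on I" for w
      using iter(1)[of w] by (simp add: weighted_Q_def Q)
    let ?K = "particle_union I x r" and ?z = "inv neg_laplacian f"
    define V where "V = {v. vanishes_on v ?K}"
    have V: "V = (\<Inter>j\<in>I. W j)" unfolding V_def W_def by (rule vanishes_on_particle_union[OF r])
    have VP: "subspace V" "complete V"
      using subspace_vanishes_on[of ?K] W by (auto simp: V_def[symmetric] V complete_eq_closed intro!: subspace_Inter closed_INT)
    \<comment> \<open>A weak solution is an element of \<open>V\<close> whose inner products with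
      \<open>V\<close> agree with those of the Riesz representative of \<open>f\<close>; this
      characterizes the projection, so existence and uniqueness come with it.\<close>
    have sol: "is_solution ?K f u \<longleftrightarrow> u = orth_proj V ?z" for u
    proof -
      have "is_solution ?K f u \<longleftrightarrow> u \<in> V \<and> (\<forall>v\<in>V. u \<bullet> v = ?z \<bullet> v)"
        by (simp add: is_solution_def V_def neg_laplacian_inv)
      also have "\<dots> \<longleftrightarrow> u \<in> V \<and> ?z - u \<in> orthogonal_comp V"
        by (auto simp: mem_orthogonal_comp inner_diff_left)
      also have "\<dots> \<longleftrightarrow> u = orth_proj V ?z"
        using orth_proj_eqI[OF VP(1), of u ?z] orth_proj_in[OF VP, of ?z] orth_proj_diff[OF VP, of ?z] by auto
      finally show ?thesis .
    qed
    show "\<exists>!u. is_solution ?K f u" unfolding sol by simp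
    fix u assume "is_solution ?K f u"
    then have "u = orth_proj (\<Inter>j\<in>I. W j) ?z" by (simp add: sol V)
    then show "(\<lambda>N. ((\<lambda>w. w - \<gamma> *\<^sub>R (\<Sum>\<^sub>\<infinity>j\<in>I. weighted_Q x r j w)) ^^ N) ?z) \<longlonglongrightarrow> u"
      using iter(2)[of ?z] by (simp add: weighted_Q_def Q)
  qed
qed

end
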